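(* Let $d\ge 3$ and let $E\subset\mathbb{R}^d$ be compact with $\dim_{\mathcal H}(E)>(2d+2)/3$. Then the set of similarity classes of triangles with vertices in $E$, $$\Big\{\big[\,|x-y| : |x-z| : |y-z|\,\big]\in\mathbb{R}\mathbb{P}^2 \ :\ x,y,z\in E \text{ are distinct}\Big\},$$ has nonempty interior in the real projective plane $\mathbb{R}\mathbb{P}^2$.
   Context: $\dim_{\mathcal H}$ denotes Hausdorff dimension, $|\cdot|$ the Euclidean norm on $\mathbb{R}^d$, and $[A:B:C]$ the standard homogeneous (projective) coordinates on $\mathbb{R}\mathbb{P}^2$. *)

theory Defs
  imports "HOL-Analysis.Analysis"
begin

section \<open>Hausdorff measure and Hausdorff dimension\<close>

(* The gauge (diam U)^s, with the usual conventions: the empty set contributes 0, and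
   (diam U)^0 = 1 for nonempty U.  The case s = 0 is split off because 0 powr 0 = 0. *)
definition diam_gauge :: "real \<Rightarrow> 'a::metric_space set \<Rightarrow> ennreal" where
  "diam_gauge s U =
     (if U = {} then 0 else if s = 0 then 1 else ennreal (diameter U powr s))"

(* Boundedness is required explicitly because the library's real-valued diameter is
   meaningless on unbounded sets.  Finite covers are included by padding with {}. *)
definition hausdorff_premeasure :: "real \<Rightarrow> real \<Rightarrow> 'a::metric_space set \<Rightarrow> ennreal" where
  "hausdorff_premeasure s \<delta> E =
     (INF U \<in> {U :: nat \<Rightarrow> 'a set.
                 E \<subseteq> (\<Union>i. U i) \<and> (\<forall>i. bounded (U i) \<and> diameter (U i) \<le> \<delta>)}.
        (\<Sum>i. diam_gauge s (U i)))"

definition hausdorff_measure :: "real \<Rightarrow> 'a::metric_space set \<Rightarrow> ennreal" where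
  "hausdorff_measure s E = (SUP \<delta> \<in> {0<..}. hausdorff_premeasure s \<delta> E)"

definition hausdorff_dim :: "'a::metric_space set \<Rightarrow> ereal" where
  "hausdorff_dim E = Inf {ereal s | s. 0 \<le> s \<and> hausdorff_measure s E = 0}"

section \<open>The real projective plane\<close>

definition proj_class :: "real^3 \<Rightarrow> (real^3) set" where
  "proj_class v = {c *\<^sub>R v | c. c \<noteq> 0}"

lemma proj_class_eq_iff: "proj_class v = proj_class w \<longleftrightarrow> (\<exists>c. c \<noteq> 0 \<and> w = c *\<^sub>R v)"
proof
  assume eq: "proj_class v = proj_class w"
  have "w \<in> proj_class w"
    unfolding proj_class_def by (auto intro: exI[of _ 1])
  with eq show "\<exists>c. c \<noteq> 0 \<and> w = c *\<^sub>R v"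
    unfolding proj_class_def by auto
next
  assume "\<exists>c. c \<noteq> 0 \<and> w = c *\<^sub>R v"
  then obtain c where c: "c \<noteq> 0" "w = c *\<^sub>R v" by blast
  have "a *\<^sub>R v \<in> proj_class w" if "a \<noteq> 0" for a
    unfolding proj_class_def using c that by (auto intro!: exI[of _ "a / c"])
  moreover have "a *\<^sub>R w \<in> proj_class v" if "a \<noteq> 0" for a
    unfolding proj_class_def using c that by (auto intro!: exI[of _ "a * c"])
  ultimately show "proj_class v = proj_class w"
    unfolding proj_class_def[of v] proj_class_def[of w] by (auto simp: proj_class_def)
qed

(* The quotient topology on (R^3 - {0}) / R^*; see RP2_quotient_map below. *)
definition RP2 :: "(real^3) set topology" where
  "RP2 = topology (\<lambda>W. W \<subseteq> proj_class ` (- {0}) \<and> open {v. v \<noteq> 0 \<and> proj_class v \<in> W})"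

lemma openin_RP2:
  "openin RP2 W \<longleftrightarrow> W \<subseteq> proj_class ` (- {0}) \<and> open {v. v \<noteq> 0 \<and> proj_class v \<in> W}"
proof -
  let ?P = "\<lambda>W. W \<subseteq> proj_class ` (- {0}) \<and> open {v. v \<noteq> 0 \<and> proj_class v \<in> W}"
  have "istopology ?P"
    unfolding istopology_def
  proof (intro conjI allI impI)
    fix S T assume "?P S" "?P T"
    moreover have "{v. v \<noteq> 0 \<and> proj_class v \<in> S \<inter> T} =
        {v. v \<noteq> 0 \<and> proj_class v \<in> S} \<inter> {v. v \<noteq> 0 \<and> proj_class v \<in> T}"
      by auto
    ultimately show "S \<inter> T \<subseteq> proj_class ` (- {0})"
      and "open {v. v \<noteq> 0 \<and> proj_class v \<in> S \<inter> T}"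
      by (auto simp only: open_Int)
  next
    fix \<K> assume K: "\<forall>W\<in>\<K>. ?P W"
    then show "\<Union>\<K> \<subseteq> proj_class ` (- {0})" by blast
    have "{v. v \<noteq> 0 \<and> proj_class v \<in> \<Union>\<K>} = (\<Union>W\<in>\<K>. {v. v \<noteq> 0 \<and> proj_class v \<in> W})"
      by auto
    moreover have "open (\<Union>W\<in>\<K>. {v. v \<noteq> 0 \<and> proj_class v \<in> W})"
      using K by (intro open_UN) blast
    ultimately show "open {v. v \<noteq> 0 \<and> proj_class v \<in> \<Union>\<K>}" by (simp only:)
  qed
  then show ?thesis
    unfolding RP2_def by (simp add: topology_inverse')
qed

lemma topspace_RP2: "topspace RP2 = proj_class ` (- {0})"
proof -
  have "{v. v \<noteq> 0 \<and> proj_class v \<in> proj_class ` (- {0})} = - {0}" by auto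
  then have "openin RP2 (proj_class ` (- {0}))"
    by (simp add: openin_RP2 open_Compl)
  then show ?thesis
    using openin_RP2[of "topspace RP2"] openin_subset by blast
qed

lemma RP2_quotient_map: "quotient_map (top_of_set (- {0})) RP2 proj_class"
proof -
  have "openin (top_of_set (- {0})) {v \<in> - {0}. proj_class v \<in> W} \<longleftrightarrow>
        open {v. v \<noteq> 0 \<and> proj_class v \<in> W}" for W
  proof -
    have "{v \<in> - {0}. proj_class v \<in> W} = {v. v \<noteq> 0 \<and> proj_class v \<in> W}" by auto
    then show ?thesis by (auto simp: openin_open_eq open_Compl)
  qed
  then show ?thesis
    by (auto simp: quotient_map_def topspace_RP2 openin_RP2)
qed

definition hom_coords :: "real \<Rightarrow> real \<Rightarrow> real \<Rightarrow> (real^3) set" where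
  "hom_coords A B C = proj_class (vector [A, B, C])"

end

theory Submission
  imports Defs "HOL-Probability.Probability" "HOL-Complex_Analysis.Complex_Analysis" "HOL-Real_Asymp.Real_Asymp"
begin

text \<open>
  Write \<open>w = y - x\<close> and \<open>z - x = \<alpha> w + p\<close>. The triangle has shape \<open>(\<alpha>, \<gamma>)\<close> when \<open>w \<bullet> p = 0\<close> and
  \<open>|p|\<^sup>2 = \<gamma> |w|\<^sup>2\<close>, and these two real numbers determine the side lengths up to scaling. It is therefore
  enough that both equations are solvable in \<open>E\<close> for all \<open>(\<alpha>, \<gamma>)\<close> in some open box.

  Choose non-collinear points of \<open>E\<close> near each of which \<open>E\<close> has positive \<open>s\<close>-dimensional content, where
  \<open>s > (2d + 2)/3\<close>, and put Frostman weights on finite subsets of \<open>E\<close> near these points. Testing the two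
  equations with the nonnegative kernel \<open>cos\<^sup>2\<^sup>n (u/2)\<close> gives a weighted count of triangles of approximate shape
  \<open>(\<alpha>, \<gamma>)\<close>. Its average over a box of shapes is bounded below, so the count is bounded below for some shape of
  the box. Expanded into Fourier modes, the part with frequencies above \<open>r\<close> is small uniformly in \<open>n\<close> and
  in the shape, by a factor \<open>r\<^bsup>-\<eta>/4\<^esup>\<close> with \<open>\<eta> = 3s - 2d - 2\<close>, and the part with frequencies up to \<open>r\<close> is
  Lipschitz in the shape. Hence the count is bounded below on a ball of shapes whose radius does not
  depend on \<open>n\<close>, and a compactness argument for \<open>n \<rightarrow> \<infinity>\<close> gives exact solutions.

  The bound for high frequencies uses that the phase is a quadratic function of \<open>(x, y)\<close> for fixed \<open>z\<close>.
  After Cauchy-Schwarz in \<open>(x, y)\<close>, the mean value property of the entire function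
  \<open>X \<mapsto> \<Sum> c e\<^bsup>iq(X)\<^esup>\<close>, with Gaussian weights at scale \<open>1/r\<close>, replaces the sum over pairs \<open>(x, y)\<close> by a Gaussian integral over
  \<open>\<real>\<^sup>2\<^sup>d\<close>, which is explicit, and no Fourier transform of the weights is needed.
\<close>

subsection \<open>Gaussian integrals\<close>

text \<open>The threshold is a count of exponents. For frequencies of size r, the squared modulus of
  the weighted sum is bounded by a product of \<open>r^(2d)\<close> (normalisation of the mean
  values on the 2d-dimensional space of pairs), \<open>r^(-2s)\<close> (weights of the pairs (x,
  y)), \<open>r^(-s)\<close> (weights of the second copy of z that squaring creates) and
  \<open>r^2\<close> (number of frequencies, the second one being close to the first). The total is
  \<open>r^(2d + 2 - 3s) = r^(-\<eta>)\<close>. The obstacle is the word "close": smoothing (x, y)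
  with a Gaussian of fixed width damps far pairs of frequencies only by a constant, and there are
  about \<open>r^4\<close> of them. The Gaussian is therefore narrowed to width about
  \<open>1 / sqrt (ln r)\<close>, which damps each far pair by \<open>r^(-2)\<close>. Dominating the
  weights by so narrow a Gaussian costs a power of r, which is small only if all pairs are close to
  one fixed pair; hence the localisation near one triangle. Finite weights suffice because the
  kernel of order n has frequencies of order at most n: the Frostman condition is used only at
  scales above about \<open>1/n\<close>, with a constant independent of n.\<close>

lemma borel_measurable_Complex [measurable (raw)]:
  assumes "f \<in> borel_measurable M" "g \<in> borel_measurable M"
  shows "(\<lambda>x. Complex (f x) (g x)) \<in> borel_measurable M"
  unfolding Complex_eq using assms by measurable

lemma norm_exp_Complex [simp]: "norm (exp (Complex u v)) = exp u"
  by simp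

lemma gaussian_real:
  fixes a :: real
  assumes "a > 0"
  shows "integrable lborel (\<lambda>x. exp (- a * x\<^sup>2))"
    and "(\<integral>x. exp (- a * x\<^sup>2) \<partial>lborel) = sqrt (pi / a)"
proof -
  let ?s = "sqrt (1 / (2 * a))"
  have s: "?s > 0" "?s\<^sup>2 = 1 / (2 * a)" using assms by auto
  have eq: "exp (- a * x\<^sup>2) = sqrt (pi / a) * normal_density 0 ?s x" for x
    unfolding normal_density_def using assms s(2)
    by (simp add: field_simps real_sqrt_divide real_sqrt_mult)
  show "integrable lborel (\<lambda>x. exp (- a * x\<^sup>2))"
    unfolding eq using s by (intro integrable_mult_right) auto
  show "(\<integral>x. exp (- a * x\<^sup>2) \<partial>lborel) = sqrt (pi / a)"
    unfolding eq using s by simp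
qed

text \<open>This is the characteristic function of the standard normal law at
  \<open>t / sqrt (2 * a)\<close>, after rescaling the variable by
  \<open>sqrt (2 * a)\<close>.\<close>

lemma gaussian_fourier_real:
  fixes a t :: real
  assumes a: "a > 0"
  shows "integrable lborel (\<lambda>x. exp (Complex (- a * x\<^sup>2) (t * x)))"
    and "(\<integral>x. exp (Complex (- a * x\<^sup>2) (t * x)) \<partial>lborel) = of_real (sqrt (pi / a) * exp (- t\<^sup>2 / (4 * a)))"
proof -
  show "integrable lborel (\<lambda>x. exp (Complex (- a * x\<^sup>2) (t * x)))"
    by (rule Bochner_Integration.integrable_bound[OF gaussian_real(1)[OF a]]) auto
  let ?c = "sqrt (2 * a)"
  have c: "?c > 0" "?c\<^sup>2 = 2 * a" using a by auto
  have "(CLINT x|std_normal_distribution. iexp ((t / ?c) * x)) = exp (- ((t / ?c)\<^sup>2) / 2)"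
    using fun_cong[OF char_std_normal_distribution, of "t / ?c"] unfolding char_def by simp
  then have "complex_of_real (exp (- t\<^sup>2 / (4 * a))) = (CLINT x|std_normal_distribution. iexp ((t / ?c) * x))"
    using a by (simp add: power_divide exp_of_real)
  also have "\<dots> = (CLINT x|lborel. std_normal_density x *\<^sub>R iexp ((t / ?c) * x))"
    by (subst integral_density) (auto simp: normal_density_nonneg)
  also have "\<dots> = ?c *\<^sub>R (CLINT x|lborel. std_normal_density (0 + ?c * x) *\<^sub>R iexp ((t / ?c) * (0 + ?c * x)))"
    using c(1) by (subst lborel_integral_real_affine[where c="?c" and t=0]) auto
  also have "(\<lambda>x. std_normal_density (0 + ?c * x) *\<^sub>R iexp ((t / ?c) * (0 + ?c * x))) =
      (\<lambda>x. (1 / sqrt (2 * pi)) *\<^sub>R exp (Complex (- a * x\<^sup>2) (t * x)))"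
  proof
    fix x
    have "exp (Complex (- a * x\<^sup>2) (t * x)) = exp (of_real (- a * x\<^sup>2)) * iexp (t * x)"
      unfolding exp_add[symmetric] by (rule arg_cong[where f=exp]) (simp add: complex_eq_iff)
    then show "std_normal_density (0 + ?c * x) *\<^sub>R iexp ((t / ?c) * (0 + ?c * x)) =
      (1 / sqrt (2 * pi)) *\<^sub>R exp (Complex (- a * x\<^sup>2) (t * x))"
      using a c by (simp add: normal_density_def power_mult_distrib scaleR_conv_of_real exp_of_real[symmetric])
  qed
  finally have "complex_of_real (exp (- t\<^sup>2 / (4 * a))) =
      (?c / sqrt (2 * pi)) *\<^sub>R (\<integral>x. exp (Complex (- a * x\<^sup>2) (t * x)) \<partial>lborel)"
    by simp
  moreover have "sqrt (pi / a) * (?c / sqrt (2 * pi)) = 1"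
    using a by (simp add: real_sqrt_divide real_sqrt_mult)
  ultimately show "(\<integral>x. exp (Complex (- a * x\<^sup>2) (t * x)) \<partial>lborel) = of_real (sqrt (pi / a) * exp (- t\<^sup>2 / (4 * a)))"
    by (metis (no_types, lifting) of_real_mult scaleR_conv_of_real mult.assoc mult_1 scaleR_scaleR scaleR_one)
qed

lemma lborel_integral_prod_Basis:
  fixes f :: "'a::euclidean_space \<Rightarrow> real \<Rightarrow> complex"
  assumes i: "\<And>b. b \<in> Basis \<Longrightarrow> integrable lborel (f b)"
  shows "integrable lborel (\<lambda>x. \<Prod>b\<in>Basis. f b (x \<bullet> b))"
    and "(\<integral>x. (\<Prod>b\<in>Basis. f b (x \<bullet> b)) \<partial>lborel) = (\<Prod>b\<in>Basis. (\<integral>x. f b x \<partial>lborel))"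
proof -
  interpret finite_product_sigma_finite "\<lambda>_::'a. lborel :: real measure" Basis
    by unfold_locales auto
  have fm: "f b \<in> borel_measurable borel" if "b \<in> Basis" for b
    using borel_measurable_integrable[OF i[OF that]] by simp
  have m: "(\<lambda>x::'a. \<Prod>b\<in>Basis. f b (x \<bullet> b)) \<in> borel_measurable borel"
    by (intro borel_measurable_prod) (auto intro!: measurable_compose[OF _ fm])
  have mm: "(\<lambda>f. \<Sum>b\<in>Basis. f b *\<^sub>R b) \<in> (\<Pi>\<^sub>M b\<in>(Basis::'a set). lborel) \<rightarrow>\<^sub>M borel"
    by measurable
  have eq: "(\<Prod>b\<in>Basis. f b ((\<Sum>c\<in>Basis. g c *\<^sub>R c) \<bullet> b)) = (\<Prod>b\<in>Basis. f b (g b))" for g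
    by (intro prod.cong) (simp_all add: inner_sum_left inner_Basis if_distrib sum.delta cong: if_cong)
  have "integrable (\<Pi>\<^sub>M b\<in>Basis. lborel) (\<lambda>x. \<Prod>b\<in>(Basis::'a set). f b (x b))"
    by (intro product_integrable_prod finite_Basis i)
  then show "integrable lborel (\<lambda>x. \<Prod>b\<in>Basis. f b (x \<bullet> b))"
    by (subst lborel_eq, subst integrable_distr_eq[OF mm m]) (simp add: eq)
  show "(\<integral>x. (\<Prod>b\<in>Basis. f b (x \<bullet> b)) \<partial>lborel) = (\<Prod>b\<in>Basis. (\<integral>x. f b x \<partial>lborel))"
    apply (subst lborel_eq)
    apply (subst integral_distr[OF mm m])
    apply (simp only: eq)
    by (rule product_integral_prod) (auto intro: i)
qed

lemma gaussian_fourier: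
  fixes \<beta> :: "'a::euclidean_space"
  assumes a: "a > 0"
  shows "integrable lborel (\<lambda>x. exp (Complex (- a * (norm x)\<^sup>2) (2 * (\<beta> \<bullet> x))))"
    and "(\<integral>x. exp (Complex (- a * (norm x)\<^sup>2) (2 * (\<beta> \<bullet> x))) \<partial>lborel) =
      of_real (sqrt (pi / a) ^ DIM('a) * exp (- (norm \<beta>)\<^sup>2 / a))"
proof -
  let ?f = "\<lambda>(b::'a) t. exp (Complex (- a * t\<^sup>2) ((2 * (\<beta> \<bullet> b)) * t))"
  have eq: "exp (Complex (- a * (norm x)\<^sup>2) (2 * (\<beta> \<bullet> x))) = (\<Prod>b\<in>Basis. ?f b (x \<bullet> b))" for x
  proof -
    have "(\<Prod>b\<in>Basis. ?f b (x \<bullet> b)) = exp (\<Sum>b\<in>Basis. Complex (- a * (x \<bullet> b)\<^sup>2) ((2 * (\<beta> \<bullet> b)) * (x \<bullet> b)))"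
      by (simp add: exp_sum)
    also have "(\<Sum>b\<in>Basis. Complex (- a * (x \<bullet> b)\<^sup>2) ((2 * (\<beta> \<bullet> b)) * (x \<bullet> b))) =
        Complex (- a * (\<Sum>b\<in>Basis. (x \<bullet> b)\<^sup>2)) (2 * (\<Sum>b\<in>Basis. (\<beta> \<bullet> b) * (x \<bullet> b)))"
      by (simp add: complex_eq_iff sum_distrib_left mult.assoc sum_negf)
    also have "\<dots> = Complex (- a * (norm x)\<^sup>2) (2 * (\<beta> \<bullet> x))"
      unfolding power2_norm_eq_inner by (simp add: euclidean_inner[of x x] euclidean_inner[of \<beta> x] power2_eq_square)
    finally show ?thesis by simp
  qed
  show "integrable lborel (\<lambda>x. exp (Complex (- a * (norm x)\<^sup>2) (2 * (\<beta> \<bullet> x))))"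
    unfolding eq by (rule lborel_integral_prod_Basis(1)) (rule gaussian_fourier_real(1)[OF a])
  have "(\<Prod>b\<in>(Basis::'a set). (\<integral>t. ?f b t \<partial>lborel)) =
      of_real (\<Prod>b\<in>(Basis::'a set). sqrt (pi / a) * exp (- (2 * (\<beta> \<bullet> b))\<^sup>2 / (4 * a)))"
    unfolding gaussian_fourier_real(2)[OF a] by simp
  also have "(\<Prod>b\<in>(Basis::'a set). sqrt (pi / a) * exp (- (2 * (\<beta> \<bullet> b))\<^sup>2 / (4 * a))) =
      sqrt (pi / a) ^ DIM('a) * exp (\<Sum>b\<in>Basis. - (2 * (\<beta> \<bullet> b))\<^sup>2 / (4 * a))"
    by (simp add: prod.distrib exp_sum)
  also have "(\<Sum>b\<in>Basis. - (2 * (\<beta> \<bullet> b))\<^sup>2 / (4 * a)) = - (norm \<beta>)\<^sup>2 / a"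
    unfolding power2_norm_eq_inner euclidean_inner[of \<beta> \<beta>]
    using a by (simp add: sum_negf sum_divide_distrib power2_eq_square field_simps)
  finally show "(\<integral>x. exp (Complex (- a * (norm x)\<^sup>2) (2 * (\<beta> \<bullet> x))) \<partial>lborel) =
      of_real (sqrt (pi / a) ^ DIM('a) * exp (- (norm \<beta>)\<^sup>2 / a))"
    unfolding eq by (subst lborel_integral_prod_Basis(2)) (use gaussian_fourier_real(1)[OF a] in auto)
qed

lemma gaussian_euclidean:
  assumes a: "a > 0"
  shows "integrable lborel (\<lambda>x::'a::euclidean_space. exp (- a * (norm x)\<^sup>2))"
    and "(\<integral>x. exp (- a * (norm (x::'a::euclidean_space))\<^sup>2) \<partial>lborel) = sqrt (pi / a) ^ DIM('a)"
    and "(\<integral>\<^sup>+x. ennreal (exp (- a * (norm (x::'a::euclidean_space))\<^sup>2)) \<partial>lborel) = ennreal (sqrt (pi / a) ^ DIM('a))"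
proof -
  have eq: "complex_of_real (exp (- a * (norm x)\<^sup>2)) = exp (Complex (- a * (norm x)\<^sup>2) (2 * (0 \<bullet> x)))" for x :: 'a
    by (simp add: complex_eq_iff exp_of_real[symmetric] Complex_eq)
  show i: "integrable lborel (\<lambda>x::'a. exp (- a * (norm x)\<^sup>2))"
    using gaussian_fourier(1)[OF a, where \<beta>="0::'a"] unfolding eq[symmetric] complex_of_real_integrable_eq .
  show v: "(\<integral>x. exp (- a * (norm (x::'a))\<^sup>2) \<partial>lborel) = sqrt (pi / a) ^ DIM('a)"
    using gaussian_fourier(2)[OF a, where \<beta>="0::'a"] unfolding eq[symmetric] integral_complex_of_real of_real_eq_iff by simp
  show "(\<integral>\<^sup>+x. ennreal (exp (- a * (norm (x::'a))\<^sup>2)) \<partial>lborel) = ennreal (sqrt (pi / a) ^ DIM('a))"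
    unfolding v[symmetric] by (rule nn_integral_eq_integral[OF i]) auto
qed

lemma lborel_translation:
  fixes f :: "'a::euclidean_space \<Rightarrow> 'b::{banach, second_countable_topology}"
  assumes [measurable]: "f \<in> borel_measurable borel"
  shows "(\<integral>x. f (c + x) \<partial>lborel) = (\<integral>x. f x \<partial>lborel)"
    and "integrable lborel (\<lambda>x. f (c + x)) \<longleftrightarrow> integrable lborel f"
proof -
  have eq: "distr lborel borel ((+) c) = lborel" by (rule lborel_distr_plus)
  have m: "(+) c \<in> lborel \<rightarrow>\<^sub>M borel" by measurable
  show "(\<integral>x. f (c + x) \<partial>lborel) = (\<integral>x. f x \<partial>lborel)"
    using integral_distr[OF m, of f] by (simp add: eq)
  show "integrable lborel (\<lambda>x. f (c + x)) \<longleftrightarrow> integrable lborel f"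
    using integrable_distr_eq[OF m, of f] by (simp add: eq)
qed

lemma nn_integral_lborel_translation:
  fixes f :: "'a::euclidean_space \<Rightarrow> ennreal"
  assumes [measurable]: "f \<in> borel_measurable borel"
  shows "(\<integral>\<^sup>+x. f (c + x) \<partial>lborel) = (\<integral>\<^sup>+x. f x \<partial>lborel)"
proof -
  have eq: "distr lborel borel ((+) c) = lborel" by (rule lborel_distr_plus)
  have m: "(+) c \<in> lborel \<rightarrow>\<^sub>M borel" by measurable
  show "(\<integral>\<^sup>+x. f (c + x) \<partial>lborel) = (\<integral>\<^sup>+x. f x \<partial>lborel)"
    using nn_integral_distr[OF m, of f] by (simp add: eq)
qed

text \<open>Only the real linear term is removed by completing the square, with the real translation
  by \<open>p / a\<close>. The imaginary one is covered by \<open>gaussian_fourier\<close>, so no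
  contour has to be moved.\<close>

lemma gaussian_complex_linear:
  fixes p q :: "'a::euclidean_space"
  assumes a: "a > 0"
  shows "integrable lborel (\<lambda>x. exp (Complex (- a * (norm x)\<^sup>2 + 2 * (p \<bullet> x)) (2 * (q \<bullet> x))))" (is ?I)
    and "(\<integral>x. exp (Complex (- a * (norm x)\<^sup>2 + 2 * (p \<bullet> x)) (2 * (q \<bullet> x))) \<partial>lborel) =
      of_real (sqrt (pi / a) ^ DIM('a)) * exp (Complex (((norm p)\<^sup>2 - (norm q)\<^sup>2) / a) (2 * (p \<bullet> q) / a))" (is ?V)
proof -
  let ?f = "\<lambda>x. exp (Complex (- a * (norm x)\<^sup>2 + 2 * (p \<bullet> x)) (2 * (q \<bullet> x)))"
  let ?c = "(1 / a) *\<^sub>R p"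
  have m: "?f \<in> borel_measurable borel" by measurable
  have eq: "?f (?c + x) = exp (Complex ((norm p)\<^sup>2 / a) (2 * (p \<bullet> q) / a)) *
       exp (Complex (- a * (norm x)\<^sup>2) (2 * (q \<bullet> x)))" for x
    unfolding exp_add[symmetric] power2_norm_eq_inner using a
    by (intro arg_cong[where f=exp])
      (simp add: complex_eq_iff inner_simps inner_commute field_simps)
  show ?I unfolding lborel_translation(2)[OF m, of ?c, symmetric] unfolding eq
    by (intro integrable_mult_right gaussian_fourier(1)[OF a])
  show ?V unfolding lborel_translation(1)[OF m, of ?c, symmetric] unfolding eq
    unfolding integral_mult_right_zero gaussian_fourier(2)[OF a] of_real_mult exp_of_real[symmetric]
    by (simp only: mult.left_commute[of "exp _" "of_real _"] exp_add[symmetric])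
       (intro arg_cong[where f="\<lambda>z. _ * z"] arg_cong[where f=exp], simp add: complex_eq_iff diff_divide_distrib)
qed

text \<open>The squared modulus is a double integral over \<open>S\<close> and \<open>S + D\<close>, in which the integral over \<open>S\<close> has a
  linear phase; so \<open>\<Omega>\<close> need not be diagonalised.\<close>
lemma quadratic_gaussian:
  fixes \<Omega> :: "'a::euclidean_space \<Rightarrow> 'a" and m g :: 'a and b w :: real
  assumes lin: "linear \<Omega>" and sym: "\<And>x y. x \<bullet> \<Omega> y = \<Omega> x \<bullet> y"
    and nrm: "\<And>x. norm (\<Omega> x) = w * norm x" and b: "b > 0"
  defines "f \<equiv> \<lambda>S. exp (Complex (- 2 * b * (norm S)\<^sup>2 - 2 * (m \<bullet> S)) (S \<bullet> \<Omega> S + 2 * (g \<bullet> S)))"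
  shows "integrable lborel f"
    and "(norm (\<integral>S. f S \<partial>lborel))\<^sup>2 \<le> (pi / sqrt (4 * b\<^sup>2 + w\<^sup>2)) ^ DIM('a) *
      exp (2 * (norm m)\<^sup>2 / b - 2 * b * (norm g)\<^sup>2 / (4 * b\<^sup>2 + w\<^sup>2))"
proof -
  have cont: "continuous_on UNIV \<Omega>" using lin by (simp add: linear_continuous_on linear_conv_bounded_linear)
  have [measurable]: "\<Omega> \<in> borel_measurable borel" by (rule borel_measurable_continuous_onI[OF cont])
  have fm [measurable]: "f \<in> borel_measurable borel" unfolding f_def by measurable
  have nf: "norm (f S) = exp (- 2 * b * (norm S)\<^sup>2 - 2 * (m \<bullet> S))" for S by (simp add: f_def)
  have "integrable lborel (\<lambda>x. exp (Complex (- (2*b) * (norm x)\<^sup>2 + 2 * ((-m) \<bullet> x)) (2 * (0 \<bullet> x))))"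
    using b by (intro gaussian_complex_linear(1)) auto
  then show fi: "integrable lborel f"
    by (rule Bochner_Integration.integrable_bound) (auto simp: nf)
  define B where "B = (\<integral>S. f S \<partial>lborel)"
  define F where "F = (\<lambda>S D. f (S + D) * cnj (f S))"
  have [measurable]: "cnj \<in> borel_measurable borel"
    by (intro borel_measurable_continuous_onI continuous_intros)
  have Fm [measurable]: "(\<lambda>z. F (fst z) (snd z)) \<in> borel_measurable (borel \<Otimes>\<^sub>M borel)"
    unfolding F_def f_def by measurable
  have i1: "integrable lborel (\<lambda>D. f (S + D))" for S using lborel_translation(2)[OF fm, of S] fi by simp
  have Fint: "integrable (lborel \<Otimes>\<^sub>M lborel) (case_prod F)"
  proof (rule lborel_pair.Fubini_integrable)
    show "case_prod F \<in> borel_measurable (lborel \<Otimes>\<^sub>M lborel)"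
      using Fm by (simp add: case_prod_beta' cong: measurable_cong_sets)
    have "(\<integral>D. norm (F S D) \<partial>lborel) = norm (f S) * (\<integral>D. norm (f D) \<partial>lborel)" for S
      unfolding F_def using lborel_translation(1)[of "\<lambda>D. norm (f D)" S] by (simp add: norm_mult mult.commute)
    then show "integrable lborel (\<lambda>x. \<integral> y. norm (case_prod F (x, y)) \<partial>lborel)"
      using fi by simp
    show "AE x in lborel. integrable lborel (\<lambda>y. case_prod F (x, y))"
      unfolding F_def using i1 by simp
  qed
  have "B * cnj B = (\<integral>S. B * cnj (f S) \<partial>lborel)"
    unfolding B_def using fi by simp
  also have "\<dots> = (\<integral>S. (\<integral>D. F S D \<partial>lborel) \<partial>lborel)"
    unfolding F_def using i1 lborel_translation(1)[OF fm] by (simp add: B_def)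
  also have "\<dots> = (\<integral>D. (\<integral>S. F S D \<partial>lborel) \<partial>lborel)"
    using lborel_pair.Fubini_integral[OF Fint] by simp
  finally have BB: "B * cnj B = (\<integral>D. (\<integral>S. F S D \<partial>lborel) \<partial>lborel)" .
  let ?k = "b + w\<^sup>2 / (4 * b)"
  let ?h = "(1 / (2 * b)) *\<^sub>R \<Omega> m"
  let ?A = "sqrt (pi / (4 * b)) ^ DIM('a) * exp ((norm m)\<^sup>2 / b)"
  \<comment> \<open>The terms quadratic in \<open>S\<close> cancel from the phase, self-adjointness
    turns the cross term into \<open>2 * (\<Omega> D \<bullet> S)\<close>, and \<open>nrm\<close>
    makes the resulting Gaussian in \<open>D\<close> isotropic with rate \<open>?k\<close>.\<close>
  have inner: "(\<integral>S. F S D \<partial>lborel) = of_real ?A * exp (Complex (- ?k * (norm D)\<^sup>2) (2 * ((g - ?h) \<bullet> D)))" for D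
  proof -
    have nm: "(norm (- (2 * b) *\<^sub>R D - 2 *\<^sub>R m))\<^sup>2 = 4 * b\<^sup>2 * (norm D)\<^sup>2 + 8 * b * (D \<bullet> m) + 4 * (norm m)\<^sup>2"
      unfolding power2_norm_eq_inner by (simp add: inner_simps inner_commute power2_eq_square)
    have lin_simps: "\<Omega> (x + y) = \<Omega> x + \<Omega> y" for x y using lin by (simp add: linear_add)
    have "F S D = exp (Complex (- 2 * b * (norm D)\<^sup>2 - 2 * (m \<bullet> D)) (D \<bullet> \<Omega> D + 2 * (g \<bullet> D))) *
        exp (Complex (- (4 * b) * (norm S)\<^sup>2 + 2 * ((- (2 * b) *\<^sub>R D - 2 *\<^sub>R m) \<bullet> S)) (2 * (\<Omega> D \<bullet> S)))" for S
      unfolding F_def f_def exp_cnj exp_add[symmetric]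
      apply (rule arg_cong[where f=exp])
      using sym[of D S] sym[of S D]
      by (simp add: complex_eq_iff power2_norm_eq_inner inner_simps lin_simps inner_commute algebra_simps)
    then have "(\<integral>S. F S D \<partial>lborel) = exp (Complex (- 2 * b * (norm D)\<^sup>2 - 2 * (m \<bullet> D)) (D \<bullet> \<Omega> D + 2 * (g \<bullet> D))) *
      (of_real (sqrt (pi / (4 * b)) ^ DIM('a)) * exp (Complex (((norm (- (2 * b) *\<^sub>R D - 2 *\<^sub>R m))\<^sup>2 - (norm (\<Omega> D))\<^sup>2) / (4 * b))
          (2 * ((- (2 * b) *\<^sub>R D - 2 *\<^sub>R m) \<bullet> \<Omega> D) / (4 * b))))"
      using gaussian_complex_linear(2)[of "4 * b" "- (2 * b) *\<^sub>R D - 2 *\<^sub>R m" "\<Omega> D"] b by simp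
    also have "\<dots> = of_real (sqrt (pi / (4 * b)) ^ DIM('a)) * (exp (of_real ((norm m)\<^sup>2 / b)) *
        exp (Complex (- ?k * (norm D)\<^sup>2) (2 * ((g - ?h) \<bullet> D))))"
      unfolding mult.left_commute[of "exp _" "of_real _"] exp_add[symmetric] nrm nm
      apply (intro arg_cong[where f="\<lambda>z. _ * z"] arg_cong[where f=exp])
      using b sym[of m D] sym[of D D]
      by (simp add: complex_eq_iff inner_simps inner_commute power_mult_distrib field_simps power2_eq_square)
    finally show ?thesis by (simp only: exp_of_real of_real_mult mult.assoc)
  qed
  have kpos: "?k > 0" using b by (intro add_pos_nonneg) auto
  have "B * cnj B = of_real ?A * of_real (sqrt (pi / ?k) ^ DIM('a) * exp (- (norm (g - ?h))\<^sup>2 / ?k))"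
    unfolding BB inner using gaussian_fourier(2)[OF kpos, of "g - ?h"] by simp
  then have "complex_of_real ((norm B)\<^sup>2) = of_real (?A * (sqrt (pi / ?k) ^ DIM('a) * exp (- (norm (g - ?h))\<^sup>2 / ?k)))"
    by (simp only: of_real_mult complex_norm_square)
  then have "(norm B)\<^sup>2 = ?A * (sqrt (pi / ?k) ^ DIM('a) * exp (- (norm (g - ?h))\<^sup>2 / ?k))"
    by (simp only: of_real_eq_iff)
  also have "\<dots> = (sqrt (pi / (4 * b)) * sqrt (pi / ?k)) ^ DIM('a) * exp ((norm m)\<^sup>2 / b - (norm (g - ?h))\<^sup>2 / ?k)"
    by (simp add: power_mult_distrib exp_diff exp_minus field_simps)
  also have "sqrt (pi / (4 * b)) * sqrt (pi / ?k) = pi / sqrt (4 * b\<^sup>2 + w\<^sup>2)"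
  proof -
    have "pi / (4 * b) * (pi / ?k) = pi\<^sup>2 / (4 * b\<^sup>2 + w\<^sup>2)"
      using b kpos by (simp add: field_simps power2_eq_square)
    then show ?thesis
      by (metis real_sqrt_mult real_sqrt_divide real_sqrt_abs abs_of_nonneg pi_ge_zero)
  qed
  \<comment> \<open>Decouples \<open>g\<close> from \<open>m\<close>: half of \<open>|g|^2\<close>
    is at most \<open>|g - ?h|^2 + |?h|^2\<close>, and the shift \<open>?h\<close>, which comes from
    the linear term \<open>m\<close>, costs at most a second \<open>|m|^2 / b\<close>.\<close>
  also have "(norm m)\<^sup>2 / b - (norm (g - ?h))\<^sup>2 / ?k \<le> 2 * (norm m)\<^sup>2 / b - 2 * b * (norm g)\<^sup>2 / (4 * b\<^sup>2 + w\<^sup>2)"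
  proof -
    have "norm g \<le> norm (g - ?h) + norm ?h" by (metis norm_triangle_sub add.commute)
    then have "(norm g)\<^sup>2 \<le> (norm (g - ?h) + norm ?h)\<^sup>2" by (intro power_mono) auto
    also have "\<dots> \<le> 2 * (norm (g - ?h))\<^sup>2 + 2 * (norm ?h)\<^sup>2"
      using sum_squares_bound[of "norm (g - ?h)" "norm ?h"] by (simp add: power2_sum)
    finally have 1: "(norm g)\<^sup>2 / 2 - (norm ?h)\<^sup>2 \<le> (norm (g - ?h))\<^sup>2" by simp
    have h: "(norm ?h)\<^sup>2 = w\<^sup>2 * (norm m)\<^sup>2 / (4 * b\<^sup>2)"
      using b by (simp add: nrm power_mult_distrib power_divide)
    have den: "4 * b\<^sup>2 + w\<^sup>2 > 0" using b by (simp add: add_pos_nonneg)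
    have k: "x / ?k = 4 * b * x / (4 * b\<^sup>2 + w\<^sup>2)" for x
      using b den kpos by (simp add: field_simps power2_eq_square)
    have "4 * b * (w\<^sup>2 * (norm m)\<^sup>2 / (4 * b\<^sup>2)) / (4 * b\<^sup>2 + w\<^sup>2) = (norm m)\<^sup>2 / b * (w\<^sup>2 / (4 * b\<^sup>2 + w\<^sup>2))"
      using b den by (simp add: field_simps power2_eq_square)
    also have "\<dots> \<le> (norm m)\<^sup>2 / b * 1"
      using b den by (intro mult_left_mono) auto
    finally have 2: "4 * b * (norm ?h)\<^sup>2 / (4 * b\<^sup>2 + w\<^sup>2) \<le> (norm m)\<^sup>2 / b" unfolding h by simp
    have "4 * b * ((norm g)\<^sup>2 / 2 - (norm ?h)\<^sup>2) / (4 * b\<^sup>2 + w\<^sup>2) \<le> (norm (g - ?h))\<^sup>2 / ?k"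
      unfolding k using 1 b den by (intro divide_right_mono mult_left_mono) auto
    then show ?thesis using 2 by (simp add: diff_divide_distrib right_diff_distrib)
  qed
  finally show "(norm (\<integral>S. f S \<partial>lborel))\<^sup>2 \<le> (pi / sqrt (4 * b\<^sup>2 + w\<^sup>2)) ^ DIM('a) *
      exp (2 * (norm m)\<^sup>2 / b - 2 * b * (norm g)\<^sup>2 / (4 * b\<^sup>2 + w\<^sup>2))"
    unfolding B_def by (simp add: mult_left_mono)
qed

subsection \<open>Mean values of entire functions\<close>

text \<open>Cauchy's formula is applied to the square of \<open>h\<close>: the mean of
  \<open>h^2\<close> over the unit circle is \<open>h(0)^2\<close>, and the triangle inequality for
  integrals then bounds the squared modulus directly.\<close>

lemma entire_mean_square:
  assumes h: "h holomorphic_on UNIV"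
  shows "ennreal ((norm (h 0))\<^sup>2) \<le> (\<integral>\<^sup>+\<theta>. indicator {0..1} \<theta> * ennreal ((norm (h (cis (2 * pi * \<theta>))))\<^sup>2) \<partial>lborel)"
proof -
  let ?k = "\<lambda>z. (h z)\<^sup>2"
  let ?g = "\<lambda>\<theta>. ?k (cis (2 * pi * \<theta>))"
  have hol: "?k holomorphic_on cball 0 1"
    by (intro holomorphic_intros holomorphic_on_subset[OF h]) auto
  have ch: "continuous_on UNIV h" by (rule holomorphic_on_imp_continuous_on[OF h])
  have cg: "continuous_on A ?g" for A
    by (intro continuous_intros continuous_on_compose2[OF ch]) auto
  have "((\<lambda>u. ?k u / (u - 0)) has_contour_integral (2 * of_real pi * \<i> * ?k 0)) (circlepath 0 1)"
    by (rule Cauchy_integral_circlepath_simple[OF hol]) simp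
  then have "((\<lambda>x. ?k (exp (2 * pi * \<i> * of_real x)) / (exp (2 * pi * \<i> * of_real x)) *
      (2 * pi * \<i> * exp (2 * pi * \<i> * of_real x))) has_integral (2 * of_real pi * \<i> * ?k 0)) {0..1}"
    unfolding has_contour_integral unfolding vector_derivative_circlepath unfolding circlepath by simp
  then have "((\<lambda>x. (2 * of_real pi * \<i>) * ?g x) has_integral (2 * of_real pi * \<i> * ?k 0)) {0..1}"
    by (rule has_integral_eq[rotated]) (simp add: cis_conv_exp mult_ac)
  from has_integral_mult_right[OF this, of "1 / (2 * of_real pi * \<i>)"]
  have I: "(?g has_integral ?k 0) {0..1}" by simp
  have J: "(\<lambda>\<theta>. norm (?g \<theta>)) integrable_on {0..1}"
    by (intro integrable_continuous_interval continuous_intros cg)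
  have "norm (?k 0) = norm (integral {0..1} ?g)" using I by (simp add: integral_unique)
  also have "\<dots> \<le> integral {0..1} (\<lambda>\<theta>. norm (?g \<theta>))"
    using I J by (intro integral_norm_bound_integral) auto
  finally have le: "norm (?k 0) \<le> integral {0..1} (\<lambda>\<theta>. norm (?g \<theta>))" .
  have "(\<integral>\<^sup>+\<theta>. ennreal (norm (?g \<theta>)) * indicator {0..1} \<theta> \<partial>lborel) = ennreal (integral {0..1} (\<lambda>\<theta>. norm (?g \<theta>)))"
  proof (rule nn_integral_has_integral_lebesgue')
    show "((\<lambda>\<theta>. norm (?g \<theta>)) has_integral integral {0..1} (\<lambda>\<theta>. norm (?g \<theta>))) {0..1}"
      using J by blast
  qed auto
  then show ?thesis
    using le by (simp add: norm_power mult.commute ennreal_leI)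
qed

text \<open>A rotation by the angle t is a product of three shears with parameters
  \<open>- tan (t/2)\<close>, \<open>sin t\<close> and \<open>- tan (t/2)\<close>. Each shear is a
  translation of one variable while the other is fixed, so translation invariance and Fubini
  suffice. The half turn has no such factorisation, hence \<open>c \<noteq> -1\<close>.\<close>

lemma nn_integral_plane_rotation:
  fixes F :: "'a::euclidean_space \<Rightarrow> 'a \<Rightarrow> ennreal"
  assumes F: "(\<lambda>z. F (fst z) (snd z)) \<in> borel_measurable borel"
    and cs: "c\<^sup>2 + \<sigma>\<^sup>2 = 1" "c \<noteq> -1"
  shows "(\<integral>\<^sup>+v. \<integral>\<^sup>+s. F (c *\<^sub>R s - \<sigma> *\<^sub>R v) (\<sigma> *\<^sub>R s + c *\<^sub>R v) \<partial>lborel \<partial>lborel) =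
    (\<integral>\<^sup>+v. \<integral>\<^sup>+s. F s v \<partial>lborel \<partial>lborel)"
proof -
  have Fm [measurable (raw)]: "(\<lambda>x. F (f x) (g x)) \<in> borel_measurable M"
    if "f \<in> borel_measurable M" "g \<in> borel_measurable M" for f g and M :: "'b measure"
    using measurable_compose[OF _ F, of "\<lambda>x. (f x, g x)" M] that
    by (simp add: borel_measurable_Pair)
  have Fm2 [measurable (raw)]: "(\<lambda>x. F (f x) (g x)) \<in> borel_measurable M"
    if "f \<in> borel_measurable M" "g \<in> borel_measurable M" for f g and M :: "('a \<times> 'a) measure"
    using measurable_compose[OF _ F, of "\<lambda>x. (f x, g x)" M] that
    by (simp add: borel_measurable_Pair)
  define a where "a = - \<sigma> / (1 + c)"
  have c1: "1 + c \<noteq> 0" using cs(2) by linarith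
  have "\<sigma> * \<sigma> = (1 - c) * (1 + c)" using cs(1) by (simp add: algebra_simps power2_eq_square)
  then have a\<sigma>: "1 + a * \<sigma> = c" and ac: "a * c + a = - \<sigma>"
    using c1 unfolding a_def by (simp_all add: divide_simps) (simp_all add: algebra_simps)
  define F2 where "F2 = (\<lambda>s v. F (s + a *\<^sub>R v) v)"
  define F1 where "F1 = (\<lambda>s v. F2 s (v + \<sigma> *\<^sub>R s))"
  define F0 where "F0 = (\<lambda>s v. F1 (s + a *\<^sub>R v) v)"
  have F0: "F (c *\<^sub>R s - \<sigma> *\<^sub>R v) (\<sigma> *\<^sub>R s + c *\<^sub>R v) = F0 s v" for s v
  proof -
    have 1: "v + \<sigma> *\<^sub>R (s + a *\<^sub>R v) = \<sigma> *\<^sub>R s + c *\<^sub>R v"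
      by (simp add: a\<sigma>[symmetric] algebra_simps)
    have "(s + a *\<^sub>R v) + a *\<^sub>R (\<sigma> *\<^sub>R s + c *\<^sub>R v) = (1 + a * \<sigma>) *\<^sub>R s + (a * c + a) *\<^sub>R v"
      by (simp add: algebra_simps)
    then have 2: "(s + a *\<^sub>R v) + a *\<^sub>R (\<sigma> *\<^sub>R s + c *\<^sub>R v) = c *\<^sub>R s - \<sigma> *\<^sub>R v"
      by (simp add: a\<sigma> ac)
    show ?thesis unfolding F0_def F1_def F2_def 1 2 ..
  qed
  have "(\<integral>\<^sup>+v. \<integral>\<^sup>+s. F0 s v \<partial>lborel \<partial>lborel) = (\<integral>\<^sup>+v. \<integral>\<^sup>+s. F1 s v \<partial>lborel \<partial>lborel)"
  proof (rule nn_integral_cong)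
    fix v
    have "(\<lambda>s. F1 s v) \<in> borel_measurable borel" unfolding F1_def F2_def by measurable
    from nn_integral_lborel_translation[OF this, of "a *\<^sub>R v"]
    show "(\<integral>\<^sup>+s. F0 s v \<partial>lborel) = (\<integral>\<^sup>+s. F1 s v \<partial>lborel)" by (simp add: F0_def add.commute)
  qed
  also have "\<dots> = (\<integral>\<^sup>+s. \<integral>\<^sup>+v. F1 s v \<partial>lborel \<partial>lborel)"
    by (rule lborel_pair.Fubini') (unfold F1_def F2_def, measurable)
  also have "\<dots> = (\<integral>\<^sup>+s. \<integral>\<^sup>+v. F2 s v \<partial>lborel \<partial>lborel)"
  proof (rule nn_integral_cong)
    fix s
    have "(\<lambda>v. F2 s v) \<in> borel_measurable borel" unfolding F2_def by measurable
    from nn_integral_lborel_translation[OF this, of "\<sigma> *\<^sub>R s"]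
    show "(\<integral>\<^sup>+v. F1 s v \<partial>lborel) = (\<integral>\<^sup>+v. F2 s v \<partial>lborel)" by (simp add: F1_def add.commute)
  qed
  also have "\<dots> = (\<integral>\<^sup>+v. \<integral>\<^sup>+s. F2 s v \<partial>lborel \<partial>lborel)"
    by (rule lborel_pair.Fubini'[symmetric]) (unfold F2_def, measurable)
  also have "\<dots> = (\<integral>\<^sup>+v. \<integral>\<^sup>+s. F s v \<partial>lborel \<partial>lborel)"
  proof (rule nn_integral_cong)
    fix v
    have "(\<lambda>s. F s v) \<in> borel_measurable borel" by measurable
    from nn_integral_lborel_translation[OF this, of "a *\<^sub>R v"]
    show "(\<integral>\<^sup>+s. F2 s v \<partial>lborel) = (\<integral>\<^sup>+s. F s v \<partial>lborel)" by (simp add: F2_def add.commute)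
  qed
  finally show ?thesis unfolding F0 .
qed

text \<open>Here \<open>H X v\<close> stands for the value at \<open>X + \<i>v\<close> of an entire function on the complexification.\<close>
lemma gaussian_mean_square:
  fixes H :: "'a::euclidean_space \<Rightarrow> 'a \<Rightarrow> complex"
  assumes cont: "continuous_on UNIV (\<lambda>z. H (fst z) (snd z))"
    and holo: "\<And>s v. (\<lambda>z. H (X + (Re z *\<^sub>R s - Im z *\<^sub>R v)) (Im z *\<^sub>R s + Re z *\<^sub>R v)) holomorphic_on UNIV"
    and \<Lambda>: "\<Lambda> > 0"
  shows "ennreal ((norm (H X 0))\<^sup>2) * (ennreal (sqrt (pi / \<Lambda>) ^ DIM('a)))\<^sup>2 \<le>
    (\<integral>\<^sup>+v. \<integral>\<^sup>+s. ennreal (exp (- \<Lambda> * (norm s)\<^sup>2) * exp (- \<Lambda> * (norm v)\<^sup>2) * (norm (H (X + s) v))\<^sup>2) \<partial>lborel \<partial>lborel)"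
    (is "_ \<le> (\<integral>\<^sup>+v. \<integral>\<^sup>+s. ennreal (?F s v) \<partial>lborel \<partial>lborel)")
proof -
  have H: "(\<lambda>z. H (fst z) (snd z)) \<in> borel_measurable borel"
    by (rule borel_measurable_continuous_onI[OF cont])
  have Hm: "(\<lambda>x. H (f x) (g x)) \<in> borel_measurable M"
    if "f \<in> borel_measurable M" "g \<in> borel_measurable M" for f g and M :: "'b measure"
    using measurable_compose[OF _ H, of "\<lambda>x. (f x, g x)" M] that
    by (simp add: borel_measurable_Pair)
  have Fm: "(\<lambda>x. ennreal (?F (f x) (g x))) \<in> borel_measurable M"
    if [measurable]: "f \<in> borel_measurable M" "g \<in> borel_measurable M" for f g and M :: "'b measure"
  proof -
    have [measurable]: "(\<lambda>x. H (X + f x) (g x)) \<in> borel_measurable M"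
      by (rule measurable_compose[OF _ H, of "\<lambda>x. (X + f x, g x)" M, simplified]) measurable
    show ?thesis by measurable
  qed
  let ?c = "\<lambda>\<theta>. cos (2 * pi * \<theta>)" and ?s = "\<lambda>\<theta>. sin (2 * pi * \<theta>)"
  let ?R = "\<lambda>\<theta> s v. ennreal (?F (?c \<theta> *\<^sub>R s - ?s \<theta> *\<^sub>R v) (?s \<theta> *\<^sub>R s + ?c \<theta> *\<^sub>R v))"
  let ?I = "\<integral>\<^sup>+v. \<integral>\<^sup>+s. ennreal (?F s v) \<partial>lborel \<partial>lborel"
  let ?g = "\<lambda>s::'a. ennreal (exp (- \<Lambda> * (norm s)\<^sup>2))"
  have rot: "(norm (c *\<^sub>R s - \<sigma> *\<^sub>R v))\<^sup>2 + (norm (\<sigma> *\<^sub>R s + c *\<^sub>R v))\<^sup>2 = (norm s)\<^sup>2 + (norm v)\<^sup>2"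
    if "c\<^sup>2 + \<sigma>\<^sup>2 = 1" for c \<sigma> and s v :: 'a
  proof -
    have "(norm (c *\<^sub>R s - \<sigma> *\<^sub>R v))\<^sup>2 + (norm (\<sigma> *\<^sub>R s + c *\<^sub>R v))\<^sup>2 = (c\<^sup>2 + \<sigma>\<^sup>2) * ((norm s)\<^sup>2 + (norm v)\<^sup>2)"
      unfolding power2_norm_eq_inner by (simp add: inner_simps inner_commute algebra_simps power2_eq_square)
    then show ?thesis using that by simp
  qed
  \<comment> \<open>On the complex line \<open>X + z * (s + i v)\<close> the function is entire in
    \<open>z\<close>. For \<open>|z| = 1\<close> the real and imaginary displacements are a rotation
    of \<open>(s, v)\<close>, which leaves the Gaussian weight unchanged.\<close>
  have pt: "ennreal ((norm (H X 0))\<^sup>2) * (?g s * ?g v) \<le> (\<integral>\<^sup>+\<theta>. indicator {0..1} \<theta> * ?R \<theta> s v \<partial>lborel)" for s v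
  proof -
    let ?h = "\<lambda>z. H (X + (Re z *\<^sub>R s - Im z *\<^sub>R v)) (Im z *\<^sub>R s + Re z *\<^sub>R v)"
    have "?g s * ?g v * ennreal ((norm (?h 0))\<^sup>2) \<le>
      ?g s * ?g v * (\<integral>\<^sup>+\<theta>. indicator {0..1} \<theta> * ennreal ((norm (?h (cis (2 * pi * \<theta>))))\<^sup>2) \<partial>lborel)"
      by (intro mult_left_mono entire_mean_square holo) auto
    also have "\<dots> = (\<integral>\<^sup>+\<theta>. ?g s * ?g v * (indicator {0..1} \<theta> * ennreal ((norm (?h (cis (2 * pi * \<theta>))))\<^sup>2)) \<partial>lborel)"
    proof (rule nn_integral_cmult[symmetric])
      have [measurable]: "(\<lambda>\<theta>. ?h (cis (2 * pi * \<theta>))) \<in> borel_measurable borel"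
        unfolding cis.sel
        by (rule measurable_compose[OF _ H, of "\<lambda>\<theta>. (X + (?c \<theta> *\<^sub>R s - ?s \<theta> *\<^sub>R v), ?s \<theta> *\<^sub>R s + ?c \<theta> *\<^sub>R v)" borel, simplified]) measurable
      show "(\<lambda>\<theta>. indicator {0..1} \<theta> * ennreal ((norm (?h (cis (2 * pi * \<theta>))))\<^sup>2)) \<in> borel_measurable lborel"
        by measurable
    qed
    also have "\<dots> = (\<integral>\<^sup>+\<theta>. indicator {0..1} \<theta> * ?R \<theta> s v \<partial>lborel)"
    proof (intro nn_integral_cong)
      fix \<theta> :: real
      have "exp (- \<Lambda> * (norm (?c \<theta> *\<^sub>R s - ?s \<theta> *\<^sub>R v))\<^sup>2) * exp (- \<Lambda> * (norm (?s \<theta> *\<^sub>R s + ?c \<theta> *\<^sub>R v))\<^sup>2) =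
          exp (- \<Lambda> * (norm s)\<^sup>2) * exp (- \<Lambda> * (norm v)\<^sup>2)"
        unfolding exp_add[symmetric] distrib_left[symmetric] by (subst rot) (auto simp: add.commute)
      then show "?g s * ?g v * (indicator {0..1} \<theta> * ennreal ((norm (?h (cis (2 * pi * \<theta>))))\<^sup>2)) =
          indicator {0..1} \<theta> * ?R \<theta> s v"
        by (simp add: ennreal_mult' mult_ac split: split_indicator)
    qed
    finally show ?thesis by (simp add: mult_ac)
  qed
  have gm: "?g \<in> borel_measurable borel" by measurable
  have N: "(\<integral>\<^sup>+v. \<integral>\<^sup>+s. ennreal ((norm (H X 0))\<^sup>2) * (?g s * ?g v) \<partial>lborel \<partial>lborel) =
    ennreal ((norm (H X 0))\<^sup>2) * (ennreal (sqrt (pi / \<Lambda>) ^ DIM('a)))\<^sup>2"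
  proof -
    have "(\<integral>\<^sup>+s. ennreal ((norm (H X 0))\<^sup>2) * (?g s * ?g v) \<partial>lborel) =
        ennreal ((norm (H X 0))\<^sup>2) * ((\<integral>\<^sup>+s. ?g s \<partial>lborel) * ?g v)" for v
      using gm by (subst nn_integral_cmult) (auto simp: nn_integral_multc)
    moreover have "(\<integral>\<^sup>+v. ennreal ((norm (H X 0))\<^sup>2) * ((\<integral>\<^sup>+s. ?g s \<partial>lborel) * ?g v) \<partial>lborel) =
        ennreal ((norm (H X 0))\<^sup>2) * ((\<integral>\<^sup>+s. ?g s \<partial>lborel) * (\<integral>\<^sup>+v. ?g v \<partial>lborel))"
      using gm by (simp add: nn_integral_cmult)
    ultimately show ?thesis
      unfolding gaussian_euclidean(3)[OF \<Lambda>] power2_eq_square[of "ennreal _"] by simp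
  qed
  have "ennreal ((norm (H X 0))\<^sup>2) * (ennreal (sqrt (pi / \<Lambda>) ^ DIM('a)))\<^sup>2 \<le>
     (\<integral>\<^sup>+v. \<integral>\<^sup>+s. \<integral>\<^sup>+\<theta>. indicator {0..1} \<theta> * ?R \<theta> s v \<partial>lborel \<partial>lborel \<partial>lborel)"
    unfolding N[symmetric] by (intro nn_integral_mono pt)
  also have "\<dots> = (\<integral>\<^sup>+v. \<integral>\<^sup>+\<theta>. \<integral>\<^sup>+s. indicator {0..1} \<theta> * ?R \<theta> s v \<partial>lborel \<partial>lborel \<partial>lborel)"
  proof (rule nn_integral_cong, rule lborel_pair.Fubini')
    fix v :: 'a
    have [measurable]: "(\<lambda>x. ?R (fst x) (snd x) v) \<in> borel_measurable (lborel \<Otimes>\<^sub>M lborel)"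
      by (rule Fm) measurable
    show "(\<lambda>(\<theta>, s). indicator {0..1} \<theta> * ?R \<theta> s v) \<in> borel_measurable (lborel \<Otimes>\<^sub>M lborel)"
      unfolding split_beta' by measurable
  qed
  also have "\<dots> = (\<integral>\<^sup>+\<theta>. \<integral>\<^sup>+v. \<integral>\<^sup>+s. indicator {0..1} \<theta> * ?R \<theta> s v \<partial>lborel \<partial>lborel \<partial>lborel)"
  proof (rule lborel_pair.Fubini')
    have "(\<lambda>x. ?R (fst (fst x)) (snd x) (snd (fst x))) \<in> borel_measurable ((lborel \<Otimes>\<^sub>M lborel) \<Otimes>\<^sub>M lborel)"
      by (rule Fm) measurable
    then have m3: "(\<lambda>x. indicator {0..1} (fst (fst x)) * ?R (fst (fst x)) (snd x) (snd (fst x))) \<in> borel_measurable ((lborel \<Otimes>\<^sub>M lborel) \<Otimes>\<^sub>M lborel)"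
      by measurable
    show "(\<lambda>(\<theta>, v). \<integral>\<^sup>+s. indicator {0..1} \<theta> * ?R \<theta> s v \<partial>lborel) \<in> borel_measurable (lborel \<Otimes>\<^sub>M lborel)"
      unfolding split_beta'
      by (rule lborel.borel_measurable_nn_integral) (simp only: split_beta' m3)
  qed
  also have "\<dots> = (\<integral>\<^sup>+\<theta>. indicator {0..1} \<theta> * (\<integral>\<^sup>+v. \<integral>\<^sup>+s. ?R \<theta> s v \<partial>lborel \<partial>lborel) \<partial>lborel)"
    by (intro nn_integral_cong) (simp split: split_indicator)
  also have "\<dots> = (\<integral>\<^sup>+\<theta>. indicator {0..1::real} \<theta> * ?I \<partial>lborel)"
  proof (rule nn_integral_cong_AE)
    \<comment> \<open>The half turn \<open>\<theta> = 1/2\<close> is the one angle without a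
      decomposition into shears; it is a null set.\<close>
    have "AE \<theta> in lborel. \<theta> \<noteq> (1/2::real)" by (rule AE_lborel_singleton)
    then show "AE \<theta> in lborel. indicator {0..1} \<theta> * (\<integral>\<^sup>+v. \<integral>\<^sup>+s. ?R \<theta> s v \<partial>lborel \<partial>lborel) = indicator {0..1} \<theta> * ?I"
    proof eventually_elim
      case (elim \<theta>)
      show ?case
      proof (cases "\<theta> \<in> {0..1}")
        case True
        have "?c \<theta> \<noteq> -1"
        proof
          assume "?c \<theta> = -1"
          then obtain n :: int where n: "2 * pi * \<theta> = (2 * of_int n + 1) * pi"
            unfolding cos_eq_minus1 by (auto simp: algebra_simps)
          then have "pi * (2 * \<theta>) = pi * (2 * of_int n + 1)" by (simp only: mult_ac)
          then have "2 * \<theta> = 2 * of_int n + 1" by simp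
          then have "n = 0" using True by auto
          with \<open>2 * \<theta> = 2 * of_int n + 1\<close> elim show False by simp
        qed
        moreover have "(\<lambda>z. ennreal (?F (fst z) (snd z))) \<in> borel_measurable borel"
          by (rule Fm; rule borel_measurable_continuous_onI; intro continuous_intros)
        ultimately show ?thesis
          using nn_integral_plane_rotation[of "\<lambda>s v. ennreal (?F s v)" "?c \<theta>" "?s \<theta>"] by simp
      qed simp
    qed
  qed
  also have "\<dots> = ?I" by (simp add: nn_integral_multc)
  finally show ?thesis .
qed

subsection \<open>Exponential sums with quadratic phases\<close>

text \<open>The value at \<open>X + \<i>v\<close> of \<open>exp (\<i>q)\<close> for the quadratic function \<open>q X = X \<bullet> \<Omega> X + 2 * (g \<bullet> X) + c\<close>,
  with \<open>\<Omega>\<close> self-adjoint.\<close>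
definition qwave :: "('a::euclidean_space \<Rightarrow> 'a) \<Rightarrow> 'a \<Rightarrow> real \<Rightarrow> 'a \<Rightarrow> 'a \<Rightarrow> complex" where
  "qwave \<Omega> g c X v = exp (Complex (- 2 * (v \<bullet> (\<Omega> X + g))) (X \<bullet> \<Omega> X - v \<bullet> \<Omega> v + 2 * (g \<bullet> X) + c))"

lemma qwave_holomorphic:
  assumes lin: "linear \<Omega>" and sym: "\<And>x y. x \<bullet> \<Omega> y = \<Omega> x \<bullet> y"
  shows "(\<lambda>z. qwave \<Omega> g c (X + (Re z *\<^sub>R s - Im z *\<^sub>R v)) (Im z *\<^sub>R s + Re z *\<^sub>R v)) holomorphic_on A"
proof -
  \<comment> \<open>\<open>A1\<close> and \<open>A2\<close> are the first and second order
    coefficients of the complexified quadratic function along the direction \<open>s + i v\<close>,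
    so the exponent is a polynomial in \<open>z\<close>.\<close>
  define A1 where "A1 = Complex (2 * ((\<Omega> X + g) \<bullet> s)) (2 * ((\<Omega> X + g) \<bullet> v))"
  define A2 where "A2 = Complex (s \<bullet> \<Omega> s - v \<bullet> \<Omega> v) (2 * (s \<bullet> \<Omega> v))"
  define q where "q = X \<bullet> \<Omega> X + 2 * (g \<bullet> X) + c"
  note lin_simps = linear_add[OF lin] linear_diff[OF lin] linear_cmul[OF lin]
  have "qwave \<Omega> g c (X + (Re z *\<^sub>R s - Im z *\<^sub>R v)) (Im z *\<^sub>R s + Re z *\<^sub>R v) = exp (\<i> * (of_real q + z * A1 + z\<^sup>2 * A2))" for z
    unfolding qwave_def A1_def A2_def q_def
    apply (rule arg_cong[where f=exp])
    using sym[of X s] sym[of X v] sym[of s v] sym[of v s]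
    by (simp add: complex_eq_iff lin_simps inner_simps inner_commute power2_eq_square algebra_simps)
  then show ?thesis by (simp add: holomorphic_intros)
qed

lemma continuous_on_qwave:
  assumes lin: "linear \<Omega>" and f: "continuous_on A f" and h: "continuous_on A h"
  shows "continuous_on A (\<lambda>z. qwave \<Omega> g c (f z) (h z))"
proof -
  have "continuous_on UNIV \<Omega>" using lin by (simp add: linear_continuous_on linear_conv_bounded_linear)
  then have "continuous_on A (\<lambda>z. \<Omega> (f z))" "continuous_on A (\<lambda>z. \<Omega> (h z))"
    using f h by (auto intro: continuous_on_compose2)
  then show ?thesis unfolding qwave_def Complex_eq using f h by (intro continuous_intros)
qed

text \<open>Multiplying by a conjugate subtracts the phases and adds the growth exponents. This is
  \<open>quadratic_gaussian\<close> for \<open>\<Omega>1 - \<Omega>2\<close>, with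
  \<open>m = \<Omega>1 v + \<Omega>2 v\<close> and with \<open>g\<close> equal to half the
  difference of the gradients at \<open>X0\<close>. The last factor says that only pairs of phases
  with nearly equal gradients interact.\<close>

lemma qwave_pair:
  fixes \<Omega>1 \<Omega>2 :: "'a::euclidean_space \<Rightarrow> 'a" and X0 v g1 g2 :: 'a and b w c1 c2 :: real
  assumes lin: "linear \<Omega>1" "linear \<Omega>2"
    and sym: "\<And>x y. x \<bullet> \<Omega>1 y = \<Omega>1 x \<bullet> y" "\<And>x y. x \<bullet> \<Omega>2 y = \<Omega>2 x \<bullet> y"
    and nrm: "\<And>x. norm (\<Omega>1 x - \<Omega>2 x) = w * norm x" and b: "b > 0"
  defines "E \<equiv> \<lambda>S. of_real (exp (- 2 * b * (norm S)\<^sup>2)) * (qwave \<Omega>1 g1 c1 (X0 + S) v * cnj (qwave \<Omega>2 g2 c2 (X0 + S) v))"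
  shows "integrable lborel E"
    and "norm (\<integral>S. E S \<partial>lborel) \<le> exp (2 * norm v * (norm (\<Omega>1 X0 + g1) + norm (\<Omega>2 X0 + g2)) + (norm (\<Omega>1 v + \<Omega>2 v))\<^sup>2 / b) *
      (sqrt (pi / sqrt (4 * b\<^sup>2 + w\<^sup>2)) ^ DIM('a) *
       exp (- b * (norm (\<Omega>1 X0 - \<Omega>2 X0 + g1 - g2))\<^sup>2 / (4 * b\<^sup>2 + w\<^sup>2)))"
proof -
  let ?\<Omega> = "\<lambda>x. \<Omega>1 x - \<Omega>2 x" and ?m = "\<Omega>1 v + \<Omega>2 v" and ?g = "\<Omega>1 X0 - \<Omega>2 X0 + g1 - g2"
  have lin': "linear ?\<Omega>" by (rule linear_compose_sub[OF lin])
  have sym': "x \<bullet> ?\<Omega> y = ?\<Omega> x \<bullet> y" for x y using sym by (simp add: inner_simps)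
  let ?f = "\<lambda>S. exp (Complex (- 2 * b * (norm S)\<^sup>2 - 2 * (?m \<bullet> S)) (S \<bullet> ?\<Omega> S + 2 * (?g \<bullet> S)))"
  define K where "K = exp (Complex (- 2 * (v \<bullet> (\<Omega>1 X0 + g1 + \<Omega>2 X0 + g2)))
     (X0 \<bullet> \<Omega>1 X0 - v \<bullet> \<Omega>1 v + 2 * (g1 \<bullet> X0) + c1 - (X0 \<bullet> \<Omega>2 X0 - v \<bullet> \<Omega>2 v + 2 * (g2 \<bullet> X0) + c2)))"
  note lin_simps = linear_add[OF lin(1)] linear_add[OF lin(2)]
  have E: "E S = K * ?f S" for S
    unfolding E_def K_def qwave_def exp_cnj exp_of_real[symmetric] exp_add[symmetric]
    apply (rule arg_cong[where f=exp])
    using sym(1)[of X0 S] sym(2)[of X0 S] sym(1)[of v S] sym(2)[of v S]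
    by (simp add: complex_eq_iff lin_simps inner_simps inner_commute algebra_simps)
  note Q = quadratic_gaussian[OF lin' sym' nrm b, of ?m ?g]
  show "integrable lborel E" unfolding E using Q(1) by simp
  have den: "4 * b\<^sup>2 + w\<^sup>2 > 0" using b by (simp add: add_pos_nonneg)
  let ?R = "sqrt (pi / sqrt (4 * b\<^sup>2 + w\<^sup>2)) ^ DIM('a) * exp ((norm ?m)\<^sup>2 / b - b * (norm ?g)\<^sup>2 / (4 * b\<^sup>2 + w\<^sup>2))"
  have "(norm (\<integral>S. ?f S \<partial>lborel))\<^sup>2 \<le> (pi / sqrt (4 * b\<^sup>2 + w\<^sup>2)) ^ DIM('a) *
      exp (2 * (norm ?m)\<^sup>2 / b - 2 * b * (norm ?g)\<^sup>2 / (4 * b\<^sup>2 + w\<^sup>2))"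
    by (rule Q(2))
  also have "\<dots> = ?R\<^sup>2"
    unfolding power_mult_distrib exp_double[symmetric]
    using den by (simp add: power_even_eq[symmetric] power_mult[symmetric] mult.commute[of "DIM('a)" 2] power_mult right_diff_distrib mult.assoc)
  finally have 1: "norm (\<integral>S. ?f S \<partial>lborel) \<le> ?R"
    by (rule power2_le_imp_le) (use den in auto)
  have "- 2 * (v \<bullet> (\<Omega>1 X0 + g1 + \<Omega>2 X0 + g2)) \<le> 2 * norm v * (norm (\<Omega>1 X0 + g1) + norm (\<Omega>2 X0 + g2))"
  proof -
    have "- (v \<bullet> ((\<Omega>1 X0 + g1) + (\<Omega>2 X0 + g2))) \<le> norm v * norm ((\<Omega>1 X0 + g1) + (\<Omega>2 X0 + g2))"
      using Cauchy_Schwarz_ineq2[of v "(\<Omega>1 X0 + g1) + (\<Omega>2 X0 + g2)"] by linarith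
    also have "\<dots> \<le> norm v * (norm (\<Omega>1 X0 + g1) + norm (\<Omega>2 X0 + g2))"
      by (intro mult_left_mono norm_triangle_ineq) auto
    finally show ?thesis by (simp add: add.assoc)
  qed
  then have 2: "norm K \<le> exp (2 * norm v * (norm (\<Omega>1 X0 + g1) + norm (\<Omega>2 X0 + g2)))"
    unfolding K_def norm_exp_Complex by simp
  have "norm (\<integral>S. E S \<partial>lborel) = norm K * norm (\<integral>S. ?f S \<partial>lborel)"
    unfolding E by (simp add: norm_mult)
  also have "\<dots> \<le> exp (2 * norm v * (norm (\<Omega>1 X0 + g1) + norm (\<Omega>2 X0 + g2))) * ?R"
    by (intro mult_mono 1 2) auto
  also have "\<dots> = exp (2 * norm v * (norm (\<Omega>1 X0 + g1) + norm (\<Omega>2 X0 + g2)) + (norm ?m)\<^sup>2 / b) *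
      (sqrt (pi / sqrt (4 * b\<^sup>2 + w\<^sup>2)) ^ DIM('a) * exp (- b * (norm ?g)\<^sup>2 / (4 * b\<^sup>2 + w\<^sup>2)))"
    by (simp add: exp_add exp_diff exp_minus field_simps)
  finally show "norm (\<integral>S. E S \<partial>lborel) \<le> exp (2 * norm v * (norm (\<Omega>1 X0 + g1) + norm (\<Omega>2 X0 + g2)) + (norm ?m)\<^sup>2 / b) *
      (sqrt (pi / sqrt (4 * b\<^sup>2 + w\<^sup>2)) ^ DIM('a) * exp (- b * (norm ?g)\<^sup>2 / (4 * b\<^sup>2 + w\<^sup>2)))" .
qed

section \<open>A large sieve inequality for quadratic phases\<close>

lemma integral_weighted_sum_square:
  fixes f :: "'j \<Rightarrow> 'a::euclidean_space \<Rightarrow> complex"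
  assumes J: "finite J" and e: "\<And>S. e S \<ge> 0"
    and int: "\<And>j j'. j \<in> J \<Longrightarrow> j' \<in> J \<Longrightarrow> integrable lborel (\<lambda>S. of_real (e S) * (f j S * cnj (f j' S)))"
  shows "integrable lborel (\<lambda>S. e S * (norm (\<Sum>j\<in>J. w j * f j S))\<^sup>2)"
    and "(\<integral>S. e S * (norm (\<Sum>j\<in>J. w j * f j S))\<^sup>2 \<partial>lborel) \<le>
      (\<Sum>j\<in>J. \<Sum>j'\<in>J. norm (w j) * norm (w j') * norm (\<integral>S. of_real (e S) * (f j S * cnj (f j' S)) \<partial>lborel))"
proof -
  have eq: "complex_of_real (e S * (norm (\<Sum>j\<in>J. w j * f j S))\<^sup>2) =
    (\<Sum>j\<in>J. \<Sum>j'\<in>J. (w j * cnj (w j')) * (of_real (e S) * (f j S * cnj (f j' S))))" for S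
    unfolding of_real_mult complex_norm_square cnj_sum unfolding sum_product unfolding sum_distrib_left by (simp add: mult_ac)
  have ci: "integrable lborel (\<lambda>S. complex_of_real (e S * (norm (\<Sum>j\<in>J. w j * f j S))\<^sup>2))"
    unfolding eq by (intro Bochner_Integration.integrable_sum integrable_mult_right int)
  then show "integrable lborel (\<lambda>S. e S * (norm (\<Sum>j\<in>J. w j * f j S))\<^sup>2)"
    unfolding complex_of_real_integrable_eq .
  have "(\<integral>S. e S * (norm (\<Sum>j\<in>J. w j * f j S))\<^sup>2 \<partial>lborel) \<le>
      norm (complex_of_real (\<integral>S. e S * (norm (\<Sum>j\<in>J. w j * f j S))\<^sup>2 \<partial>lborel))"
    by simp
  also have "complex_of_real (\<integral>S. e S * (norm (\<Sum>j\<in>J. w j * f j S))\<^sup>2 \<partial>lborel) =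
     (\<integral>S. (\<Sum>j\<in>J. \<Sum>j'\<in>J. (w j * cnj (w j')) * (of_real (e S) * (f j S * cnj (f j' S)))) \<partial>lborel)"
    unfolding integral_complex_of_real[symmetric] eq ..
  also have "\<dots> = (\<Sum>j\<in>J. \<Sum>j'\<in>J. (w j * cnj (w j')) * (\<integral>S. of_real (e S) * (f j S * cnj (f j' S)) \<partial>lborel))"
  proof -
    have "(\<integral>S. (\<Sum>j\<in>J. \<Sum>j'\<in>J. (w j * cnj (w j')) * (of_real (e S) * (f j S * cnj (f j' S)))) \<partial>lborel) =
        (\<Sum>j\<in>J. (\<integral>S. (\<Sum>j'\<in>J. (w j * cnj (w j')) * (of_real (e S) * (f j S * cnj (f j' S)))) \<partial>lborel))"
      by (rule Bochner_Integration.integral_sum) (intro Bochner_Integration.integrable_sum integrable_mult_right int)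
    also have "\<dots> = (\<Sum>j\<in>J. \<Sum>j'\<in>J. (\<integral>S. (w j * cnj (w j')) * (of_real (e S) * (f j S * cnj (f j' S))) \<partial>lborel))"
      by (intro sum.cong refl Bochner_Integration.integral_sum integrable_mult_right int)
    finally show ?thesis by simp
  qed
  also have "norm \<dots> \<le> (\<Sum>j\<in>J. \<Sum>j'\<in>J. norm (w j) * norm (w j') * norm (\<integral>S. of_real (e S) * (f j S * cnj (f j' S)) \<partial>lborel))"
    by (intro sum_norm_le) (simp add: norm_mult sum_norm_le)
  finally show "(\<integral>S. e S * (norm (\<Sum>j\<in>J. w j * f j S))\<^sup>2 \<partial>lborel) \<le>
      (\<Sum>j\<in>J. \<Sum>j'\<in>J. norm (w j) * norm (w j') * norm (\<integral>S. of_real (e S) * (f j S * cnj (f j' S)) \<partial>lborel))" .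
qed

lemma weighted_mean_square:
  fixes G :: "'i \<Rightarrow> complex"
  assumes A: "\<And>i. i \<in> I \<Longrightarrow> A i \<ge> 0" and le1: "sum A I \<le> 1"
  shows "(norm (\<Sum>i\<in>I. of_real (A i) * G i))\<^sup>2 \<le> (\<Sum>i\<in>I. A i * (norm (G i))\<^sup>2)"
proof -
  have "norm (\<Sum>i\<in>I. of_real (A i) * G i) \<le> (\<Sum>i\<in>I. sqrt (A i) * (sqrt (A i) * norm (G i)))"
    using A by (intro sum_norm_le) (simp add: norm_mult mult.assoc[symmetric])
  then have "(norm (\<Sum>i\<in>I. of_real (A i) * G i))\<^sup>2 \<le> (\<Sum>i\<in>I. sqrt (A i) * (sqrt (A i) * norm (G i)))\<^sup>2"
    by (intro power_mono) auto
  also have "\<dots> \<le> (\<Sum>i\<in>I. (sqrt (A i))\<^sup>2) * (\<Sum>i\<in>I. (sqrt (A i) * norm (G i))\<^sup>2)"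
    by (rule Cauchy_Schwarz_ineq_sum)
  also have "\<dots> = sum A I * (\<Sum>i\<in>I. A i * (norm (G i))\<^sup>2)"
    using A by (simp add: power_mult_distrib cong: sum.cong)
  also have "\<dots> \<le> 1 * (\<Sum>i\<in>I. A i * (norm (G i))\<^sup>2)"
    using A le1 by (intro mult_right_mono sum_nonneg) auto
  finally show ?thesis by simp
qed

text \<open>After Cauchy-Schwarz over \<open>I\<close>, each value at \<open>X i\<close> is replaced
  by a Gaussian average over the complexified space. The sum over \<open>I\<close> then touches only
  the Gaussian weights, and \<open>maj\<close> replaces these by one Gaussian about
  \<open>X0\<close>. What is left is a double sum over \<open>J\<close> of explicit integrals. The
  arrangement of the points \<open>X i\<close> enters through \<open>D\<close> alone.\<close>

lemma quadratic_exponential_sum_bound: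
  fixes \<Omega> :: "'j \<Rightarrow> 'a::euclidean_space \<Rightarrow> 'a" and X :: "'i \<Rightarrow> 'a"
  assumes I: "finite I" "\<And>i. i \<in> I \<Longrightarrow> A i \<ge> 0" "sum A I \<le> 1" and J: "finite J"
    and lin: "\<And>j. j \<in> J \<Longrightarrow> linear (\<Omega> j)"
    and sym: "\<And>j x y. j \<in> J \<Longrightarrow> x \<bullet> \<Omega> j y = \<Omega> j x \<bullet> y"
    and up: "\<And>j x. j \<in> J \<Longrightarrow> norm (\<Omega> j x) \<le> 2 * r * norm x"
    and H: "\<And>j. j \<in> J \<Longrightarrow> norm (\<Omega> j X0 + g j) \<le> 2 * r * H"
    and pair: "\<And>j j' x. j \<in> J \<Longrightarrow> j' \<in> J \<Longrightarrow> norm (\<Omega> j x - \<Omega> j' x) = \<omega> j j' * norm x"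
    and r: "r > 0" and b: "b \<ge> 64" and D: "D \<ge> 0"
    and maj: "\<And>Y. (\<Sum>i\<in>I. A i * exp (- r\<^sup>2 * (norm (Y - X i))\<^sup>2)) \<le> D * exp (- 2 * b * (norm (Y - X0))\<^sup>2)"
  shows "(norm (\<Sum>i\<in>I. of_real (A i) * (\<Sum>j\<in>J. w j * qwave (\<Omega> j) (g j) (c j) (X i) 0)))\<^sup>2 \<le>
    sqrt (2 * r\<^sup>2 / pi) ^ DIM('a) * exp (64 * H\<^sup>2) * D *
      (\<Sum>j\<in>J. \<Sum>j'\<in>J. norm (w j) * norm (w j') * (sqrt (pi / sqrt (4 * b\<^sup>2 + (\<omega> j j')\<^sup>2)) ^ DIM('a) *
         exp (- b * (norm (\<Omega> j X0 - \<Omega> j' X0 + g j - g j'))\<^sup>2 / (4 * b\<^sup>2 + (\<omega> j j')\<^sup>2))))"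
    (is "?L \<le> _ * _ * _ * ?T")
proof -
  define G where "G = (\<lambda>Y v. \<Sum>j\<in>J. w j * qwave (\<Omega> j) (g j) (c j) Y v)"
  define N where "N = sqrt (pi / r\<^sup>2) ^ DIM('a)"
  have Gc: "continuous_on UNIV (\<lambda>z. G (fst z) (snd z))"
    unfolding G_def using lin by (intro continuous_intros continuous_on_qwave) auto
  have Gmb: "(\<lambda>z. G (fst z) (snd z)) \<in> borel_measurable borel"
    by (rule borel_measurable_continuous_onI[OF Gc])
  have Gm: "(\<lambda>x. G (f x) (h x)) \<in> borel_measurable M"
    if "f \<in> borel_measurable M" "h \<in> borel_measurable M" for f h and M :: "'b measure"
    using measurable_compose[OF _ Gmb, of "\<lambda>x. (f x, h x)" M] that by (simp add: borel_measurable_Pair)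
  have Gm1 [measurable]: "(\<lambda>x. G x v) \<in> borel_measurable borel" for v by (rule Gm) auto
  have Gm2 [measurable]: "(\<lambda>x. G (snd x) (fst x)) \<in> borel_measurable (borel \<Otimes>\<^sub>M borel)" by (rule Gm) auto
  have Tpos: "?T \<ge> 0" by (intro sum_nonneg mult_nonneg_nonneg) auto
  let ?e = "\<lambda>x::'a. exp (- r\<^sup>2 * (norm x)\<^sup>2)"
  \<comment> \<open>The rate \<open>r^2\<close> is matched to the frequencies: an imaginary
    displacement \<open>v\<close> lets the waves grow by about \<open>exp (O(r * |v|))\<close>,
    which a Gaussian of width \<open>1/r\<close> can absorb.\<close>
  have step: "ennreal ((norm (G (X i) 0))\<^sup>2) * (ennreal N)\<^sup>2 \<le>
     (\<integral>\<^sup>+v. \<integral>\<^sup>+Y. ennreal (?e (Y - X i) * ?e v * (norm (G Y v))\<^sup>2) \<partial>lborel \<partial>lborel)" for i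
  proof -
    have "ennreal ((norm (G (X i) 0))\<^sup>2) * (ennreal N)\<^sup>2 \<le>
       (\<integral>\<^sup>+v. \<integral>\<^sup>+s. ennreal (?e s * ?e v * (norm (G (X i + s) v))\<^sup>2) \<partial>lborel \<partial>lborel)"
      unfolding N_def
    proof (rule gaussian_mean_square[OF Gc])
      show "(\<lambda>z. G (X i + (Re z *\<^sub>R s - Im z *\<^sub>R v)) (Im z *\<^sub>R s + Re z *\<^sub>R v)) holomorphic_on UNIV" for s v
        unfolding G_def using lin sym by (intro holomorphic_intros qwave_holomorphic) auto
    qed (use r in auto)
    also have "\<dots> = (\<integral>\<^sup>+v. \<integral>\<^sup>+Y. ennreal (?e (Y - X i) * ?e v * (norm (G Y v))\<^sup>2) \<partial>lborel \<partial>lborel)"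
    proof (rule nn_integral_cong)
      fix v
      have "(\<lambda>Y. ennreal (?e (Y - X i) * ?e v * (norm (G Y v))\<^sup>2)) \<in> borel_measurable borel" by measurable
      from nn_integral_lborel_translation[OF this, of "X i"]
      show "(\<integral>\<^sup>+s. ennreal (?e s * ?e v * (norm (G (X i + s) v))\<^sup>2) \<partial>lborel) =
        (\<integral>\<^sup>+Y. ennreal (?e (Y - X i) * ?e v * (norm (G Y v))\<^sup>2) \<partial>lborel)" by simp
    qed
    finally show ?thesis .
  qed
  have inner: "(\<integral>\<^sup>+Y. ennreal (D * exp (- 2 * b * (norm (Y - X0))\<^sup>2) * ?e v * (norm (G Y v))\<^sup>2) \<partial>lborel) \<le>
      ennreal (D * exp (64 * H\<^sup>2) * ?T) * ennreal (exp (- (r\<^sup>2 / 2) * (norm v)\<^sup>2))" for v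
  proof -
    let ?E = "\<lambda>S::'a. exp (- 2 * b * (norm S)\<^sup>2)"
    let ?f = "\<lambda>j S. qwave (\<Omega> j) (g j) (c j) (X0 + S) v"
    have b0: "b > 0" using b by simp
    note P = qwave_pair[OF lin lin sym sym pair b0]
    have int: "integrable lborel (\<lambda>S. of_real (?E S) * (?f j S * cnj (?f j' S)))" if "j \<in> J" "j' \<in> J" for j j'
      using P(1)[of j j'] that by simp
    note W = integral_weighted_sum_square[OF J _ int, where w=w]
    have iW: "integrable lborel (\<lambda>S. ?E S * (norm (G (X0 + S) v))\<^sup>2)"
      unfolding G_def by (rule W(1)) auto
    have "(\<integral>S. ?E S * (norm (G (X0 + S) v))\<^sup>2 \<partial>lborel) \<le>
       (\<Sum>j\<in>J. \<Sum>j'\<in>J. norm (w j) * norm (w j') * norm (\<integral>S. of_real (?E S) * (?f j S * cnj (?f j' S)) \<partial>lborel))"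
      unfolding G_def by (rule W(2)) auto
    also have "\<dots> \<le> (\<Sum>j\<in>J. \<Sum>j'\<in>J. norm (w j) * norm (w j') * (exp (8 * r * H * norm v + 16 * r\<^sup>2 * (norm v)\<^sup>2 / b) *
       (sqrt (pi / sqrt (4 * b\<^sup>2 + (\<omega> j j')\<^sup>2)) ^ DIM('a) *
         exp (- b * (norm (\<Omega> j X0 - \<Omega> j' X0 + g j - g j'))\<^sup>2 / (4 * b\<^sup>2 + (\<omega> j j')\<^sup>2)))))"
    proof (intro sum_mono mult_left_mono)
      fix j j' assume jj: "j \<in> J" "j' \<in> J"
      let ?R = "sqrt (pi / sqrt (4 * b\<^sup>2 + (\<omega> j j')\<^sup>2)) ^ DIM('a) *
         exp (- b * (norm (\<Omega> j X0 - \<Omega> j' X0 + g j - g j'))\<^sup>2 / (4 * b\<^sup>2 + (\<omega> j j')\<^sup>2))"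
      have "norm (\<integral>S. of_real (?E S) * (?f j S * cnj (?f j' S)) \<partial>lborel) \<le>
         exp (2 * norm v * (norm (\<Omega> j X0 + g j) + norm (\<Omega> j' X0 + g j')) + (norm (\<Omega> j v + \<Omega> j' v))\<^sup>2 / b) * ?R"
        using P(2)[of j j'] jj by simp
      also have "\<dots> \<le> exp (8 * r * H * norm v + 16 * r\<^sup>2 * (norm v)\<^sup>2 / b) * ?R"
      proof (intro mult_right_mono)
        have "2 * norm v * (norm (\<Omega> j X0 + g j) + norm (\<Omega> j' X0 + g j')) \<le> 2 * norm v * (2 * r * H + 2 * r * H)"
          using H jj by (intro mult_left_mono add_mono) auto
        moreover have "norm (\<Omega> j v + \<Omega> j' v) \<le> 2 * r * norm v + 2 * r * norm v"
          using up[OF jj(1), of v] up[OF jj(2), of v] norm_triangle_ineq[of "\<Omega> j v" "\<Omega> j' v"] by linarith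
        then have "(norm (\<Omega> j v + \<Omega> j' v))\<^sup>2 \<le> (4 * r * norm v)\<^sup>2" by (intro power_mono) auto
        then have "(norm (\<Omega> j v + \<Omega> j' v))\<^sup>2 / b \<le> 16 * r\<^sup>2 * (norm v)\<^sup>2 / b"
          using b0 by (intro divide_right_mono) (auto simp: power_mult_distrib)
        ultimately show "exp (2 * norm v * (norm (\<Omega> j X0 + g j) + norm (\<Omega> j' X0 + g j')) + (norm (\<Omega> j v + \<Omega> j' v))\<^sup>2 / b) \<le>
           exp (8 * r * H * norm v + 16 * r\<^sup>2 * (norm v)\<^sup>2 / b)" by (simp add: algebra_simps)
      qed (use b in \<open>auto intro!: mult_nonneg_nonneg\<close>)
      finally show "norm (\<integral>S. of_real (?E S) * (?f j S * cnj (?f j' S)) \<partial>lborel) \<le>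
        exp (8 * r * H * norm v + 16 * r\<^sup>2 * (norm v)\<^sup>2 / b) * ?R" .
    qed auto
    also have "\<dots> = exp (8 * r * H * norm v + 16 * r\<^sup>2 * (norm v)\<^sup>2 / b) * ?T"
      unfolding sum_distrib_left by (intro sum.cong refl) (simp only: mult_ac)
    finally have le1: "(\<integral>S. ?E S * (norm (G (X0 + S) v))\<^sup>2 \<partial>lborel) \<le> exp (8 * r * H * norm v + 16 * r\<^sup>2 * (norm v)\<^sup>2 / b) * ?T" .
    have "(\<integral>\<^sup>+Y. ennreal (D * exp (- 2 * b * (norm (Y - X0))\<^sup>2) * ?e v * (norm (G Y v))\<^sup>2) \<partial>lborel) =
        (\<integral>\<^sup>+S. ennreal (D * ?E S * ?e v * (norm (G (X0 + S) v))\<^sup>2) \<partial>lborel)"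
    proof -
      have "(\<lambda>Y. ennreal (D * exp (- 2 * b * (norm (Y - X0))\<^sup>2) * ?e v * (norm (G Y v))\<^sup>2)) \<in> borel_measurable borel" by measurable
      from nn_integral_lborel_translation[OF this, of X0] show ?thesis by simp
    qed
    also have "\<dots> = (\<integral>\<^sup>+S. ennreal ((D * ?e v) * (?E S * (norm (G (X0 + S) v))\<^sup>2)) \<partial>lborel)"
      by (simp only: mult_ac)
    also have "\<dots> = ennreal (\<integral>S. (D * ?e v) * (?E S * (norm (G (X0 + S) v))\<^sup>2) \<partial>lborel)"
      using iW D by (intro nn_integral_eq_integral integrable_mult_right) (auto intro!: AE_I2)
    also have "\<dots> = ennreal ((D * ?e v) * (\<integral>S. ?E S * (norm (G (X0 + S) v))\<^sup>2 \<partial>lborel))" by simp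
    also have "\<dots> \<le> ennreal ((D * ?e v) * (exp (8 * r * H * norm v + 16 * r\<^sup>2 * (norm v)\<^sup>2 / b) * ?T))"
      using D by (intro ennreal_leI mult_left_mono le1) auto
    also have "\<dots> = ennreal (D * ?T * exp (- r\<^sup>2 * (norm v)\<^sup>2 + (8 * r * H * norm v + 16 * r\<^sup>2 * (norm v)\<^sup>2 / b)))"
      unfolding exp_add by (simp only: mult_ac)
    also have "\<dots> \<le> ennreal (D * ?T * exp (64 * H\<^sup>2 + (- (r\<^sup>2 / 2) * (norm v)\<^sup>2)))"
    \<comment> \<open>Absorbs the growth in the imaginary direction. \<open>b >= 64\<close> makes
      the quadratic term at most a quarter of \<open>r^2 * |v|^2\<close>, and the linear term costs
      another quarter and the constant \<open>64 * H^2\<close>; half of the decay survives.\<close>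
    proof (intro ennreal_leI mult_left_mono)
      have "16 * r\<^sup>2 * (norm v)\<^sup>2 / b \<le> 16 * r\<^sup>2 * (norm v)\<^sup>2 / 64" using b by (intro divide_left_mono) auto
      then have 1: "16 * r\<^sup>2 * (norm v)\<^sup>2 / b \<le> r\<^sup>2 * (norm v)\<^sup>2 / 4" by simp
      have "(r * norm v / 2 - 8 * H)\<^sup>2 \<ge> 0" by simp
      then have 2: "8 * r * H * norm v \<le> 64 * H\<^sup>2 + r\<^sup>2 * (norm v)\<^sup>2 / 4"
        by (simp add: power2_diff power_mult_distrib power_divide algebra_simps)
      have 3: "- r\<^sup>2 * (norm v)\<^sup>2 = - (r\<^sup>2 * (norm v)\<^sup>2)" "- (r\<^sup>2 / 2) * (norm v)\<^sup>2 = - (r\<^sup>2 * (norm v)\<^sup>2) / 2" by simp_all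
      show "exp (- r\<^sup>2 * (norm v)\<^sup>2 + (8 * r * H * norm v + 16 * r\<^sup>2 * (norm v)\<^sup>2 / b)) \<le>
          exp (64 * H\<^sup>2 + (- (r\<^sup>2 / 2) * (norm v)\<^sup>2))"
        unfolding exp_le_cancel_iff 3 using 1 2 by linarith
      show "0 \<le> D * ?T" using D Tpos by simp
    qed
    also have "\<dots> = ennreal (D * exp (64 * H\<^sup>2) * ?T) * ennreal (exp (- (r\<^sup>2 / 2) * (norm v)\<^sup>2))"
      unfolding exp_add using D Tpos by (subst ennreal_mult[symmetric]) (auto simp: mult_ac)
    finally show ?thesis .
  qed
  have joint: "(\<lambda>v. \<integral>\<^sup>+Y. ennreal (?e (Y - X i) * ?e v * (norm (G Y v))\<^sup>2) \<partial>lborel) \<in> borel_measurable lborel" for i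
    by (rule lborel.borel_measurable_nn_integral) (simp add: split_beta')
  have jointA: "(\<lambda>v. \<integral>\<^sup>+Y. ennreal (A i) * ennreal (?e (Y - X i) * ?e v * (norm (G Y v))\<^sup>2) \<partial>lborel) \<in> borel_measurable lborel" for i
    by (rule lborel.borel_measurable_nn_integral) (simp add: split_beta')
  have "ennreal ((\<Sum>i\<in>I. A i * (norm (G (X i) 0))\<^sup>2) * N\<^sup>2) =
      (\<Sum>i\<in>I. ennreal (A i) * (ennreal ((norm (G (X i) 0))\<^sup>2) * (ennreal N)\<^sup>2))"
  proof -
    have "N \<ge> 0" by (simp add: N_def)
    then have "ennreal (A i) * (ennreal ((norm (G (X i) 0))\<^sup>2) * (ennreal N)\<^sup>2) = ennreal (A i * (norm (G (X i) 0))\<^sup>2 * N\<^sup>2)" if "i \<in> I" for i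
      using I(2)[OF that] by (simp add: ennreal_mult ennreal_power mult.assoc)
    then show ?thesis using I by (simp add: sum_distrib_right sum_ennreal)
  qed
  also have "\<dots> \<le> (\<Sum>i\<in>I. ennreal (A i) * (\<integral>\<^sup>+v. \<integral>\<^sup>+Y. ennreal (?e (Y - X i) * ?e v * (norm (G Y v))\<^sup>2) \<partial>lborel \<partial>lborel))"
    by (intro sum_mono mult_left_mono step) auto
  also have "\<dots> = (\<Sum>i\<in>I. \<integral>\<^sup>+v. \<integral>\<^sup>+Y. ennreal (A i) * ennreal (?e (Y - X i) * ?e v * (norm (G Y v))\<^sup>2) \<partial>lborel \<partial>lborel)"
    using joint by (simp add: nn_integral_cmult)
  also have "\<dots> = (\<integral>\<^sup>+v. (\<Sum>i\<in>I. \<integral>\<^sup>+Y. ennreal (A i) * ennreal (?e (Y - X i) * ?e v * (norm (G Y v))\<^sup>2) \<partial>lborel) \<partial>lborel)"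
    by (rule nn_integral_sum[symmetric]) (rule jointA)
  also have "\<dots> = (\<integral>\<^sup>+v. \<integral>\<^sup>+Y. (\<Sum>i\<in>I. ennreal (A i) * ennreal (?e (Y - X i) * ?e v * (norm (G Y v))\<^sup>2)) \<partial>lborel \<partial>lborel)"
    by (intro nn_integral_cong nn_integral_sum[symmetric]) measurable
  also have "\<dots> \<le> (\<integral>\<^sup>+v. \<integral>\<^sup>+Y. ennreal (D * exp (- 2 * b * (norm (Y - X0))\<^sup>2) * ?e v * (norm (G Y v))\<^sup>2) \<partial>lborel \<partial>lborel)"
  proof (intro nn_integral_mono)
    fix v Y :: 'a
    have "(\<Sum>i\<in>I. ennreal (A i) * ennreal (?e (Y - X i) * ?e v * (norm (G Y v))\<^sup>2)) =
       ennreal ((\<Sum>i\<in>I. A i * ?e (Y - X i)) * (?e v * (norm (G Y v))\<^sup>2))"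
      unfolding sum_distrib_right using I by (simp add: ennreal_mult[symmetric] mult_ac)
    also have "\<dots> \<le> ennreal (D * exp (- 2 * b * (norm (Y - X0))\<^sup>2) * (?e v * (norm (G Y v))\<^sup>2))"
      by (intro ennreal_leI mult_right_mono maj) auto
    finally show "(\<Sum>i\<in>I. ennreal (A i) * ennreal (?e (Y - X i) * ?e v * (norm (G Y v))\<^sup>2)) \<le>
      ennreal (D * exp (- 2 * b * (norm (Y - X0))\<^sup>2) * ?e v * (norm (G Y v))\<^sup>2)" by (simp only: mult.assoc)
  qed
  also have "\<dots> \<le> (\<integral>\<^sup>+v. ennreal (D * exp (64 * H\<^sup>2) * ?T) * ennreal (exp (- (r\<^sup>2 / 2) * (norm (v::'a))\<^sup>2)) \<partial>lborel)"
    by (intro nn_integral_mono inner)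
  also have "\<dots> = ennreal (D * exp (64 * H\<^sup>2) * ?T) * ennreal (sqrt (pi / (r\<^sup>2 / 2)) ^ DIM('a))"
    using r by (subst nn_integral_cmult) (auto simp only: gaussian_euclidean(3) zero_less_power half_gt_zero_iff, measurable)
  also have "\<dots> = ennreal (D * exp (64 * H\<^sup>2) * ?T * sqrt (pi / (r\<^sup>2 / 2)) ^ DIM('a))"
    using D Tpos by (simp add: ennreal_mult)
  finally have le: "(\<Sum>i\<in>I. A i * (norm (G (X i) 0))\<^sup>2) * N\<^sup>2 \<le> D * exp (64 * H\<^sup>2) * ?T * sqrt (pi / (r\<^sup>2 / 2)) ^ DIM('a)"
    by (rule ennreal_le_iff[THEN iffD1, rotated]) (use D Tpos r in \<open>auto intro!: mult_nonneg_nonneg\<close>)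
  \<comment> \<open>The mean value inequality supplies the normalisation \<open>N\<close> twice, the
    integral over \<open>v\<close> gives back only one Gaussian integral; this is the quotient of
    the two.\<close>
  have N2: "sqrt (pi / (r\<^sup>2 / 2)) ^ DIM('a) = sqrt (2 * r\<^sup>2 / pi) ^ DIM('a) * N\<^sup>2"
  proof -
    have "sqrt (pi / (r\<^sup>2 / 2)) = sqrt (2 * r\<^sup>2 / pi) * (sqrt (pi / r\<^sup>2))\<^sup>2"
      using r by (simp add: real_sqrt_divide real_sqrt_mult field_simps power2_eq_square)
    then show ?thesis unfolding N_def
      by (simp only: power_mult_distrib power_mult[symmetric] mult.commute[of 2])
  qed
  have Np: "N\<^sup>2 > 0" unfolding N_def using r by simp
  have "?L \<le> (\<Sum>i\<in>I. A i * (norm (G (X i) 0))\<^sup>2)"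
    unfolding G_def by (rule weighted_mean_square[OF I(2,3)])
  also have "\<dots> \<le> sqrt (2 * r\<^sup>2 / pi) ^ DIM('a) * exp (64 * H\<^sup>2) * D * ?T"
  proof (rule mult_right_le_imp_le[OF _ Np])
    show "(\<Sum>i\<in>I. A i * (norm (G (X i) 0))\<^sup>2) * N\<^sup>2 \<le> (sqrt (2 * r\<^sup>2 / pi) ^ DIM('a) * exp (64 * H\<^sup>2) * D * ?T) * N\<^sup>2"
      using le unfolding N2 by (simp only: mult_ac)
  qed
  finally show ?thesis .
qed

subsection \<open>The phase of a triangle\<close>

text \<open>With \<open>W = \<surd>\<gamma> (y - x)\<close> and \<open>M = (1 - \<alpha>) x + \<alpha> y\<close>, the point \<open>z - M\<close> is orthogonal to \<open>W\<close> and of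
  the same length if and only if the triangle \<open>x y z\<close> has shape \<open>(\<alpha>, \<gamma>)\<close>; the phase is the pairing
  of \<open>\<zeta>\<close> with these two conditions.\<close>
definition tri_phase :: "complex \<Rightarrow> 'a::euclidean_space \<Rightarrow> 'a \<times> 'a \<Rightarrow> real" where
  "tri_phase \<zeta> z X = Re \<zeta> * ((norm (z - snd X))\<^sup>2 - (norm (fst X))\<^sup>2) + 2 * Im \<zeta> * (fst X \<bullet> (z - snd X))"

definition tri_op :: "complex \<Rightarrow> 'a::euclidean_space \<times> 'a \<Rightarrow> 'a \<times> 'a" where
  "tri_op \<zeta> X = (- Re \<zeta> *\<^sub>R fst X - Im \<zeta> *\<^sub>R snd X, Re \<zeta> *\<^sub>R snd X - Im \<zeta> *\<^sub>R fst X)"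

definition tri_vec :: "complex \<Rightarrow> 'a::euclidean_space \<Rightarrow> 'a \<times> 'a" where
  "tri_vec \<zeta> z = (Im \<zeta> *\<^sub>R z, - Re \<zeta> *\<^sub>R z)"

lemma cis_tri_phase: "cis (tri_phase \<zeta> z X) = qwave (tri_op \<zeta>) (tri_vec \<zeta> z) (Re \<zeta> * (norm z)\<^sup>2) X 0"
proof -
  have "tri_phase \<zeta> z X = X \<bullet> tri_op \<zeta> X + 2 * (tri_vec \<zeta> z \<bullet> X) + Re \<zeta> * (norm z)\<^sup>2"
    unfolding tri_phase_def tri_op_def tri_vec_def power2_norm_eq_inner inner_prod_def
    by (simp add: inner_simps inner_commute algebra_simps)
  moreover have "exp (Complex 0 t) = cis t" for t by (simp add: cis_conv_exp Complex_eq)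
  ultimately show ?thesis by (simp add: qwave_def)
qed

lemma linear_tri_op: "linear (tri_op \<zeta>)"
  by (rule linearI) (simp_all add: tri_op_def algebra_simps)

lemma tri_op_self_adjoint: "x \<bullet> tri_op \<zeta> y = tri_op \<zeta> x \<bullet> y"
  by (simp add: tri_op_def inner_prod_def inner_simps algebra_simps)

text \<open>The factor \<open>\<surd>\<gamma>\<close> in the choice of \<open>W\<close> serves this
  identity: the quadratic part of the phase is \<open>norm \<zeta>\<close> times an isometry. Since
  \<open>tri_op\<close> is additive in \<open>\<zeta>\<close>, differences of two such operators
  have the same form, as \<open>quadratic_gaussian\<close> requires.\<close>

lemma norm_tri_op: "norm (tri_op \<zeta> x) = norm \<zeta> * norm x"
proof -
  have "(norm (tri_op \<zeta> x))\<^sup>2 = (norm \<zeta> * norm x)\<^sup>2"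
    unfolding power_mult_distrib cmod_power2 power2_norm_eq_inner tri_op_def inner_prod_def
    by (simp add: inner_simps inner_commute algebra_simps power2_eq_square)
  then show ?thesis by (simp add: power2_eq_imp_eq)
qed

lemma tri_op_diff: "tri_op \<zeta> x - tri_op \<zeta>' x = tri_op (\<zeta> - \<zeta>') x"
  by (simp add: tri_op_def algebra_simps)

lemma norm_tri_vec: "norm (tri_vec \<zeta> z) = norm \<zeta> * norm z"
proof -
  have "(norm (tri_vec \<zeta> z))\<^sup>2 = (norm \<zeta> * norm z)\<^sup>2"
    unfolding power_mult_distrib cmod_power2 power2_norm_eq_inner tri_vec_def inner_prod_def
    by (simp add: inner_simps algebra_simps power2_eq_square)
  then show ?thesis by (simp add: power2_eq_imp_eq)
qed

text \<open>The gradient difference is a pair \<open>(gs, gt)\<close> in which \<open>z'\<close>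
  enters only through \<open>u = z - z'\<close>, with coefficients \<open>(z2, - z1)\<close>. The
  combination orthogonal to these is free of \<open>u\<close>: it is a combination of
  \<open>W\<close> and \<open>P\<close> whose coefficients have square sum
  \<open>q * |\<zeta> - \<zeta>'|^2\<close>. The parallel one equals \<open>q * (u + y')\<close>. So
  the square splits into a penalty for \<open>\<zeta> \<noteq> \<zeta>'\<close> and one for the
  distance of \<open>z'\<close> from a point \<open>y\<close> that does not depend on
  \<open>z'\<close>.\<close>

lemma tri_gradient_lower:
  fixes X0 :: "'a::euclidean_space \<times> 'a"
  assumes indep: "\<And>a b. c0 * (a\<^sup>2 + b\<^sup>2) \<le> (norm (a *\<^sub>R fst X0 + b *\<^sub>R (z - snd X0)))\<^sup>2" and \<zeta>': "\<zeta>' \<noteq> 0"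
  shows "\<exists>y. \<forall>z'. c0 * (norm (\<zeta> - \<zeta>'))\<^sup>2 + (norm \<zeta>')\<^sup>2 * (norm (z' - y))\<^sup>2 \<le>
    (norm (tri_op \<zeta> X0 - tri_op \<zeta>' X0 + tri_vec \<zeta> z - tri_vec \<zeta>' z'))\<^sup>2"
proof -
  define W where "W = fst X0"
  define P where "P = z - snd X0"
  define w1 where "w1 = Re \<zeta> - Re \<zeta>'"
  define w2 where "w2 = Im \<zeta> - Im \<zeta>'"
  define z1 where "z1 = Re \<zeta>'"
  define z2 where "z2 = Im \<zeta>'"
  define q where "q = z1\<^sup>2 + z2\<^sup>2"
  have q: "q = (norm \<zeta>')\<^sup>2" by (simp add: q_def z1_def z2_def cmod_power2)
  then have qp: "q > 0" using \<zeta>' by simp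
  have om: "(norm (\<zeta> - \<zeta>'))\<^sup>2 = w1\<^sup>2 + w2\<^sup>2" by (simp add: w1_def w2_def cmod_power2)
  define y' where "y' = (1 / q) *\<^sub>R ((z1 * w2 - z2 * w1) *\<^sub>R W + (z2 * w2 + z1 * w1) *\<^sub>R P)"
  define y where "y = z + y'"
  have "c0 * (norm (\<zeta> - \<zeta>'))\<^sup>2 + (norm \<zeta>')\<^sup>2 * (norm (z' - y))\<^sup>2 \<le>
    (norm (tri_op \<zeta> X0 - tri_op \<zeta>' X0 + tri_vec \<zeta> z - tri_vec \<zeta>' z'))\<^sup>2" for z'
  proof -
    define u where "u = z - z'"
    define gs where "gs = - w1 *\<^sub>R W + w2 *\<^sub>R P + z2 *\<^sub>R u"
    define gt where "gt = - w2 *\<^sub>R W - w1 *\<^sub>R P - z1 *\<^sub>R u"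
    have "tri_op \<zeta> X0 - tri_op \<zeta>' X0 + tri_vec \<zeta> z - tri_vec \<zeta>' z' = (gs, gt)"
      by (simp add: tri_op_def tri_vec_def gs_def gt_def w1_def w2_def z1_def z2_def u_def W_def P_def algebra_simps)
    then have g: "(norm (tri_op \<zeta> X0 - tri_op \<zeta>' X0 + tri_vec \<zeta> z - tri_vec \<zeta>' z'))\<^sup>2 = (norm gs)\<^sup>2 + (norm gt)\<^sup>2"
      by (simp add: norm_Pair)
    have split: "q * ((norm gs)\<^sup>2 + (norm gt)\<^sup>2) = (norm (z1 *\<^sub>R gs + z2 *\<^sub>R gt))\<^sup>2 + (norm (z2 *\<^sub>R gs - z1 *\<^sub>R gt))\<^sup>2"
      unfolding q_def power2_norm_eq_inner by (simp add: inner_simps inner_commute algebra_simps power2_eq_square)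
    have e1: "z1 *\<^sub>R gs + z2 *\<^sub>R gt = (- (z1 * w1 + z2 * w2)) *\<^sub>R W + (z1 * w2 - z2 * w1) *\<^sub>R P"
      by (simp add: gs_def gt_def algebra_simps)
    have "q *\<^sub>R y' = (z1 * w2 - z2 * w1) *\<^sub>R W + (z2 * w2 + z1 * w1) *\<^sub>R P"
      using qp by (simp add: y'_def)
    then have e2: "z2 *\<^sub>R gs - z1 *\<^sub>R gt = q *\<^sub>R (u + y')"
      by (simp add: gs_def gt_def q_def algebra_simps power2_eq_square)
    have id: "q * (w1\<^sup>2 + w2\<^sup>2) = (- (z1 * w1 + z2 * w2))\<^sup>2 + (z1 * w2 - z2 * w1)\<^sup>2"
      by (simp add: q_def algebra_simps power2_eq_square)
    have 1: "c0 * (q * (w1\<^sup>2 + w2\<^sup>2)) \<le> (norm (z1 *\<^sub>R gs + z2 *\<^sub>R gt))\<^sup>2"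
      unfolding e1 id unfolding W_def P_def by (rule indep)
    have "norm (u + y') = norm (z' - y)" unfolding u_def y_def
      by (metis add_diff_cancel_left' diff_add_eq diff_diff_eq2 norm_minus_commute)
    then have 2: "(norm (z2 *\<^sub>R gs - z1 *\<^sub>R gt))\<^sup>2 = q * (q * (norm (z' - y))\<^sup>2)"
      unfolding e2 using qp by (simp add: power_mult_distrib power2_eq_square)
    have "q * (c0 * (w1\<^sup>2 + w2\<^sup>2) + q * (norm (z' - y))\<^sup>2) \<le> q * ((norm gs)\<^sup>2 + (norm gt)\<^sup>2)"
      unfolding split 2 using 1 by (simp add: algebra_simps)
    then show ?thesis unfolding g om q[symmetric] using qp by simp
  qed
  then show ?thesis by blast
qed

section \<open>The double sum over frequencies and the bound for one annulus\<close>

text \<open>Each \<open>\<zeta>\<close> has only \<open>O(b^2)\<close> neighbours within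
  \<open>2 * b\<close>, and these are counted with the trivial bound 1. At larger distances the
  quotient \<open>w^2 / (4 * b^2 + w^2)\<close> is at least 1/2, so every term is at most
  \<open>exp (- b * c0 / 2)\<close> and the crude count of \<open>Z\<close> suffices.\<close>

lemma frequency_double_sum:
  fixes Z :: "complex set"
  assumes Z: "finite Z" "\<And>\<zeta>. \<zeta> \<in> Z \<Longrightarrow> norm \<zeta> \<le> 2 * r"
    and cnt: "\<And>\<eta> \<rho>. \<rho> \<ge> 1 \<Longrightarrow> real (card {\<zeta> \<in> Z. norm (\<zeta> - \<eta>) \<le> \<rho>}) \<le> CZ * \<rho>\<^sup>2"
    and c0: "c0 > 0" and b: "b \<ge> 1" and r: "r \<ge> 1"
  shows "(\<Sum>\<zeta>\<in>Z. \<Sum>\<zeta>'\<in>Z. exp (- b * (c0 * (norm (\<zeta> - \<zeta>'))\<^sup>2) / (4 * b\<^sup>2 + (norm (\<zeta> - \<zeta>'))\<^sup>2))) \<le>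
    16 * CZ\<^sup>2 * r\<^sup>2 * (b\<^sup>2 + r\<^sup>2 * exp (- b * c0 / 2))"
proof -
  let ?e = "\<lambda>\<zeta> \<zeta>'. exp (- b * (c0 * (norm (\<zeta> - \<zeta>'))\<^sup>2) / (4 * b\<^sup>2 + (norm (\<zeta> - \<zeta>'))\<^sup>2))"
  have "real (card {\<zeta> \<in> Z. norm (\<zeta> - 0) \<le> 1}) \<le> CZ * 1\<^sup>2" by (rule cnt) simp
  then have CZ: "CZ \<ge> 0" by (simp add: order_trans[OF of_nat_0_le_iff])
  have "{\<zeta> \<in> Z. norm (\<zeta> - 0) \<le> 2 * r} = Z" using Z(2) by auto
  then have cardZ: "real (card Z) \<le> 4 * CZ * r\<^sup>2"
    using cnt[of "2 * r" 0] r by (simp add: power_mult_distrib)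
  have row: "(\<Sum>\<zeta>'\<in>Z. ?e \<zeta> \<zeta>') \<le> 4 * CZ * (b\<^sup>2 + r\<^sup>2 * exp (- b * c0 / 2))" for \<zeta>
  proof -
    let ?N = "{\<zeta>' \<in> Z. norm (\<zeta>' - \<zeta>) \<le> 2 * b}"
    have pt: "?e \<zeta> \<zeta>' \<le> (if norm (\<zeta>' - \<zeta>) \<le> 2 * b then 1 else 0) + exp (- b * c0 / 2)" for \<zeta>'
    proof (cases "norm (\<zeta>' - \<zeta>) \<le> 2 * b")
      case True
      have "?e \<zeta> \<zeta>' \<le> 1" using b c0 by (simp add: divide_nonpos_nonneg)
      then show ?thesis using True by (simp add: add_increasing2)
    next
      case False
      define w where "w = norm (\<zeta> - \<zeta>')"
      have w: "w \<ge> 2 * b" using False by (simp add: w_def norm_minus_commute)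
      have "w\<^sup>2 \<ge> (2 * b)\<^sup>2" using w b by (intro power_mono) auto
      then have w2: "4 * b\<^sup>2 \<le> w\<^sup>2" by simp
      have den: "4 * b\<^sup>2 + w\<^sup>2 > 0" using b by (simp add: add_pos_nonneg)
      have "1 / 2 \<le> w\<^sup>2 / (4 * b\<^sup>2 + w\<^sup>2)" using w2 den by (simp add: field_simps)
      then have "(b * c0) * (1 / 2) \<le> (b * c0) * (w\<^sup>2 / (4 * b\<^sup>2 + w\<^sup>2))" using b c0 by (intro mult_left_mono) auto
      then have "?e \<zeta> \<zeta>' \<le> exp (- b * c0 / 2)" unfolding w_def[symmetric] by simp
      then show ?thesis using False by simp
    qed
    have "(\<Sum>\<zeta>'\<in>Z. ?e \<zeta> \<zeta>') \<le> (\<Sum>\<zeta>'\<in>Z. (if norm (\<zeta>' - \<zeta>) \<le> 2 * b then 1 else 0) + exp (- b * c0 / 2))"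
      by (intro sum_mono pt)
    also have "\<dots> = real (card ?N) + real (card Z) * exp (- b * c0 / 2)"
      using Z(1) by (simp add: sum.distrib sum.If_cases Int_def Collect_conj_eq[symmetric])
    also have "\<dots> \<le> CZ * (2 * b)\<^sup>2 + 4 * CZ * r\<^sup>2 * exp (- b * c0 / 2)"
      using b by (intro add_mono cnt mult_right_mono cardZ) auto
    finally show ?thesis by (simp add: algebra_simps power_mult_distrib)
  qed
  have "(\<Sum>\<zeta>\<in>Z. \<Sum>\<zeta>'\<in>Z. ?e \<zeta> \<zeta>') \<le> (\<Sum>\<zeta>\<in>Z. 4 * CZ * (b\<^sup>2 + r\<^sup>2 * exp (- b * c0 / 2)))"
    by (intro sum_mono row)
  also have "\<dots> = real (card Z) * (4 * CZ * (b\<^sup>2 + r\<^sup>2 * exp (- b * c0 / 2)))" by simp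
  also have "\<dots> \<le> 4 * CZ * r\<^sup>2 * (4 * CZ * (b\<^sup>2 + r\<^sup>2 * exp (- b * c0 / 2)))"
    using CZ by (intro mult_right_mono cardZ) auto
  also have "\<dots> = 16 * CZ\<^sup>2 * r\<^sup>2 * (b\<^sup>2 + r\<^sup>2 * exp (- b * c0 / 2))" by (simp add: power2_eq_square)
  finally show ?thesis .
qed

text \<open>Half of the rate \<open>r^2\<close> is kept for the Frostman bound. The other half is at
  least \<open>4 * b\<close> and is traded for a Gaussian about \<open>X0\<close> by means of
  \<open>|Y - X0|^2 <= 2 * |Y - X i|^2 + 2 * \<rho>^2\<close>; the price is
  \<open>exp (4 * b * \<rho>^2)\<close>.\<close>

lemma gaussian_majorant:
  fixes X :: "'i \<Rightarrow> 'a::real_normed_vector"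
  assumes I: "finite I" "\<And>i. i \<in> I \<Longrightarrow> A i \<ge> 0"
    and fro: "\<And>Y \<Lambda>. 0 < \<Lambda> \<Longrightarrow> \<Lambda> \<le> L \<Longrightarrow> (\<Sum>i\<in>I. A i * exp (- \<Lambda> * (norm (Y - X i))\<^sup>2)) \<le> C * \<Lambda> powr - s"
    and near: "\<And>i. i \<in> I \<Longrightarrow> norm (X i - X0) \<le> \<rho>"
    and r: "r > 0" "r\<^sup>2 \<le> L" and b: "0 \<le> b" "8 * b \<le> r\<^sup>2"
  shows "(\<Sum>i\<in>I. A i * exp (- r\<^sup>2 * (norm (Y - X i))\<^sup>2)) \<le>
    C * (r\<^sup>2 / 2) powr - s * exp (4 * b * \<rho>\<^sup>2) * exp (- 2 * b * (norm (Y - X0))\<^sup>2)"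
proof -
  have "(\<Sum>i\<in>I. A i * exp (- r\<^sup>2 * (norm (Y - X i))\<^sup>2)) \<le>
    (\<Sum>i\<in>I. A i * exp (- (r\<^sup>2 / 2) * (norm (Y - X i))\<^sup>2) * (exp (4 * b * \<rho>\<^sup>2) * exp (- 2 * b * (norm (Y - X0))\<^sup>2)))"
  proof (intro sum_mono)
    fix i assume i: "i \<in> I"
    define p where "p = (norm (Y - X i))\<^sup>2"
    have "norm (Y - X0) \<le> norm (Y - X i) + norm (X i - X0)" using norm_triangle_ineq[of "Y - X i" "X i - X0"] by simp
    also have "\<dots> \<le> norm (Y - X i) + \<rho>" using near[OF i] by simp
    finally have "(norm (Y - X0))\<^sup>2 \<le> (norm (Y - X i) + \<rho>)\<^sup>2" by (intro power_mono) auto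
    also have "\<dots> \<le> 2 * p + 2 * \<rho>\<^sup>2"
      using sum_squares_bound[of "norm (Y - X i)" \<rho>] by (simp add: power2_sum p_def)
    finally have "2 * b * (norm (Y - X0))\<^sup>2 \<le> 2 * b * (2 * p + 2 * \<rho>\<^sup>2)" using b by (intro mult_left_mono) auto
    moreover have "8 * b * p \<le> r\<^sup>2 * p" using b by (intro mult_right_mono) (auto simp: p_def)
    ultimately have "- r\<^sup>2 * p \<le> - (r\<^sup>2 / 2) * p + (4 * b * \<rho>\<^sup>2 + (- 2 * b * (norm (Y - X0))\<^sup>2))"
      by (simp add: algebra_simps)
    then have "exp (- r\<^sup>2 * p) \<le> exp (- (r\<^sup>2 / 2) * p) * (exp (4 * b * \<rho>\<^sup>2) * exp (- 2 * b * (norm (Y - X0))\<^sup>2))"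
      unfolding exp_add[symmetric] by simp
    then show "A i * exp (- r\<^sup>2 * (norm (Y - X i))\<^sup>2) \<le> A i * exp (- (r\<^sup>2 / 2) * (norm (Y - X i))\<^sup>2) *
       (exp (4 * b * \<rho>\<^sup>2) * exp (- 2 * b * (norm (Y - X0))\<^sup>2))"
      unfolding p_def using I(2)[OF i] by (simp only: mult.assoc mult_left_mono)
  qed
  also have "\<dots> = (\<Sum>i\<in>I. A i * exp (- (r\<^sup>2 / 2) * (norm (Y - X i))\<^sup>2)) * (exp (4 * b * \<rho>\<^sup>2) * exp (- 2 * b * (norm (Y - X0))\<^sup>2))"
    by (simp only: sum_distrib_right)
  also have "\<dots> \<le> C * (r\<^sup>2 / 2) powr - s * (exp (4 * b * \<rho>\<^sup>2) * exp (- 2 * b * (norm (Y - X0))\<^sup>2))"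
  proof (intro mult_right_mono fro)
    show "r\<^sup>2 / 2 \<le> L" using r(2) zero_le_power2[of r] by linarith
  qed (use r in auto)
  finally show ?thesis by (simp only: mult.assoc)
qed

lemma sqrt_power_DIM_prod:
  assumes "q \<ge> 0"
  shows "sqrt q ^ DIM('a::euclidean_space \<times> 'a) = q ^ DIM('a)"
  using assms by (simp add: power_add power_mult_distrib[symmetric])

lemma powr_square:
  fixes r t :: real
  assumes "r > 0"
  shows "(r\<^sup>2) powr t = r powr (2 * t)"
proof -
  have "r\<^sup>2 = r powr 2" using assms by simp
  then show ?thesis by (simp only: powr_powr)
qed

text \<open>For fixed \<open>(\<zeta>, k)\<close> and \<open>\<zeta>'\<close>,
  \<open>tri_gradient_lower\<close> leaves a Gaussian in \<open>z k'\<close> about a point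
  \<open>y\<close>, of rate \<open>\<Lambda> = b * |\<zeta>'|^2 / Q\<close> with
  \<open>Q = 4 * b^2 + |\<zeta> - \<zeta>'|^2\<close>. The Frostman bound turns the sum over
  \<open>k'\<close> into at most \<open>r powr - s * Q powr (s / 2)\<close>, and the determinant
  factor \<open>Q powr (- d / 2)\<close> of the Gaussian integral absorbs the power of
  \<open>Q\<close> because \<open>s <= d\<close>. The sum over frequencies remains.\<close>

lemma exponential_pair_sum_bound:
  fixes Z :: "complex set" and X0 :: "'a::euclidean_space \<times> 'a"
  assumes Z: "finite Z" "\<And>\<zeta>. \<zeta> \<in> Z \<Longrightarrow> r \<le> norm \<zeta> \<and> norm \<zeta> \<le> 2 * r"
    and cnt: "\<And>\<eta> \<rho>. \<rho> \<ge> 1 \<Longrightarrow> real (card {\<zeta> \<in> Z. norm (\<zeta> - \<eta>) \<le> \<rho>}) \<le> CZ * \<rho>\<^sup>2"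
    and \<kappa>: "\<And>\<zeta>. \<zeta> \<in> Z \<Longrightarrow> norm (\<kappa> \<zeta> :: complex) \<le> 1"
    and K: "finite K" "\<And>k. k \<in> K \<Longrightarrow> c k \<ge> (0::real)" "sum c K \<le> 1"
    and fro: "\<And>y \<Lambda>. 0 < \<Lambda> \<Longrightarrow> \<Lambda> \<le> L \<Longrightarrow> (\<Sum>k\<in>K. c k * exp (- \<Lambda> * (norm (z k - y))\<^sup>2)) \<le> CF * \<Lambda> powr (- s / 2)"
    and indep: "\<And>k a b. k \<in> K \<Longrightarrow> c0 * (a\<^sup>2 + b\<^sup>2) \<le> (norm (a *\<^sub>R fst X0 + b *\<^sub>R (z k - snd X0)))\<^sup>2"
    and s: "0 \<le> s" "s \<le> DIM('a)" and c0: "c0 > 0" and b: "b \<ge> 1" and r: "r \<ge> 1" "r\<^sup>2 \<le> L"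
  shows "(\<Sum>j\<in>Z \<times> K. \<Sum>j'\<in>Z \<times> K. norm (\<kappa> (fst j) * of_real (c (snd j))) * norm (\<kappa> (fst j') * of_real (c (snd j'))) *
      (sqrt (pi / sqrt (4 * b\<^sup>2 + (norm (fst j - fst j'))\<^sup>2)) ^ DIM('a \<times> 'a) *
         exp (- b * (norm (tri_op (fst j) X0 - tri_op (fst j') X0 + tri_vec (fst j) (z (snd j)) - tri_vec (fst j') (z (snd j'))))\<^sup>2 /
           (4 * b\<^sup>2 + (norm (fst j - fst j'))\<^sup>2)))) \<le>
    pi ^ DIM('a) * CF * r powr - s * (16 * CZ\<^sup>2 * r\<^sup>2 * (b\<^sup>2 + r\<^sup>2 * exp (- b * c0 / 2)))"
    (is "(\<Sum>j\<in>Z \<times> K. \<Sum>j'\<in>Z \<times> K. ?t j j') \<le> _")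
proof -
  let ?d = "DIM('a)"
  let ?e = "\<lambda>\<zeta> \<zeta>'. exp (- b * (c0 * (norm (\<zeta> - \<zeta>'))\<^sup>2) / (4 * b\<^sup>2 + (norm (\<zeta> - \<zeta>'))\<^sup>2))"
  have L1: "1 \<le> L" using r(2) one_le_power[OF r(1), of 2] by linarith
  have CF: "CF \<ge> 0"
    using fro[of 1 0] L1 sum_nonneg[of K "\<lambda>k. c k * exp (- 1 * (norm (z k - 0))\<^sup>2)"] K(2) by simp
  have row: "(\<Sum>k'\<in>K. ?t (\<zeta>, k) (\<zeta>', k')) \<le> c k * (pi ^ ?d * CF * r powr - s * ?e \<zeta> \<zeta>')"
    if \<zeta>: "\<zeta> \<in> Z" "\<zeta>' \<in> Z" and k: "k \<in> K" for \<zeta> \<zeta>' k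
  proof -
    define Q where "Q = 4 * b\<^sup>2 + (norm (\<zeta> - \<zeta>'))\<^sup>2"
    have b2: "b\<^sup>2 \<ge> 1" using b by (simp add: one_le_power)
    then have Q: "Q \<ge> 1" "Q > 0" unfolding Q_def by (smt (verit) zero_le_power2)+
    have rz: "r \<le> norm \<zeta>'" "norm \<zeta>' \<le> 2 * r" using Z(2)[OF \<zeta>(2)] by auto
    then have "\<zeta>' \<noteq> 0" using r by auto
    from tri_gradient_lower[OF indep[OF k] this, of \<zeta>] obtain y where
      y: "\<And>z'. c0 * (norm (\<zeta> - \<zeta>'))\<^sup>2 + (norm \<zeta>')\<^sup>2 * (norm (z' - y))\<^sup>2 \<le>
        (norm (tri_op \<zeta> X0 - tri_op \<zeta>' X0 + tri_vec \<zeta> (z k) - tri_vec \<zeta>' z'))\<^sup>2" by blast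
    define \<Lambda> where "\<Lambda> = b * (norm \<zeta>')\<^sup>2 / Q"
    have \<Lambda>0: "\<Lambda> > 0" unfolding \<Lambda>_def using b Q \<open>\<zeta>' \<noteq> 0\<close> by simp
    have "\<Lambda> \<le> b * (2 * r)\<^sup>2 / (4 * b\<^sup>2)"
      unfolding \<Lambda>_def Q_def using b rz r by (intro frac_le mult_left_mono power_mono) auto
    also have "\<dots> = r\<^sup>2 / b" using b by (simp add: field_simps power2_eq_square)
    also have "\<dots> \<le> r\<^sup>2" using b by (simp add: divide_le_eq mult_le_cancel_left1)
    finally have \<Lambda>L: "\<Lambda> \<le> L" using r(2) by simp
    have pi_pow: "sqrt (pi / sqrt Q) ^ DIM('a \<times> 'a) = pi ^ ?d * Q powr (- real ?d / 2)"
    proof -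
      have "sqrt (pi / sqrt Q) ^ DIM('a \<times> 'a) = (pi / sqrt Q) ^ ?d"
        using Q by (intro sqrt_power_DIM_prod) simp
      also have "\<dots> = pi ^ ?d * Q powr (- real ?d / 2)"
        using Q by (simp add: power_divide powr_minus_divide powr_half_sqrt[symmetric] powr_realpow[symmetric] powr_powr)
      finally show ?thesis .
    qed
    have entry: "?t (\<zeta>, k) (\<zeta>', k') \<le> c k * (pi ^ ?d * Q powr (- real ?d / 2) * ?e \<zeta> \<zeta>' * (c k' * exp (- \<Lambda> * (norm (z k' - y))\<^sup>2)))"
      if k': "k' \<in> K" for k'
    proof -
      let ?g = "(norm (tri_op \<zeta> X0 - tri_op \<zeta>' X0 + tri_vec \<zeta> (z k) - tri_vec \<zeta>' (z k')))\<^sup>2"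
      have "- b * ?g / Q \<le> - b * (c0 * (norm (\<zeta> - \<zeta>'))\<^sup>2 + (norm \<zeta>')\<^sup>2 * (norm (z k' - y))\<^sup>2) / Q"
        using y[of "z k'"] b Q by (intro divide_right_mono) auto
      also have "\<dots> = - b * (c0 * (norm (\<zeta> - \<zeta>'))\<^sup>2) / Q + - \<Lambda> * (norm (z k' - y))\<^sup>2"
        using Q by (simp add: \<Lambda>_def field_simps)
      finally have e: "exp (- b * ?g / Q) \<le> ?e \<zeta> \<zeta>' * exp (- \<Lambda> * (norm (z k' - y))\<^sup>2)"
        unfolding exp_add[symmetric] Q_def by simp
      have n: "norm (\<kappa> \<zeta> * of_real (c k)) \<le> c k" if "\<zeta> \<in> Z" "k \<in> K" for \<zeta> k
        using mult_right_mono[OF \<kappa>[OF that(1)] K(2)[OF that(2)]] K(2)[OF that(2)] by (simp add: norm_mult)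
      have "?t (\<zeta>, k) (\<zeta>', k') \<le> (c k * c k') *
          (sqrt (pi / sqrt Q) ^ DIM('a \<times> 'a) * (?e \<zeta> \<zeta>' * exp (- \<Lambda> * (norm (z k' - y))\<^sup>2)))"
        unfolding fst_conv snd_conv Q_def[symmetric] using K(2) k k' Q e n[OF \<zeta>(1) k] n[OF \<zeta>(2) k']
        by (intro mult_mono mult_nonneg_nonneg) (auto simp: Q_def)
      then show ?thesis unfolding pi_pow by (simp only: mult_ac)
    qed
    have "(\<Sum>k'\<in>K. ?t (\<zeta>, k) (\<zeta>', k')) \<le> (\<Sum>k'\<in>K. c k * (pi ^ ?d * Q powr (- real ?d / 2) * ?e \<zeta> \<zeta>' * (c k' * exp (- \<Lambda> * (norm (z k' - y))\<^sup>2))))"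
      by (intro sum_mono entry)
    also have "\<dots> = c k * (pi ^ ?d * Q powr (- real ?d / 2) * ?e \<zeta> \<zeta>' * (\<Sum>k'\<in>K. c k' * exp (- \<Lambda> * (norm (z k' - y))\<^sup>2)))"
      by (simp only: sum_distrib_left)
    also have "\<dots> \<le> c k * (pi ^ ?d * Q powr (- real ?d / 2) * ?e \<zeta> \<zeta>' * (CF * \<Lambda> powr (- s / 2)))"
      using K(2) k \<Lambda>0 \<Lambda>L by (intro mult_left_mono fro) auto
    also have "\<dots> = c k * (pi ^ ?d * CF * (Q powr (- real ?d / 2) * \<Lambda> powr (- s / 2)) * ?e \<zeta> \<zeta>')"
      by (simp only: mult_ac)
    also have "\<dots> \<le> c k * (pi ^ ?d * CF * r powr - s * ?e \<zeta> \<zeta>')"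
    proof (intro mult_left_mono mult_right_mono)
      have "r\<^sup>2 / Q \<le> \<Lambda>"
      proof -
        have "r\<^sup>2 \<le> (norm \<zeta>')\<^sup>2" using rz r by (intro power_mono) auto
        also have "\<dots> \<le> b * (norm \<zeta>')\<^sup>2" using b by (simp add: mult_le_cancel_right1)
        finally show ?thesis unfolding \<Lambda>_def using Q by (intro divide_right_mono) auto
      qed
      then have "\<Lambda> powr (- s / 2) \<le> (r\<^sup>2 / Q) powr (- s / 2)"
        using s r Q by (intro powr_mono2') auto
      also have "\<dots> = r powr - s * Q powr (s / 2)"
        using r Q by (simp add: powr_divide powr_square powr_minus_divide)
      finally have "Q powr (- real ?d / 2) * \<Lambda> powr (- s / 2) \<le> Q powr (- real ?d / 2) * (r powr - s * Q powr (s / 2))"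
        by (intro mult_left_mono) auto
      also have "\<dots> = r powr - s * Q powr (- real ?d / 2 + s / 2)" by (simp only: powr_add mult_ac)
      also have "\<dots> \<le> r powr - s * Q powr 0" using s Q by (intro mult_left_mono powr_mono) auto
      finally show "Q powr (- real ?d / 2) * \<Lambda> powr (- s / 2) \<le> r powr - s" using Q by simp
    qed (use CF K(2) k in auto)
    finally show ?thesis .
  qed
  have "(\<Sum>j\<in>Z \<times> K. \<Sum>j'\<in>Z \<times> K. ?t j j') = (\<Sum>\<zeta>\<in>Z. \<Sum>k\<in>K. \<Sum>\<zeta>'\<in>Z. \<Sum>k'\<in>K. ?t (\<zeta>, k) (\<zeta>', k'))"
    unfolding sum.cartesian_product' ..
  also have "\<dots> \<le> (\<Sum>\<zeta>\<in>Z. \<Sum>k\<in>K. \<Sum>\<zeta>'\<in>Z. c k * (pi ^ ?d * CF * r powr - s * ?e \<zeta> \<zeta>'))"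
    by (intro sum_mono row)
  also have "\<dots> = sum c K * (pi ^ ?d * CF * r powr - s * (\<Sum>\<zeta>\<in>Z. \<Sum>\<zeta>'\<in>Z. ?e \<zeta> \<zeta>'))"
    unfolding sum_distrib_left[symmetric] sum_distrib_right[symmetric] by simp
  also have "\<dots> \<le> 1 * (pi ^ ?d * CF * r powr - s * (16 * CZ\<^sup>2 * r\<^sup>2 * (b\<^sup>2 + r\<^sup>2 * exp (- b * c0 / 2))))"
    using K CF Z cnt c0 b r
    by (intro mult_mono mult_left_mono frequency_double_sum mult_nonneg_nonneg sum_nonneg) auto
  finally show ?thesis by simp
qed

text \<open>The large sieve bound on the space of pairs is combined with the sum over
  \<open>Z \<times> K\<close>. As the frequencies lie in one annulus, the same smoothing rate
  \<open>r^2\<close> and the same lower bound \<open>|\<zeta>'| >= r\<close> serve all of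
  them.\<close>

lemma annulus_bound:
  fixes Z :: "complex set" and X0 :: "'a::euclidean_space \<times> 'a" and X :: "'i \<Rightarrow> 'a \<times> 'a"
  assumes Z: "finite Z" "\<And>\<zeta>. \<zeta> \<in> Z \<Longrightarrow> r \<le> norm \<zeta> \<and> norm \<zeta> \<le> 2 * r"
    and cnt: "\<And>\<eta> \<rho>. \<rho> \<ge> 1 \<Longrightarrow> real (card {\<zeta> \<in> Z. norm (\<zeta> - \<eta>) \<le> \<rho>}) \<le> CZ * \<rho>\<^sup>2"
    and \<kappa>: "\<And>\<zeta>. \<zeta> \<in> Z \<Longrightarrow> norm (\<kappa> \<zeta> :: complex) \<le> 1"
    and I: "finite I" "\<And>i. i \<in> I \<Longrightarrow> A i \<ge> 0" "sum A I \<le> 1"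
    and froI: "\<And>Y \<Lambda>. 0 < \<Lambda> \<Longrightarrow> \<Lambda> \<le> L \<Longrightarrow> (\<Sum>i\<in>I. A i * exp (- \<Lambda> * (norm (Y - X i))\<^sup>2)) \<le> CI * \<Lambda> powr - s"
    and near: "\<And>i. i \<in> I \<Longrightarrow> norm (X i - X0) \<le> \<rho>"
    and K: "finite K" "\<And>k. k \<in> K \<Longrightarrow> c k \<ge> (0::real)" "sum c K \<le> 1"
    and fro: "\<And>y \<Lambda>. 0 < \<Lambda> \<Longrightarrow> \<Lambda> \<le> L \<Longrightarrow> (\<Sum>k\<in>K. c k * exp (- \<Lambda> * (norm (z k - y))\<^sup>2)) \<le> CF * \<Lambda> powr (- s / 2)"
    and indep: "\<And>k a b. k \<in> K \<Longrightarrow> c0 * (a\<^sup>2 + b\<^sup>2) \<le> (norm (a *\<^sub>R fst X0 + b *\<^sub>R (z k - snd X0)))\<^sup>2"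
    and H: "\<And>k. k \<in> K \<Longrightarrow> norm X0 + norm (z k) \<le> H"
    and s: "0 \<le> s" "s \<le> DIM('a)" and c0: "c0 > 0"
    and B0: "B0 = 64 + 4 / c0" and \<eta>: "\<eta> = 3 * s - 2 * real DIM('a) - 2" "\<eta> > 0"
    and \<rho>: "16 * B0 * \<rho>\<^sup>2 \<le> \<eta>" and r: "r \<ge> 8 * B0" "r\<^sup>2 \<le> L"
  shows "(norm (\<Sum>i\<in>I. of_real (A i) * (\<Sum>\<zeta>\<in>Z. \<kappa> \<zeta> * (\<Sum>k\<in>K. of_real (c k) * cis (tri_phase \<zeta> (z k) (X i))))))\<^sup>2 \<le>
    (2 ^ DIM('a) * exp (64 * H\<^sup>2) * CI * 2 powr s * exp (\<eta> / 4) * CF * 32 * CZ\<^sup>2 * B0\<^sup>2 * (1 + 8 / \<eta>)\<^sup>2) * r powr (- \<eta> / 2)"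
proof -
  let ?d = "DIM('a)"
  have B0g: "B0 \<ge> 64" "B0 * c0 \<ge> 4" using c0 by (simp_all add: B0 field_simps)
  have r1: "r \<ge> 1" using B0g r by linarith
  have L1: "1 \<le> L" using r(2) one_le_power[OF r1, of 2] by linarith
  have lnr: "ln r \<ge> 0" using r1 by simp
  \<comment> \<open>\<open>B0 * c0 >= 4\<close> gives \<open>exp (- b * c0 / 2) <= r^(-2)\<close>,
    so far pairs of frequencies together cost no more than near ones. \<open>B0 >= 64\<close>
    ensures \<open>b >= 64\<close>.\<close>
  define b where "b = B0 * (1 + ln r)"
  have bB: "b \<ge> B0" unfolding b_def using B0g lnr by (simp add: algebra_simps)
  then have b: "b \<ge> 64" "b \<ge> 1" using B0g by linarith+
  have "1 + ln r \<le> r" using ln_le_minus_one[of r] r1 by linarith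
  then have "8 * b \<le> 8 * B0 * r" unfolding b_def using B0g by simp
  also have "\<dots> \<le> r * r" using r r1 by (intro mult_right_mono) auto
  finally have br: "8 * b \<le> r\<^sup>2" by (simp add: power2_eq_square)
  have CF: "CF \<ge> 0"
    using fro[of 1 0] L1 sum_nonneg[of K "\<lambda>k. c k * exp (- 1 * (norm (z k - 0))\<^sup>2)"] K(2) by simp
  have CI: "CI \<ge> 0"
    using froI[of 1 0] L1 sum_nonneg[of I "\<lambda>i. A i * exp (- 1 * (norm (0 - X i))\<^sup>2)"] I(2) by simp
  let ?D = "CI * (r\<^sup>2 / 2) powr - s * exp (4 * b * \<rho>\<^sup>2)"
  let ?T = "pi ^ ?d * CF * r powr - s * (16 * CZ\<^sup>2 * r\<^sup>2 * (b\<^sup>2 + r\<^sup>2 * exp (- b * c0 / 2)))"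
  have D0: "?D \<ge> 0" using CI by simp
  have pairing: "(\<Sum>\<zeta>\<in>Z. \<kappa> \<zeta> * (\<Sum>k\<in>K. of_real (c k) * cis (tri_phase \<zeta> (z k) (X i)))) =
     (\<Sum>j\<in>Z \<times> K. (\<kappa> (fst j) * of_real (c (snd j))) *
       qwave (tri_op (fst j)) (tri_vec (fst j) (z (snd j))) (Re (fst j) * (norm (z (snd j)))\<^sup>2) (X i) 0)" for i
    unfolding cis_tri_phase sum.cartesian_product' by (simp add: sum_distrib_left mult.assoc)
  have "(norm (\<Sum>i\<in>I. of_real (A i) * (\<Sum>\<zeta>\<in>Z. \<kappa> \<zeta> * (\<Sum>k\<in>K. of_real (c k) * cis (tri_phase \<zeta> (z k) (X i))))))\<^sup>2 \<le>
    sqrt (2 * r\<^sup>2 / pi) ^ DIM('a \<times> 'a) * exp (64 * H\<^sup>2) * ?D *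
    (\<Sum>j\<in>Z \<times> K. \<Sum>j'\<in>Z \<times> K. norm (\<kappa> (fst j) * of_real (c (snd j))) * norm (\<kappa> (fst j') * of_real (c (snd j'))) *
      (sqrt (pi / sqrt (4 * b\<^sup>2 + (norm (fst j - fst j'))\<^sup>2)) ^ DIM('a \<times> 'a) *
         exp (- b * (norm (tri_op (fst j) X0 - tri_op (fst j') X0 + tri_vec (fst j) (z (snd j)) - tri_vec (fst j') (z (snd j'))))\<^sup>2 /
           (4 * b\<^sup>2 + (norm (fst j - fst j'))\<^sup>2))))"
    unfolding pairing
  proof (rule quadratic_exponential_sum_bound[where ?X0.0 = X0])
    show "finite (Z \<times> K)" using Z K by simp
    show "norm (tri_op (fst j) x) \<le> 2 * r * norm x" if "j \<in> Z \<times> K" for j x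
      using that Z(2)[of "fst j"] unfolding norm_tri_op by (intro mult_right_mono) auto
    show "norm (tri_op (fst j) X0 + tri_vec (fst j) (z (snd j))) \<le> 2 * r * H" if "j \<in> Z \<times> K" for j
    proof -
      have j: "fst j \<in> Z" "snd j \<in> K" using that by auto
      have "norm (tri_op (fst j) X0 + tri_vec (fst j) (z (snd j))) \<le> norm (fst j) * (norm X0 + norm (z (snd j)))"
        using norm_triangle_ineq[of "tri_op (fst j) X0" "tri_vec (fst j) (z (snd j))"]
        by (simp add: norm_tri_op norm_tri_vec distrib_left)
      also have "\<dots> \<le> 2 * r * H" using Z(2)[OF j(1)] H[OF j(2)] r1 by (intro mult_mono) auto
      finally show ?thesis .
    qed
    show "norm (tri_op (fst j) x - tri_op (fst j') x) = norm (fst j - fst j') * norm x" for j j' :: "complex \<times> 'b" and x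
      by (simp add: tri_op_diff norm_tri_op)
    show "(\<Sum>i\<in>I. A i * exp (- r\<^sup>2 * (norm (Y - X i))\<^sup>2)) \<le> ?D * exp (- 2 * b * (norm (Y - X0))\<^sup>2)" for Y
      using r1 b br by (intro gaussian_majorant[OF I(1,2) froI near _ r(2)]) auto
  qed (use I b r1 D0 linear_tri_op tri_op_self_adjoint in auto)
  also have "\<dots> \<le> sqrt (2 * r\<^sup>2 / pi) ^ DIM('a \<times> 'a) * exp (64 * H\<^sup>2) * ?D * ?T"
    using D0 by (intro mult_left_mono exponential_pair_sum_bound[OF Z cnt \<kappa> K fro indep s c0 b(2) r1 r(2)]) auto
  also have "sqrt (2 * r\<^sup>2 / pi) ^ DIM('a \<times> 'a) = (2 * r\<^sup>2 / pi) ^ ?d"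
    by (rule sqrt_power_DIM_prod) simp
  also have "(2 * r\<^sup>2 / pi) ^ ?d * exp (64 * H\<^sup>2) * ?D * ?T =
     (2 ^ ?d * exp (64 * H\<^sup>2) * CI * 2 powr s * CF * 16 * CZ\<^sup>2) *
       (r powr (- \<eta>) * (exp (4 * b * \<rho>\<^sup>2) * (b\<^sup>2 + r\<^sup>2 * exp (- b * c0 / 2))))"
  proof -
    have "(2 * r\<^sup>2 / pi) ^ ?d * pi ^ ?d = 2 ^ ?d * (r\<^sup>2) ^ ?d"
      by (simp add: power_divide power_mult_distrib)
    moreover have "(r\<^sup>2) ^ ?d * ((r\<^sup>2 / 2) powr - s * r powr - s * r\<^sup>2) = 2 powr s * r powr (- \<eta>)"
    proof -
      have "(r\<^sup>2) ^ ?d = (r\<^sup>2) powr real ?d" using r1 by (simp add: powr_realpow)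
      then have a: "(r\<^sup>2) ^ ?d = r powr (2 * real ?d)" using r1 by (simp only: powr_square)
      have "(r\<^sup>2 / 2) powr - s = 2 powr s * r powr (- (2 * s))"
        using r1 by (simp add: powr_divide powr_square powr_minus_divide)
      moreover have "r\<^sup>2 = r powr 2" using r1 by simp
      ultimately show ?thesis unfolding a \<eta>(1) by (simp add: powr_add[symmetric] algebra_simps)
    qed
    ultimately have "((2 * r\<^sup>2 / pi) ^ ?d * pi ^ ?d) * ((r\<^sup>2 / 2) powr - s * r powr - s * r\<^sup>2) = 2 ^ ?d * (2 powr s * r powr (- \<eta>))"
      by (simp only: mult.assoc)
    moreover have "(2 * r\<^sup>2 / pi) ^ ?d * exp (64 * H\<^sup>2) * ?D * ?T =
      (((2 * r\<^sup>2 / pi) ^ ?d * pi ^ ?d) * ((r\<^sup>2 / 2) powr - s * r powr - s * r\<^sup>2)) *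
        (exp (64 * H\<^sup>2) * CI * CF * 16 * CZ\<^sup>2 * (exp (4 * b * \<rho>\<^sup>2) * (b\<^sup>2 + r\<^sup>2 * exp (- b * c0 / 2))))"
      by (simp only: mult_ac)
    ultimately show ?thesis by (simp only: mult_ac)
  qed
  \<comment> \<open>Both effects of the logarithm in \<open>b\<close> are converted into powers:
    \<open>exp (4 * b * \<rho>^2)\<close> and \<open>b^2\<close> cost a factor
    \<open>r powr (\<eta> / 4)\<close> each, so half of the gain \<open>r powr (- \<eta>)\<close>
    survives.\<close>
  also have "\<dots> \<le> (2 ^ ?d * exp (64 * H\<^sup>2) * CI * 2 powr s * CF * 16 * CZ\<^sup>2) *
       (r powr (- \<eta>) * ((exp (\<eta> / 4) * r powr (\<eta> / 4)) * (2 * (B0\<^sup>2 * ((1 + 8 / \<eta>)\<^sup>2 * r powr (\<eta> / 4))))))"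
  proof (intro mult_left_mono mult_mono)
    have "4 * b * \<rho>\<^sup>2 = (16 * B0 * \<rho>\<^sup>2) * (1 + ln r) / 4" by (simp add: b_def)
    also have "\<dots> \<le> \<eta> * (1 + ln r) / 4" using \<rho> lnr by (intro divide_right_mono mult_right_mono) auto
    finally have "exp (4 * b * \<rho>\<^sup>2) \<le> exp (\<eta> / 4 + \<eta> / 4 * ln r)" by (simp add: algebra_simps add_divide_distrib)
    then show "exp (4 * b * \<rho>\<^sup>2) \<le> exp (\<eta> / 4) * r powr (\<eta> / 4)"
      using r1 by (simp add: exp_add powr_def)
    have "b * c0 / 2 \<ge> 2 * ln r"
    proof -
      have "4 * (1 + ln r) \<le> (B0 * c0) * (1 + ln r)" using B0g lnr by (intro mult_right_mono) auto
      then show ?thesis unfolding b_def by (simp add: algebra_simps)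
    qed
    then have "r\<^sup>2 * exp (- b * c0 / 2) \<le> r\<^sup>2 * exp (- (2 * ln r))" by (intro mult_left_mono) auto
    also have "\<dots> = 1" using r1 by (simp only: exp_minus exp_double exp_ln) simp
    also have "1 \<le> b\<^sup>2" using b by (simp add: one_le_power)
    finally have 1: "b\<^sup>2 + r\<^sup>2 * exp (- b * c0 / 2) \<le> 2 * b\<^sup>2" by simp
    have "ln r \<le> r powr (\<eta> / 8) / (\<eta> / 8)" using r1 \<eta> by (intro ln_powr_bound) auto
    moreover have "1 \<le> r powr (\<eta> / 8)" using r1 \<eta> by (intro ge_one_powr_ge_zero) auto
    ultimately have "1 + ln r \<le> (1 + 8 / \<eta>) * r powr (\<eta> / 8)" by (simp add: algebra_simps)
    then have "(1 + ln r)\<^sup>2 \<le> ((1 + 8 / \<eta>) * r powr (\<eta> / 8))\<^sup>2" using lnr by (intro power_mono) auto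
    also have "\<dots> = (1 + 8 / \<eta>)\<^sup>2 * r powr (\<eta> / 4)"
      by (simp add: power_mult_distrib power2_eq_square powr_add[symmetric])
    finally have "b\<^sup>2 \<le> B0\<^sup>2 * ((1 + 8 / \<eta>)\<^sup>2 * r powr (\<eta> / 4))"
      unfolding b_def power_mult_distrib by (intro mult_left_mono) auto
    then show "b\<^sup>2 + r\<^sup>2 * exp (- b * c0 / 2) \<le> 2 * (B0\<^sup>2 * ((1 + 8 / \<eta>)\<^sup>2 * r powr (\<eta> / 4)))" using 1 by linarith
  qed (use CF CI in auto)
  also have "\<dots> = (2 ^ ?d * exp (64 * H\<^sup>2) * CI * 2 powr s * exp (\<eta> / 4) * CF * 32 * CZ\<^sup>2 * B0\<^sup>2 * (1 + 8 / \<eta>)\<^sup>2) *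
     (r powr (- \<eta>) * (r powr (\<eta> / 4) * r powr (\<eta> / 4)))" by (simp add: mult_ac)
  also have "r powr (- \<eta>) * (r powr (\<eta> / 4) * r powr (\<eta> / 4)) = r powr (- \<eta> / 2)"
    by (simp add: powr_add[symmetric])
  finally show ?thesis .
qed

subsection \<open>Hausdorff content and Frostman weights\<close>

text \<open>The premeasure without a bound on the diameters of the covering sets. It is finite on
  bounded sets, and a null content already forces a null Hausdorff measure, so it can replace the
  measure wherever only positivity matters.\<close>

definition hausdorff_content :: "real \<Rightarrow> 'a::metric_space set \<Rightarrow> ennreal" where
  "hausdorff_content s E =
     (INF U \<in> {U :: nat \<Rightarrow> 'a set. E \<subseteq> (\<Union>i. U i) \<and> (\<forall>i. bounded (U i))}. (\<Sum>i. diam_gauge s (U i)))"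

lemma hausdorff_content_le:
  assumes "E \<subseteq> (\<Union>i. U i)" "\<And>i. bounded (U i)"
  shows "hausdorff_content s E \<le> (\<Sum>i. diam_gauge s (U i))"
  unfolding hausdorff_content_def using assms by (intro INF_lower) auto

lemma hausdorff_content_lessD:
  assumes "hausdorff_content s E < e"
  obtains U where "E \<subseteq> (\<Union>i. U i)" "\<And>i. bounded (U i)" "(\<Sum>i. diam_gauge s (U i)) < e"
  using assms unfolding hausdorff_content_def by (auto simp: INF_less_iff)

lemma hausdorff_content_mono: "A \<subseteq> B \<Longrightarrow> hausdorff_content s A \<le> hausdorff_content s B"
  unfolding hausdorff_content_def by (intro INF_superset_mono) auto

text \<open>A cover whose gauges sum to less than \<open>\<delta> powr s\<close> consists of sets of
  diameter at most \<open>\<delta>\<close>, so it is admissible for the premeasure at scale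
  \<open>\<delta>\<close>.\<close>

lemma hausdorff_measure_eq_0:
  assumes s: "s > 0" and null: "hausdorff_content s E = 0"
  shows "hausdorff_measure s E = 0"
proof -
  have "hausdorff_premeasure s \<delta> E \<le> 0" if \<delta>: "\<delta> > 0" for \<delta>
  proof (rule ennreal_le_epsilon)
    fix e :: real assume e: "e > 0"
    let ?e = "min e (\<delta> powr s)"
    have "hausdorff_content s E < ennreal ?e" using e \<delta> null by simp
    then obtain U where U: "E \<subseteq> (\<Union>i. U i)" "\<And>i. bounded (U i)" "(\<Sum>i. diam_gauge s (U i)) < ennreal ?e"
      using hausdorff_content_lessD by blast
    have "diameter (U i) \<le> \<delta>" for i
    proof (cases "U i = {}")
      case False
      have d: "diameter (U i) \<ge> 0" by (rule diameter_ge_0[OF U(2)])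
      have "diam_gauge s (U i) \<le> (\<Sum>i. diam_gauge s (U i))"
        using sum_le_suminf[of "\<lambda>i. diam_gauge s (U i)" "{i}"] by simp
      also have "\<dots> < ennreal (\<delta> powr s)" using U(3) by (auto intro: order.strict_trans2 ennreal_leI)
      finally have "diameter (U i) powr s < \<delta> powr s"
        using False s by (simp add: diam_gauge_def ennreal_less_iff)
      then show ?thesis using s d \<delta> by (meson linorder_not_less powr_mono2 less_imp_le)
    qed (use \<delta> in simp)
    then have "hausdorff_premeasure s \<delta> E \<le> (\<Sum>i. diam_gauge s (U i))"
      unfolding hausdorff_premeasure_def using U by (intro INF_lower) auto
    also have "\<dots> \<le> ennreal ?e" using U(3) by simp
    also have "\<dots> \<le> ennreal e" by (intro ennreal_leI) simp
    finally show "hausdorff_premeasure s \<delta> E \<le> 0 + ennreal e" by simp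
  qed
  then show ?thesis unfolding hausdorff_measure_def by (simp add: SUP_eq_const)
qed

lemma hausdorff_content_UN_null:
  assumes "\<And>n::nat. hausdorff_content s (A n) = 0"
  shows "hausdorff_content s (\<Union>n. A n) = 0"
proof -
  have "hausdorff_content s (\<Union>n. A n) \<le> 0"
  proof (rule ennreal_le_epsilon)
    fix e :: real assume e: "e > 0"
    have "\<exists>U. A n \<subseteq> (\<Union>i. U i) \<and> (\<forall>i. bounded (U i)) \<and> (\<Sum>i. diam_gauge s (U i)) < ennreal (e * (1 / 2) ^ Suc n)" for n
    proof -
      have "hausdorff_content s (A n) < ennreal (e * (1 / 2) ^ Suc n)" using assms[of n] e by simp
      then show ?thesis by (rule hausdorff_content_lessD) blast
    qed
    then obtain U where U: "\<And>n. A n \<subseteq> (\<Union>i. U n i)" "\<And>n i. bounded (U n i)"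
       "\<And>n. (\<Sum>i. diam_gauge s (U n i)) < ennreal (e * (1 / 2) ^ Suc n)" by metis
    let ?V = "\<lambda>k. U (fst (prod_decode k)) (snd (prod_decode k))"
    have "(\<Union>n. A n) \<subseteq> (\<Union>k. ?V k)"
    proof
      fix x assume "x \<in> (\<Union>n. A n)"
      then obtain n i where "x \<in> U n i" using U(1) by blast
      then have "x \<in> ?V (prod_encode (n, i))" by simp
      then show "x \<in> (\<Union>k. ?V k)" by blast
    qed
    then have "hausdorff_content s (\<Union>n. A n) \<le> (\<Sum>k. diam_gauge s (?V k))"
      using U(2) by (intro hausdorff_content_le) auto
    also have "\<dots> = (\<Sum>n. \<Sum>i. diam_gauge s (U n i))"
      using suminf_ennreal_2dimen[of "\<lambda>n. \<Sum>i. diam_gauge s (U n i)" "\<lambda>p. diam_gauge s (U (fst p) (snd p))"]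
      by (simp add: comp_def)
    also have "\<dots> \<le> (\<Sum>n. ennreal (e * (1 / 2) ^ Suc n))"
      by (intro suminf_le less_imp_le U(3)) auto
    also have "\<dots> = ennreal e"
    proof -
      have "(\<lambda>n. e * (1 / 2) ^ Suc n) sums (e * 1)" by (intro sums_mult power_half_series)
      then show ?thesis using e by (subst suminf_ennreal2) (auto simp: sums_iff)
    qed
    finally show "hausdorff_content s (\<Union>n. A n) \<le> 0 + ennreal e" by simp
  qed
  then show ?thesis by simp
qed

lemma hausdorff_content_finite_le:
  assumes "finite C" "E \<subseteq> (\<Union>i\<in>C. V i)" "\<And>i. i \<in> C \<Longrightarrow> bounded (V i)"
  shows "hausdorff_content s E \<le> (\<Sum>i\<in>C. diam_gauge s (V i))"
proof -
  obtain f where f: "bij_betw f {..<card C} C"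
    using ex_bij_betw_nat_finite[OF assms(1)] by (auto simp: atLeast0LessThan)
  let ?U = "\<lambda>i. if i < card C then V (f i) else {}"
  have "E \<subseteq> (\<Union>i. ?U i)"
  proof
    fix x assume "x \<in> E"
    then obtain c where "c \<in> C" "x \<in> V c" using assms(2) by blast
    moreover have "f ` {..<card C} = C" using f by (simp add: bij_betw_imp_surj_on)
    ultimately obtain i where "i < card C" "x \<in> V (f i)" by (metis imageE lessThan_iff)
    then show "x \<in> (\<Union>i. ?U i)" by (intro UN_I[of i]) auto
  qed
  then have "hausdorff_content s E \<le> (\<Sum>i. diam_gauge s (?U i))"
    using f assms(3) by (intro hausdorff_content_le) (auto simp: bij_betw_def)
  also have "\<dots> = (\<Sum>i<card C. diam_gauge s (?U i))"
    by (rule suminf_finite) (auto simp: diam_gauge_def)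
  also have "\<dots> = (\<Sum>i<card C. diam_gauge s (V (f i)))" by simp
  also have "\<dots> = (\<Sum>i\<in>C. diam_gauge s (V i))" by (rule sum.reindex_bij_betw[OF f])
  finally show ?thesis .
qed

lemma hausdorff_content_empty: "hausdorff_content s {} = 0"
  using hausdorff_content_finite_le[of "{}" "{}" "\<lambda>_. {}" s] by simp

lemma hausdorff_content_countable_null:
  assumes "countable I" "\<And>i. i \<in> I \<Longrightarrow> hausdorff_content s (A i) = 0"
  shows "hausdorff_content s (\<Union>i\<in>I. A i) = 0"
proof (cases "I = {}")
  case False
  have "(\<Union>i\<in>I. A i) = (\<Union>n. A (from_nat_into I n))"
    using range_from_nat_into[OF False assms(1)] by (metis image_image)
  then show ?thesis using hausdorff_content_UN_null[of s "\<lambda>n. A (from_nat_into I n)"] assms(2) from_nat_into[OF False] by simp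
qed (simp add: hausdorff_content_empty)

lemma diam_gauge_le:
  fixes V :: "'a::real_normed_vector set"
  assumes "s > 0" "\<delta> \<ge> 0" "\<And>x y. x \<in> V \<Longrightarrow> y \<in> V \<Longrightarrow> norm (x - y) \<le> \<delta>"
  shows "diam_gauge s V \<le> ennreal (\<delta> powr s)"
proof (cases "V = {}")
  case False
  then obtain v where v: "v \<in> V" by blast
  have "bounded V" unfolding bounded_def using assms(3)[OF v] by (metis dist_norm)
  then have "0 \<le> diameter V" by (rule diameter_ge_0)
  moreover have "diameter V \<le> \<delta>" using assms by (intro diameter_le) auto
  ultimately show ?thesis unfolding diam_gauge_def using assms False by (auto intro!: ennreal_leI powr_mono2)
qed (simp add: diam_gauge_def)

lemma hausdorff_content_singleton:
  fixes x :: "'a::real_normed_vector"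
  assumes "s > 0"
  shows "hausdorff_content s {x} = 0"
  using hausdorff_content_finite_le[of "{x}" "{x}" "\<lambda>x. {x}" s] diam_gauge_le[of s 0 "{x}"] assms by simp

text \<open>A segment cut into \<open>m + 1\<close> equal pieces has gauge sum of order
  \<open>(m + 1) powr (1 - s)\<close>, which tends to 0; a line is a countable union of
  segments.\<close>

lemma hausdorff_content_line:
  fixes p w :: "'a::real_normed_vector"
  assumes s: "s > 1"
  shows "hausdorff_content s (range (\<lambda>t. p + t *\<^sub>R w)) = 0"
proof -
  let ?S = "\<lambda>n::nat. (\<lambda>t. p + t *\<^sub>R w) ` {- real n..real n}"
  have seg: "hausdorff_content s (?S n) = 0" for n
  proof -
    let ?c = "2 * real n * norm w"
    have bd: "hausdorff_content s (?S n) \<le> ennreal (real (Suc m) * (?c / Suc m) powr s)" for m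
    proof -
      let ?h = "2 * real n / Suc m"
      let ?V = "\<lambda>i. (\<lambda>t. p + t *\<^sub>R w) ` {- real n + real i * ?h..- real n + (real i + 1) * ?h}"
      have "?S n \<subseteq> (\<Union>i\<in>{..<Suc m}. ?V i)"
      proof (intro image_subsetI)
        fix t assume t: "t \<in> {- real n..real n}"
        show "p + t *\<^sub>R w \<in> (\<Union>i\<in>{..<Suc m}. ?V i)"
        proof (cases "t = real n")
          \<comment> \<open>The right end point has its own case, since the floor used below would
            give the index \<open>m + 1\<close>. This case also takes care of the degenerate segment
            \<open>n = 0\<close>, where \<open>?h = 0\<close>.\<close>
          case True
          have "- real n + (real m + 1) * ?h = real n" by (simp add: field_simps)
          moreover have "- real n + real m * ?h \<le> real n" by (simp add: field_simps)
          ultimately have "t \<in> {- real n + real m * ?h..- real n + (real m + 1) * ?h}" using True by auto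
          then show ?thesis by (intro UN_I[of m]) auto
        next
          case False
          then have n: "?h > 0" using t by auto
          define i where "i = nat \<lfloor>(t + n) / ?h\<rfloor>"
          have i: "real i \<le> (t + n) / ?h" "(t + n) / ?h < real i + 1"
            unfolding i_def using t n by (auto simp: of_nat_nat)
          have 1: "real i * ?h \<le> t + n" "t + n \<le> (real i + 1) * ?h"
            using i n by (simp_all only: pos_le_divide_eq pos_divide_less_eq less_imp_le)
          have "real (Suc m) * ?h = 2 * real n" by simp
          then have "real i * ?h < real (Suc m) * ?h" using 1(1) t False by simp
          then have "i < Suc m" using n by (simp only: mult_less_cancel_right_pos of_nat_less_iff)
          then show ?thesis using 1 by (intro UN_I[of i]) auto
        qed
      qed
      then have "hausdorff_content s (?S n) \<le> (\<Sum>i<Suc m. diam_gauge s (?V i))"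
        by (rule hausdorff_content_finite_le[rotated])
           (auto intro!: compact_imp_bounded compact_continuous_image continuous_intros)
      also have "\<dots> \<le> (\<Sum>i<Suc m. ennreal ((?c / Suc m) powr s))"
      proof (intro sum_mono diam_gauge_le)
        fix i :: nat and x y assume "x \<in> ?V i" "y \<in> ?V i"
        then obtain t u where tu: "x = p + t *\<^sub>R w" "y = p + u *\<^sub>R w"
          "t \<in> {- real n + real i * ?h..- real n + (real i + 1) * ?h}" "u \<in> {- real n + real i * ?h..- real n + (real i + 1) * ?h}"
          by blast
        have "(real i + 1) * ?h = real i * ?h + ?h" by (simp only: distrib_right mult_1_left)
        then have abs: "\<bar>t - u\<bar> \<le> ?h" using tu(3,4) unfolding atLeastAtMost_iff by linarith
        have "norm (x - y) = \<bar>t - u\<bar> * norm w" using tu(1,2) by (simp flip: scaleR_diff_left)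
        also have "\<dots> \<le> ?h * norm w" using abs by (intro mult_right_mono) auto
        finally show "norm (x - y) \<le> ?c / Suc m" by (simp add: field_simps)
      qed (use s in auto)
      also have "\<dots> = ennreal (real (Suc m) * (?c / Suc m) powr s)"
        by (subst sum_ennreal) auto
      finally show ?thesis .
    qed
    have "(\<lambda>m. real (Suc m) * (?c / Suc m) powr s) \<longlonglongrightarrow> 0"
    proof -
      have "real (Suc m) * (?c / Suc m) powr s = ?c powr s * (real (Suc m)) powr (1 - s)" for m
        by (simp add: powr_divide powr_diff)
      moreover have "(\<lambda>m. ?c powr s * (real (Suc m)) powr (1 - s)) \<longlonglongrightarrow> ?c powr s * 0"
        using s by (intro tendsto_mult tendsto_const) real_asymp
      ultimately show ?thesis by simp
    qed
    then have "(\<lambda>m. ennreal (real (Suc m) * (?c / Suc m) powr s)) \<longlonglongrightarrow> ennreal 0"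
      by (intro tendsto_ennrealI)
    then have "hausdorff_content s (?S n) \<le> ennreal 0"
      by (rule LIMSEQ_le_const) (use bd in auto)
    then show ?thesis by simp
  qed
  have "range (\<lambda>t. p + t *\<^sub>R w) = (\<Union>n. ?S n)"
  proof (intro equalityI subsetI)
    fix x assume "x \<in> range (\<lambda>t. p + t *\<^sub>R w)"
    then obtain t where t: "x = p + t *\<^sub>R w" by blast
    obtain n :: nat where "\<bar>t\<bar> \<le> real n" using real_arch_simple by blast
    then have "t \<in> {- real n..real n}" by auto
    then have "x \<in> ?S n" unfolding t by (rule imageI)
    then show "x \<in> (\<Union>n. ?S n)" by blast
  qed blast
  then show ?thesis using hausdorff_content_UN_null[OF seg] by simp
qed

text \<open>Otherwise every point of \<open>E - C\<close> has a ball meeting \<open>E\<close> in a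
  null set. By Lindelof countably many of these balls cover \<open>E - C\<close>, and
  \<open>E\<close> would be null.\<close>

lemma point_of_local_content:
  fixes E :: "'a::euclidean_space set"
  assumes E: "hausdorff_content s E \<noteq> 0" and C: "hausdorff_content s C = 0"
  shows "\<exists>x\<in>E - C. \<forall>\<rho>>0. hausdorff_content s (E \<inter> cball x \<rho>) \<noteq> 0"
proof (rule ccontr)
  assume "\<not> ?thesis"
  then have "\<forall>x\<in>E - C. \<exists>\<rho>>0. hausdorff_content s (E \<inter> cball x \<rho>) = 0" by blast
  then obtain \<rho> where \<rho>: "\<And>x. x \<in> E - C \<Longrightarrow> \<rho> x > 0 \<and> hausdorff_content s (E \<inter> cball x (\<rho> x)) = 0" by metis
  obtain F where F: "F \<subseteq> (\<lambda>x. ball x (\<rho> x)) ` (E - C)" "countable F" "\<Union>F = (\<Union>x\<in>E - C. ball x (\<rho> x))"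
    by (rule Lindelof[of "(\<lambda>x. ball x (\<rho> x)) ` (E - C)"]) auto
  obtain I where I: "countable I" "I \<subseteq> E - C" "F = (\<lambda>x. ball x (\<rho> x)) ` I"
    using countable_subset_image[of F "\<lambda>x. ball x (\<rho> x)" "E - C"] F(1,2) by blast
  let ?A = "\<lambda>n::nat. if n = 0 then C else (\<Union>x\<in>I. E \<inter> cball x (\<rho> x))"
  have "hausdorff_content s (\<Union>x\<in>I. E \<inter> cball x (\<rho> x)) = 0"
    using I \<rho> by (intro hausdorff_content_countable_null) auto
  then have "hausdorff_content s (\<Union>n. ?A n) = 0" using C by (intro hausdorff_content_UN_null) auto
  moreover have "E \<subseteq> (\<Union>n. ?A n)"
  proof
    fix x assume x: "x \<in> E"
    show "x \<in> (\<Union>n. ?A n)"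
    proof (cases "x \<in> C")
      case True then show ?thesis by (intro UN_I[of 0]) auto
    next
      case False
      then have "x \<in> \<Union>F" unfolding F(3) using x \<rho>[of x] by force
      then obtain y where "y \<in> I" "x \<in> ball y (\<rho> y)" using I by blast
      then show ?thesis using x by (intro UN_I[of 1]) (auto intro!: bexI[of _ y])
    qed
  qed
  then have "hausdorff_content s E \<le> hausdorff_content s (\<Union>n. ?A n)" by (rule hausdorff_content_mono)
  ultimately show False using E by (simp only: le_zero_eq)
qed

section \<open>Frostman weights on finite sets\<close>

text \<open>The points are treated one after the other, and each receives the largest weight that
  violates no capacity. Then some set containing the new point is saturated.\<close>

lemma greedy_weights:
  fixes B :: "'f \<Rightarrow> 'a set" and w :: "'f \<Rightarrow> real"
  assumes P: "finite P" and F: "finite F" and w: "\<And>f. f \<in> F \<Longrightarrow> w f \<ge> 0"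
    and cov: "\<And>p. p \<in> P \<Longrightarrow> \<exists>f\<in>F. p \<in> B f"
  shows "\<exists>a. (\<forall>p. a p \<ge> 0) \<and> (\<forall>f\<in>F. sum a (P \<inter> B f) \<le> w f) \<and> (\<forall>p\<in>P. \<exists>f\<in>F. p \<in> B f \<and> sum a (P \<inter> B f) = w f)"
  using P cov
proof (induction P)
  case empty
  then show ?case using w by (intro exI[of _ "\<lambda>_. 0"]) auto
next
  case (insert p P)
  have "\<exists>a. (\<forall>p. a p \<ge> 0) \<and> (\<forall>f\<in>F. sum a (P \<inter> B f) \<le> w f) \<and> (\<forall>p\<in>P. \<exists>f\<in>F. p \<in> B f \<and> sum a (P \<inter> B f) = w f)"
    by (rule insert.IH) (rule insert.prems, simp)
  then obtain a where a': "\<forall>p. a p \<ge> 0" "\<forall>f\<in>F. sum a (P \<inter> B f) \<le> w f"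
    "\<forall>p\<in>P. \<exists>f\<in>F. p \<in> B f \<and> sum a (P \<inter> B f) = w f" by blast
  note a = a'(1)[rule_format] a'(2)[rule_format] a'(3)[rule_format]
  let ?G = "(\<lambda>f. w f - sum a (P \<inter> B f)) ` {f \<in> F. p \<in> B f}"
  define m where "m = Min ?G"
  have G: "finite ?G" "?G \<noteq> {}" using F insert.prems[of p] by auto
  have m_le: "m \<le> w f - sum a (P \<inter> B f)" if "f \<in> F" "p \<in> B f" for f
    unfolding m_def using G that by (intro Min_le) auto
  have m0: "m \<ge> 0" unfolding m_def using G a(2) by (subst Min_ge_iff) auto
  obtain f0 where f0: "f0 \<in> F" "p \<in> B f0" "m = w f0 - sum a (P \<inter> B f0)"
    using Min_in[OF G] unfolding m_def by auto
  define a' where "a' = a(p := m)"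
  have "sum a' (P \<inter> B f) = sum a (P \<inter> B f)" for f
    using insert.hyps by (intro sum.cong) (auto simp: a'_def)
  then have sum': "sum a' (insert p P \<inter> B f) = (if p \<in> B f then m else 0) + sum a (P \<inter> B f)" for f
    using insert.hyps by (auto simp: Int_insert_left a'_def)
  show ?case
  proof (intro exI[of _ a'] conjI allI ballI)
    fix q show "a' q \<ge> 0" using a(1) m0 by (simp add: a'_def)
  next
    fix f assume "f \<in> F"
    then show "sum a' (insert p P \<inter> B f) \<le> w f" unfolding sum' using m_le[of f] a(2)[of f] by auto
  next
    fix q assume q: "q \<in> insert p P"
    show "\<exists>f\<in>F. q \<in> B f \<and> sum a' (insert p P \<inter> B f) = w f"
    proof (cases "q = p")
      case True
      then show ?thesis using f0 unfolding sum' by (intro bexI[of _ f0]) auto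
    next
      case False
      then obtain f where f: "f \<in> F" "q \<in> B f" "sum a (P \<inter> B f) = w f" using a(3) q by auto
      \<comment> \<open>A set saturated before stays saturated: if it contains \<open>p\<close>, it
        leaves no room for a positive weight at \<open>p\<close>.\<close>
      then have "p \<in> B f \<Longrightarrow> m = 0" using m_le[of f] m0 by auto
      then show ?thesis using f unfolding sum' by (intro bexI[of _ f]) auto
    qed
  qed
qed

text \<open>A discrete Frostman lemma. The capacities are the s-th powers of the radii of the dyadic
  balls centred in a finite net \<open>P\<close> of mesh \<open>2^(-N)\<close>. The saturated balls
  cover \<open>P\<close>; a disjoint Vitali subfamily carries mass equal to its total capacity, and
  its enlargements cover \<open>A\<close>, so the content of \<open>A\<close> bounds the total mass
  from below. For a ball with arbitrary centre, compare with a dyadic ball about one of its points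
  in \<open>P\<close>.\<close>

lemma finite_scale_measure:
  fixes A :: "'a::euclidean_space set"
  assumes A: "compact A" "\<And>x y. x \<in> A \<Longrightarrow> y \<in> A \<Longrightarrow> norm (x - y) \<le> 1"
    and s: "s > 0" and c: "c > 0" "ennreal c \<le> hausdorff_content s A"
  shows "\<exists>P a. finite P \<and> P \<subseteq> A \<and> (\<forall>p. a p \<ge> 0) \<and> c / 12 powr s \<le> sum a P \<and>
     (\<forall>y r. 1 / 2 ^ N \<le> r \<longrightarrow> sum a (P \<inter> cball y r) \<le> (4 * r) powr s)"
proof -
  let ?\<delta> = "\<lambda>j::nat. 1 / (2::real) ^ j"
  obtain P where P: "finite P" "P \<subseteq> A" "A \<subseteq> (\<Union>p\<in>P. ball p (?\<delta> N))"
  proof (rule compactE_image[OF A(1), of A "\<lambda>p. ball p (?\<delta> N)"])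
    show "A \<subseteq> (\<Union>p\<in>A. ball p (?\<delta> N))" by (intro subsetI UN_I) auto
  qed auto
  let ?F = "P \<times> {..N}" and ?B = "\<lambda>f. cball (fst f) (?\<delta> (snd f))" and ?w = "\<lambda>f. ?\<delta> (snd f) powr s"
  have "\<exists>a. (\<forall>p. a p \<ge> 0) \<and> (\<forall>f\<in>?F. sum a (P \<inter> ?B f) \<le> ?w f) \<and>
      (\<forall>p\<in>P. \<exists>f\<in>?F. p \<in> ?B f \<and> sum a (P \<inter> ?B f) = ?w f)"
  proof (rule greedy_weights[OF P(1)])
    show "\<exists>f\<in>?F. p \<in> ?B f" if "p \<in> P" for p using that by (intro bexI[of _ "(p, 0)"]) auto
  qed (use P(1) in auto)
  then obtain a where a': "\<forall>p. a p \<ge> 0" "\<forall>f\<in>?F. sum a (P \<inter> ?B f) \<le> ?w f"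
    "\<forall>p\<in>P. \<exists>f\<in>?F. p \<in> ?B f \<and> sum a (P \<inter> ?B f) = ?w f" by blast
  note a = a'(1)[rule_format] a'(2)[rule_format] a'(3)[rule_format]
  have total: "c / 12 powr s \<le> sum a P"
  proof -
    let ?T = "{f \<in> ?F. sum a (P \<inter> ?B f) = ?w f}"
    have PT: "P \<subseteq> (\<Union>f\<in>?T. ?B f)" using a(3) by blast
    obtain C where C: "C \<subseteq> ?T" "pairwise (\<lambda>i j. disjnt (?B i) (?B j)) C" "P \<subseteq> (\<Union>f\<in>C. cball (fst f) (5 * ?\<delta> (snd f)))"
    proof (rule Vitali_covering_lemma_cballs[OF PT, of 1])
      show "0 < ?\<delta> (snd i) \<and> ?\<delta> (snd i) \<le> 1" for i :: "'a \<times> nat" by (simp add: field_simps)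
    qed (rule that)
    have "finite ?T" using P(1) by auto
    then have finC: "finite C" using C(1) by (rule finite_subset[rotated])
    \<comment> \<open>Vitali gives the factor 5 for points of \<open>P\<close>. A point of
      \<open>A\<close> is within \<open>2^(-N)\<close> of \<open>P\<close>, which is at most one
      further radius; hence 6, and 12 for the diameters.\<close>
    have "A \<subseteq> (\<Union>f\<in>C. cball (fst f) (6 * ?\<delta> (snd f)))"
    proof
      fix x assume "x \<in> A"
      then obtain p where p: "p \<in> P" "dist p x < ?\<delta> N" using P(3) by auto
      then obtain f where f: "f \<in> C" "dist (fst f) p \<le> 5 * ?\<delta> (snd f)" using C(3) by auto
      have "snd f \<le> N" using f C(1) by auto
      then have "?\<delta> N \<le> ?\<delta> (snd f)" by (intro divide_left_mono power_increasing) auto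
      moreover have "dist (fst f) x \<le> dist (fst f) p + dist p x" by (rule dist_triangle)
      ultimately show "x \<in> (\<Union>f\<in>C. cball (fst f) (6 * ?\<delta> (snd f)))" using f p by (intro UN_I[of f]) auto
    qed
    then have "hausdorff_content s A \<le> (\<Sum>f\<in>C. diam_gauge s (cball (fst f) (6 * ?\<delta> (snd f))))"
      using finC by (intro hausdorff_content_finite_le) auto
    also have "\<dots> \<le> (\<Sum>f\<in>C. ennreal ((12 * ?\<delta> (snd f)) powr s))"
    proof (intro sum_mono diam_gauge_le s)
      fix f :: "'a \<times> nat" and x y assume "x \<in> cball (fst f) (6 * ?\<delta> (snd f))" "y \<in> cball (fst f) (6 * ?\<delta> (snd f))"
      then show "norm (x - y) \<le> 12 * ?\<delta> (snd f)"
        unfolding mem_cball using dist_triangle2[of x y "fst f"] by (simp add: dist_norm[of x y, symmetric] dist_commute)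
    qed auto
    also have "\<dots> = ennreal (12 powr s * (\<Sum>f\<in>C. ?w f))"
      by (subst sum_ennreal) (auto simp: powr_mult sum_distrib_left simp del: times_divide_eq_right mult_1_right)
    finally have "ennreal c \<le> ennreal (12 powr s * (\<Sum>f\<in>C. ?w f))" using c(2) by (rule order_trans[rotated])
    then have "c \<le> 12 powr s * (\<Sum>f\<in>C. ?w f)"
      by (subst (asm) ennreal_le_iff) (auto intro!: mult_nonneg_nonneg sum_nonneg)
    also have "(\<Sum>f\<in>C. ?w f) = (\<Sum>f\<in>C. sum a (P \<inter> ?B f))" using C(1) by (intro sum.cong) auto
    also have "\<dots> = sum a (\<Union>f\<in>C. P \<inter> ?B f)"
    proof (rule sum.UNION_disjoint[symmetric])
      show "\<forall>i\<in>C. \<forall>j\<in>C. i \<noteq> j \<longrightarrow> P \<inter> ?B i \<inter> (P \<inter> ?B j) = {}"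
        using C(2) unfolding pairwise_def disjnt_def by blast
    qed (use finC P(1) in auto)
    also have "\<dots> \<le> sum a P" using a(1) P(1) by (intro sum_mono2) auto
    finally show ?thesis by (simp add: field_simps)
  qed
  have mass: "sum a (P \<inter> cball y r) \<le> (4 * r) powr s" if r: "?\<delta> N \<le> r" for y r
  proof (cases "P \<inter> cball y r = {}")
    case False
    then obtain p where p: "p \<in> P" "dist y p \<le> r" by auto
    have r0: "r > 0" using r by (rule less_le_trans[rotated]) simp
    have sub: "sum a (P \<inter> cball y r) \<le> ?\<delta> j powr s" if j: "j \<le> N" "P \<inter> cball y r \<subseteq> cball p (?\<delta> j)" for j
    proof -
      have "sum a (P \<inter> cball y r) \<le> sum a (P \<inter> ?B (p, j))"
        using j a(1) P(1) by (intro sum_mono2) auto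
      also have "\<dots> \<le> ?w (p, j)" using j p by (intro a(2)) auto
      finally show ?thesis by simp
    qed
    show ?thesis
    proof (cases "2 * r \<le> 1")
      case True
      \<comment> \<open>The index for which \<open>2^(-j)\<close> lies between \<open>2 * r\<close>
        and \<open>4 * r\<close>: the ball about \<open>p\<close> must contain the given ball, while
        its capacity stays below \<open>(4 * r) powr s\<close>.\<close>
      define j where "j = nat \<lfloor>log 2 (1 / (2 * r))\<rfloor>"
      have lg: "log 2 (1 / (2 * r)) \<ge> 0" using True r0 by (simp add: field_simps)
      have j: "real j \<le> log 2 (1 / (2 * r))" "log 2 (1 / (2 * r)) < real j + 1"
        unfolding j_def using lg by (auto simp: of_nat_nat)
      have "2 ^ j \<le> 1 / (2 * r)" using j(1) r0 by (simp add: le_log_iff powr_realpow)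
      then have j1: "2 * r \<le> ?\<delta> j" using r0 by (simp add: field_simps)
      have "1 / (2 * r) < 2 powr (real j + 1)" using j(2) r0 by (simp add: log_less_iff)
      then have "1 / (2 * r) < 2 ^ (j + 1)" by (simp add: powr_add powr_realpow)
      then have j2: "?\<delta> j < 4 * r" using r0 by (simp add: field_simps)
      have "?\<delta> N < ?\<delta> j" using r j1 r0 by linarith
      then have "(2::real) ^ j < 2 ^ N" by (simp add: field_simps)
      then have "j \<le> N" by simp
      moreover have "P \<inter> cball y r \<subseteq> cball p (?\<delta> j)"
      proof
        fix q assume "q \<in> P \<inter> cball y r"
        then have "dist p q \<le> 2 * r" using p dist_triangle3[of p q y] by (simp add: dist_commute)
        then show "q \<in> cball p (?\<delta> j)" using j1 by simp
      qed
      ultimately have "sum a (P \<inter> cball y r) \<le> ?\<delta> j powr s" by (rule sub)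
      also have "\<dots> \<le> (4 * r) powr s" using j2 s by (intro powr_mono2) auto
      finally show ?thesis .
    next
      case False
      \<comment> \<open>For \<open>r > 1/2\<close> the diameter bound on \<open>A\<close> makes the
        ball of radius 1 about \<open>p\<close> contain all of \<open>P\<close>, and its capacity 1
        is below \<open>(4 * r) powr s\<close>.\<close>
      have "P \<inter> cball y r \<subseteq> cball p (?\<delta> 0)" 
      proof
        fix q assume "q \<in> P \<inter> cball y r"
        then have "norm (p - q) \<le> 1" using p(1) P(2) by (intro A(2)) auto
        then show "q \<in> cball p (?\<delta> 0)" by (simp add: dist_norm)
      qed
      then have "sum a (P \<inter> cball y r) \<le> ?\<delta> 0 powr s" by (intro sub) auto
      also have "\<dots> \<le> (4 * r) powr s" using False s by (intro powr_mono2) auto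
      finally show ?thesis .
    qed
  qed simp
  show ?thesis
    by (intro exI[of _ P] exI[of _ a] conjI allI impI) (rule P(1), rule P(2), rule a(1), rule total, erule mass)
qed

text \<open>The Gaussian is cut into shells of width \<open>r0 = 1 / sqrt \<Lambda>\<close> about
  \<open>y\<close>. The ball bound on the k-th shell is \<open>(4 * (k + 1) * r0) powr s\<close>,
  and the factors \<open>exp (- k^2)\<close> make the sum over k converge. The order of quantifiers
  is essential: \<open>C\<close> is fixed before \<open>L\<close>, while the weights may depend on
  \<open>L\<close>.\<close>

lemma frostman_finite:
  fixes A :: "'a::euclidean_space set"
  assumes A: "compact A" "\<And>x y. x \<in> A \<Longrightarrow> y \<in> A \<Longrightarrow> norm (x - y) \<le> 1"
    and s: "s > 0" and c: "hausdorff_content s A \<noteq> 0"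
  shows "\<exists>C. \<forall>L. \<exists>P a. finite P \<and> P \<subseteq> A \<and> (\<forall>p. a p \<ge> 0) \<and> sum a P = 1 \<and>
     (\<forall>y \<Lambda>. 0 < \<Lambda> \<longrightarrow> \<Lambda> \<le> L \<longrightarrow> (\<Sum>p\<in>P. a p * exp (- \<Lambda> * (norm (p - y))\<^sup>2)) \<le> C * \<Lambda> powr (- s / 2))"
proof -
  \<comment> \<open>Truncation at 1 yields a positive real number below the content.\<close>
  define c where "c = enn2real (min 1 (hausdorff_content s A))"
  have "min 1 (hausdorff_content s A) < top" by (simp add: min.strict_coboundedI1)
  then have ec: "ennreal c = min 1 (hausdorff_content s A)" unfolding c_def by simp
  have c0: "c > 0" using assms(4) unfolding c_def
    by (simp add: enn2real_positive_iff min.strict_coboundedI1 zero_less_iff_neq_zero)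
  define t where "t = c / 12 powr s"
  have t: "t > 0" using c0 by (simp add: t_def)
  let ?u = "\<lambda>k::nat. exp (- (real k)\<^sup>2) * (4 * (real k + 1)) powr s"
  have sm: "summable ?u"
  proof (rule summable_comparison_test_bigo)
    show "summable (\<lambda>k. norm (1 / 2 ^ k :: real))" by (simp add: power_one_over[symmetric] summable_geometric)
    show "?u \<in> O(\<lambda>k. 1 / 2 ^ k)" by real_asymp
  qed
  define C where "C = suminf ?u / t"
  have "\<exists>P a. finite P \<and> P \<subseteq> A \<and> (\<forall>p. a p \<ge> 0) \<and> sum a P = 1 \<and>
     (\<forall>y \<Lambda>. 0 < \<Lambda> \<longrightarrow> \<Lambda> \<le> L \<longrightarrow> (\<Sum>p\<in>P. a p * exp (- \<Lambda> * (norm (p - y))\<^sup>2)) \<le> C * \<Lambda> powr (- s / 2))" for L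
  proof -
    \<comment> \<open>Chosen so that \<open>2^(-N)\<close> is below the shell width
      \<open>1 / sqrt \<Lambda>\<close> for every \<open>\<Lambda> <= L\<close>.\<close>
    obtain N :: nat where N: "sqrt (max L 0) < 2 ^ N" using real_arch_pow[of 2 "sqrt (max L 0)"] by auto
    have "ennreal c \<le> hausdorff_content s A" using ec by simp
    from finite_scale_measure[OF A s c0 this, of N]
    obtain P a where P: "finite P" "P \<subseteq> A" "\<And>p. a p \<ge> 0" "t \<le> sum a P"
      "\<And>y r. 1 / 2 ^ N \<le> r \<Longrightarrow> sum a (P \<inter> cball y r) \<le> (4 * r) powr s" unfolding t_def by blast
    define m where "m = sum a P"
    have m: "m > 0" "t \<le> m" using P(4) t by (auto simp: m_def)
    show ?thesis
    proof (intro exI[of _ P] exI[of _ "\<lambda>p. a p / m"] conjI allI impI)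
      show "(\<Sum>p\<in>P. a p / m) = 1" using m by (simp add: sum_divide_distrib[symmetric] m_def)
      fix y :: 'a and \<Lambda> :: real assume \<Lambda>: "0 < \<Lambda>" "\<Lambda> \<le> L"
      define r0 where "r0 = 1 / sqrt \<Lambda>"
      have r0: "r0 > 0" "\<Lambda> * r0\<^sup>2 = 1" using \<Lambda> by (simp_all add: r0_def power_divide)
      have "sqrt \<Lambda> \<le> 2 ^ N" using N \<Lambda> by (smt (verit) real_sqrt_le_mono)
      then have r0N: "1 / 2 ^ N \<le> r0" unfolding r0_def using \<Lambda> by (intro divide_left_mono) auto
      define kk where "kk = (\<lambda>p. nat \<lfloor>norm (p - y) / r0\<rfloor>)"
      define Kmax where "Kmax = Max (insert 0 (kk ` P))"
      have kk: "kk p \<le> Kmax" if "p \<in> P" for p unfolding Kmax_def using that P(1) by (intro Max_ge) auto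
      have pt: "a p * exp (- \<Lambda> * (norm (p - y))\<^sup>2) \<le>
          (\<Sum>k\<le>Kmax. exp (- (real k)\<^sup>2) * (if p \<in> cball y ((real k + 1) * r0) then a p else 0))" if p: "p \<in> P" for p
      proof -
        have k: "real (kk p) \<le> norm (p - y) / r0" "norm (p - y) / r0 < real (kk p) + 1"
          unfolding kk_def using r0 by (auto simp: of_nat_nat)
        have 1: "p \<in> cball y ((real (kk p) + 1) * r0)"
          using k(2) r0 by (simp add: dist_norm norm_minus_commute pos_divide_less_eq less_imp_le)
        have "(real (kk p))\<^sup>2 \<le> (norm (p - y) / r0)\<^sup>2" using k by (intro power_mono) auto
        also have "\<dots> = \<Lambda> * (norm (p - y))\<^sup>2"
          using r0 by (simp add: power_divide divide_eq_eq mult.assoc mult.left_commute[of "r0\<^sup>2"])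
        finally have "exp (- \<Lambda> * (norm (p - y))\<^sup>2) \<le> exp (- (real (kk p))\<^sup>2)" by simp
        then have "a p * exp (- \<Lambda> * (norm (p - y))\<^sup>2) \<le> exp (- (real (kk p))\<^sup>2) * (if p \<in> cball y ((real (kk p) + 1) * r0) then a p else 0)"
          using 1 P(3)[of p] by (simp add: mult.commute mult_left_mono)
        also have "\<dots> \<le> (\<Sum>k\<le>Kmax. exp (- (real k)\<^sup>2) * (if p \<in> cball y ((real k + 1) * r0) then a p else 0))"
          using kk[OF p] P(3) by (intro member_le_sum) auto
        finally show ?thesis .
      qed
      have "(\<Sum>p\<in>P. a p * exp (- \<Lambda> * (norm (p - y))\<^sup>2)) \<le>
         (\<Sum>p\<in>P. \<Sum>k\<le>Kmax. exp (- (real k)\<^sup>2) * (if p \<in> cball y ((real k + 1) * r0) then a p else 0))"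
        by (intro sum_mono pt)
      also have "\<dots> = (\<Sum>k\<le>Kmax. exp (- (real k)\<^sup>2) * sum a (P \<inter> cball y ((real k + 1) * r0)))"
        by (subst sum.swap) (simp add: sum_distrib_left[symmetric] sum.inter_restrict[OF P(1)] del: mem_cball)
      also have "\<dots> \<le> (\<Sum>k\<le>Kmax. exp (- (real k)\<^sup>2) * (4 * ((real k + 1) * r0)) powr s)"
      proof (intro sum_mono mult_left_mono P(5))
        fix k :: nat
        have "1 * r0 \<le> (real k + 1) * r0" using r0 by (intro mult_right_mono) auto
        then show "1 / 2 ^ N \<le> (real k + 1) * r0" using r0N by linarith
      qed auto
      also have "\<dots> = r0 powr s * (\<Sum>k\<le>Kmax. ?u k)"
        using r0 by (simp add: sum_distrib_left powr_mult mult_ac)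
      also have "\<dots> \<le> r0 powr s * suminf ?u"
        by (intro mult_left_mono sum_le_suminf sm) auto
      also have "r0 powr s = \<Lambda> powr (- s / 2)"
        using \<Lambda> by (simp add: r0_def powr_half_sqrt[symmetric] powr_divide powr_powr powr_minus_divide)
      finally have main: "(\<Sum>p\<in>P. a p * exp (- \<Lambda> * (norm (p - y))\<^sup>2)) \<le> \<Lambda> powr (- s / 2) * suminf ?u" .
      have "(\<Sum>p\<in>P. a p / m * exp (- \<Lambda> * (norm (p - y))\<^sup>2)) = (\<Sum>p\<in>P. a p * exp (- \<Lambda> * (norm (p - y))\<^sup>2)) / m"
        by (simp add: sum_divide_distrib)
      also have "\<dots> \<le> (\<Lambda> powr (- s / 2) * suminf ?u) / t"
      proof (rule frac_le[OF _ main t m(2)])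
        show "0 \<le> \<Lambda> powr (- s / 2) * suminf ?u" by (intro mult_nonneg_nonneg suminf_nonneg sm) auto
      qed
      finally show "(\<Sum>p\<in>P. a p / m * exp (- \<Lambda> * (norm (p - y))\<^sup>2)) \<le> C * \<Lambda> powr (- s / 2)"
        unfolding C_def by (simp add: mult.commute)
    qed (use P m in auto)
  qed
  then show ?thesis by blast
qed

subsection \<open>The cosine kernel\<close>

text \<open>Normalised so that the constant Fourier coefficient is 1.\<close>
definition cos_kernel :: "nat \<Rightarrow> real \<Rightarrow> real" where
  "cos_kernel n u = 4 ^ n / real (2 * n choose n) * cos (u / 2) ^ (2 * n)"

definition kernel_coeff :: "nat \<Rightarrow> nat \<Rightarrow> real" where
  "kernel_coeff n k = real (2 * n choose k) / real (2 * n choose n)"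

lemma kernel_coeff_bounds: "0 \<le> kernel_coeff n k" "kernel_coeff n k \<le> 1"
  using binomial_maximum'[of n k] by (simp_all add: kernel_coeff_def)

text \<open>The binomial theorem for \<open>(cis (u/2) + cis (- u/2)) ^ (2 * n)\<close>;
  consequently the coefficients are nonnegative and largest in the middle, at
  \<open>k = n\<close>.\<close>

lemma cos_kernel_fourier:
  "complex_of_real (cos_kernel n u) = (\<Sum>k\<le>2 * n. of_real (kernel_coeff n k) * cis ((real k - real n) * u))"
proof -
  have e: "(2 * cos (u / 2)) ^ (2 * n) = 4 ^ n * cos (u / 2) ^ (2 * n)"
    by (simp only: power_mult_distrib power_mult) simp
  have "cis (u / 2) + cis (- (u / 2)) = of_real (2 * cos (u / 2))" by (simp add: complex_eq_iff)
  then have "complex_of_real (4 ^ n * cos (u / 2) ^ (2 * n)) = (cis (u / 2) + cis (- (u / 2))) ^ (2 * n)"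
    by (simp only: e[symmetric] of_real_power)
  also have "\<dots> = (\<Sum>k\<le>2 * n. of_nat (2 * n choose k) * cis (u / 2) ^ k * cis (- (u / 2)) ^ (2 * n - k))"
    by (rule binomial_ring)
  also have "\<dots> = (\<Sum>k\<le>2 * n. of_nat (2 * n choose k) * cis ((real k - real n) * u))"
  proof (rule sum.cong[OF refl])
    fix k assume "k \<in> {..2 * n}"
    then have "cis (u / 2) ^ k * cis (- (u / 2)) ^ (2 * n - k) = cis ((real k - real n) * u)"
      by (simp add: Complex.DeMoivre cis_mult of_nat_diff algebra_simps add_divide_distrib diff_divide_distrib)
    then show "of_nat (2 * n choose k) * cis (u / 2) ^ k * cis (- (u / 2)) ^ (2 * n - k) =
       of_nat (2 * n choose k) * cis ((real k - real n) * u)" by (simp add: mult.assoc)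
  qed
  finally show ?thesis
    by (simp add: cos_kernel_def kernel_coeff_def sum_divide_distrib[symmetric] flip: of_real_power)
qed

lemma cos_kernel_nonneg: "cos_kernel n u \<ge> 0"
  by (simp add: cos_kernel_def power_mult)

text \<open>The central binomial coefficient is at least the average
  \<open>4^n / (2 * n + 1)\<close> of its row. The normalisation thus costs only a factor linear in
  \<open>n\<close>, which the geometric decay away from the peak outweighs.\<close>

lemma cos_kernel_le: "cos_kernel n u \<le> (2 * real n + 1) * (cos (u / 2))\<^sup>2 ^ n"
proof -
  have "(2::nat) ^ (2 * n) = (\<Sum>k\<le>2 * n. 2 * n choose k)" by (simp add: choose_row_sum)
  also have "\<dots> \<le> (\<Sum>k\<le>2 * n. 2 * n choose n)" by (intro sum_mono binomial_maximum')
  also have "\<dots> = (2 * n + 1) * (2 * n choose n)" by simp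
  finally have "real (2 ^ (2 * n)) \<le> real ((2 * n + 1) * (2 * n choose n))" by (simp only: of_nat_le_iff)
  then have "(2::real) ^ (2 * n) \<le> (2 * real n + 1) * real (2 * n choose n)"
    by (simp only: of_nat_power of_nat_mult of_nat_add of_nat_numeral of_nat_1)
  moreover have "(2::real) ^ (2 * n) = 4 ^ n" by (simp add: power_mult)
  ultimately have "4 ^ n \<le> (2 * real n + 1) * real (2 * n choose n)" by (simp only:)
  moreover have "real (2 * n choose n) > 0" by simp
  ultimately have "4 ^ n / real (2 * n choose n) \<le> 2 * real n + 1" by (simp add: divide_le_eq)
  then show ?thesis unfolding cos_kernel_def power_mult by (intro mult_right_mono) auto
qed

lemma cos_kernel_uminus [simp]: "cos_kernel n (- u) = cos_kernel n u"
  by (simp add: cos_kernel_def)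

lemma continuous_on_cos_kernel [continuous_intros]:
  assumes "continuous_on A f"
  shows "continuous_on A (\<lambda>x. cos_kernel n (f x))"
proof -
  have "continuous_on UNIV (cos :: real \<Rightarrow> real)" by (intro continuous_at_imp_continuous_on ballI isCont_cos)
  moreover have "continuous_on A (\<lambda>x. f x / 2)" using assms by (intro continuous_intros) auto
  ultimately have "continuous_on A (\<lambda>x. cos (f x / 2))" by (rule continuous_on_compose2) auto
  then show ?thesis unfolding cos_kernel_def by (intro continuous_intros)
qed

lemma cos_kernel_antimono:
  assumes "0 \<le> u" "u \<le> v" "v \<le> pi"
  shows "cos_kernel n v \<le> cos_kernel n u"
proof -
  have "cos (v / 2) \<le> cos (u / 2)" using assms by (intro cos_monotone_0_pi_le) auto
  moreover have "0 \<le> cos (v / 2)" using assms by (intro cos_ge_zero) auto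
  ultimately show ?thesis unfolding cos_kernel_def by (intro mult_left_mono power_mono) auto
qed

lemma has_integral_cis_period:
  fixes j :: int
  assumes "j \<noteq> 0"
  shows "((\<lambda>u. cis (of_int j * u)) has_integral 0) {- pi..pi}"
proof -
  let ?F = "\<lambda>u. cis (of_int j * u) / (\<i> * of_int j)"
  have "((\<lambda>u. cis (of_int j * u)) has_integral (?F pi - ?F (- pi))) {- pi..pi}"
  proof (rule fundamental_theorem_of_calculus)
    show "(?F has_vector_derivative cis (of_int j * x)) (at x within {- pi..pi})" for x
      using assms by (auto intro!: derivative_eq_intros simp: has_vector_derivative_def scaleR_conv_of_real field_simps)
  qed simp
  moreover have "cis (of_int j * pi) = cis (- (of_int j * pi))"
    by (auto simp: complex_eq_iff sin_zero_iff_int2)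
  ultimately show ?thesis by simp
qed

lemma integral_cos_kernel_period: "(cos_kernel n has_integral 2 * pi) {- pi..pi}"
proof -
  have entry: "((\<lambda>u. of_real (kernel_coeff n k) * cis ((real k - real n) * u)) has_integral
      (if k = n then 2 * of_real pi else 0)) {- pi..pi}" for k
  proof (cases "k = n")
    case True
    have "((\<lambda>u::real. 1 :: complex) has_integral (2 * of_real pi)) {- pi..pi}"
      using has_integral_const_real[of "1::complex" "- pi" pi] by (simp add: scaleR_conv_of_real)
    then show ?thesis using True by (simp add: kernel_coeff_def)
  next
    case False
    have "((\<lambda>u. cis (of_int (int k - int n) * u)) has_integral 0) {- pi..pi}"
      using False by (intro has_integral_cis_period) auto
    from has_integral_mult_right[OF this, of "of_real (kernel_coeff n k)"] show ?thesis using False by simp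
  qed
  have "((\<lambda>u. \<Sum>k\<le>2 * n. of_real (kernel_coeff n k) * cis ((real k - real n) * u)) has_integral
      (\<Sum>k\<le>2 * n. if k = n then 2 * of_real pi else 0)) {- pi..pi}"
    by (intro has_integral_sum entry) auto
  then have "((\<lambda>u. complex_of_real (cos_kernel n u)) has_integral of_real (2 * pi)) {- pi..pi}"
    unfolding cos_kernel_fourier[symmetric] by (simp add: sum.delta)
  then have "((\<lambda>u. Re (complex_of_real (cos_kernel n u))) has_integral Re (of_real (2 * pi))) {- pi..pi}"
    by (rule has_integral_Re)
  then show ?thesis by simp
qed

text \<open>The kernel is even, decreases on \<open>[0, pi]\<close> and has mean value 1 there.
  Either it is at least 1 on all of \<open>[0, m]\<close>, or it is at most 1 on
  \<open>[m, pi]\<close>, so that at most \<open>pi - m\<close> of its mass lies outside. This is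
  uniform in \<open>n\<close> without any asymptotics.\<close>

lemma integral_cos_kernel_ge:
  assumes m: "0 \<le> m" "m \<le> pi"
  shows "2 * m \<le> integral {- m..m} (cos_kernel n)"
proof -
  let ?k = "cos_kernel n"
  have int: "?k integrable_on {a..b}" for a b
    by (intro integrable_continuous_interval continuous_intros)
  have refl: "integral {- a..0} ?k = integral {0..a} ?k" for a
    using Henstock_Kurzweil_Integration.integral_reflect_real[of "a" 0 "?k"] by simp
  have halves: "integral {- a..a} ?k = 2 * integral {0..a} ?k" if "a \<ge> 0" for a
    using Henstock_Kurzweil_Integration.integral_combine[of "- a" 0 a ?k] int that refl[of a] by simp
  have full: "integral {0..pi} ?k = pi"
    using halves[of pi] integral_unique[OF integral_cos_kernel_period[of n]] by simp
  have "m \<le> integral {0..m} ?k"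
  proof (cases "?k m \<ge> 1")
    case True
    have "integral {0..m} (\<lambda>_. 1) \<le> integral {0..m} ?k"
    proof (rule integral_le)
      show "1 \<le> ?k x" if "x \<in> {0..m}" for x
        using cos_kernel_antimono[of x m n] that m True by auto
    qed (auto intro: int)
    then show ?thesis using m by simp
  next
    case False
    have "integral {m..pi} ?k \<le> integral {m..pi} (\<lambda>_. 1)"
    proof (rule integral_le)
      show "?k x \<le> 1" if "x \<in> {m..pi}" for x
        using cos_kernel_antimono[of m x n] that m False by auto
    qed (auto intro: int)
    then have "integral {m..pi} ?k \<le> pi - m" using m by simp
    moreover have "integral {0..m} ?k + integral {m..pi} ?k = pi"
      using Henstock_Kurzweil_Integration.integral_combine[of 0 m pi ?k] int m full by simp
    ultimately show ?thesis by simp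
  qed
  then show ?thesis using halves[OF m(1)] by simp
qed

lemma integral_cos_kernel_affine_ge:
  assumes "\<mu> > 0" "m \<ge> 0" "\<mu> * m \<le> pi" "a \<le> u - m" "u + m \<le> b"
  shows "2 * m \<le> integral {a..b} (\<lambda>t. cos_kernel n (\<mu> * (u - t)))"
proof -
  let ?f = "\<lambda>t. cos_kernel n (\<mu> * (u - t))"
  have int: "?f integrable_on {a..b}" for a b
    by (intro integrable_continuous_interval continuous_intros)
  have eq: "?f t = cos_kernel n (\<mu> * t + (- \<mu> * u))" for t
    using cos_kernel_uminus[of n "\<mu> * (u - t)"] by (simp add: algebra_simps)
  have "(cos_kernel n has_integral integral {- (\<mu> * m)..\<mu> * m} (cos_kernel n)) (cbox (- (\<mu> * m)) (\<mu> * m))"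
    by (auto intro!: integrable_integral integrable_continuous_interval continuous_intros)
  from has_integral_affinity[OF this, of \<mu> "- \<mu> * u"] assms
  have "(?f has_integral (integral {- (\<mu> * m)..\<mu> * m} (cos_kernel n) / \<mu>))
     ((\<lambda>x. (1 / \<mu>) *\<^sub>R x + - ((1 / \<mu>) *\<^sub>R (- \<mu> * u))) ` cbox (- (\<mu> * m)) (\<mu> * m))"
    unfolding eq by (simp add: divide_inverse mult.commute)
  also have "(\<lambda>x. (1 / \<mu>) *\<^sub>R x + - ((1 / \<mu>) *\<^sub>R (- \<mu> * u))) ` cbox (- (\<mu> * m)) (\<mu> * m) = {u - m..u + m}"
    using assms(1,2) image_affinity_cbox[of "1 / \<mu>" u "- (\<mu> * m)" "\<mu> * m"] by simp
  finally have "integral {u - m..u + m} ?f = integral {- (\<mu> * m)..\<mu> * m} (cos_kernel n) / \<mu>"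
    by (rule integral_unique)
  also have "\<dots> \<ge> 2 * (\<mu> * m) / \<mu>"
    using assms by (intro divide_right_mono integral_cos_kernel_ge) auto
  finally have "2 * m \<le> integral {u - m..u + m} ?f" using assms(1) by simp
  also have "\<dots> \<le> integral {a..b} ?f"
    using assms(4,5) by (intro integral_subset_le int) (auto simp: cos_kernel_nonneg)
  finally show ?thesis .
qed

lemma exists_ge_average:
  fixes f :: "real \<Rightarrow> real"
  assumes "continuous_on {a..b} f" "a \<le> b" "c * (b - a) \<le> integral {a..b} f" "a < b"
  shows "\<exists>t\<in>{a..b}. c \<le> f t"
proof -
  obtain t where t: "t \<in> {a..b}" "\<And>s. s \<in> {a..b} \<Longrightarrow> f s \<le> f t"
    using continuous_attains_sup[of "{a..b}" f] assms by auto
  have "integral {a..b} f \<le> integral {a..b} (\<lambda>_. f t)"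
    using t assms by (intro integral_le integrable_continuous_interval) auto
  then have "integral {a..b} f \<le> f t * (b - a)" using assms by (simp add: mult.commute)
  with assms(3) have "c * (b - a) \<le> f t * (b - a)" by (rule order_trans)
  then show ?thesis using t assms(4) by auto
qed

lemma card_near_le:
  fixes S :: "nat set"
  assumes R: "R \<ge> 0"
  shows "real (card {k \<in> S. \<bar>real k - c\<bar> \<le> R}) \<le> 2 * R + 1"
proof -
  let ?T = "{\<lceil>c - R\<rceil>..\<lfloor>c + R\<rfloor>}"
  have "int ` {k \<in> S. \<bar>real k - c\<bar> \<le> R} \<subseteq> ?T"
    by (auto simp: ceiling_le_iff le_floor_iff abs_le_iff)
  then have "card (int ` {k \<in> S. \<bar>real k - c\<bar> \<le> R}) \<le> card ?T" by (intro card_mono) auto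
  then have "card {k \<in> S. \<bar>real k - c\<bar> \<le> R} \<le> card ?T" by (simp add: card_image)
  also have "real (card ?T) \<le> 2 * R + 1"
    using R by (simp add: of_nat_nat le_floor_iff) linarith
  finally show ?thesis by simp
qed

subsection \<open>Shapes of triangles\<close>

definition shape1 :: "real \<Rightarrow> real \<Rightarrow> 'a::euclidean_space \<Rightarrow> 'a \<Rightarrow> 'a \<Rightarrow> real" where
  "shape1 \<alpha> \<gamma> x y z = (norm (z - x - \<alpha> *\<^sub>R (y - x)))\<^sup>2 - \<gamma> * (norm (y - x))\<^sup>2"

definition shape2 :: "real \<Rightarrow> 'a::euclidean_space \<Rightarrow> 'a \<Rightarrow> 'a \<Rightarrow> real" where
  "shape2 \<alpha> x y z = (y - x) \<bullet> (z - x - \<alpha> *\<^sub>R (y - x))"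

text \<open>The pair \<open>(W, M)\<close> of \<open>tri_phase\<close>. It is linear in
  \<open>(x, y)\<close>, so the phase becomes quadratic in the pair.\<close>

definition chart :: "real \<Rightarrow> real \<Rightarrow> 'a::euclidean_space \<times> 'a \<Rightarrow> 'a \<times> 'a" where
  "chart \<alpha> \<gamma> p = (sqrt \<gamma> *\<^sub>R (snd p - fst p), (1 - \<alpha>) *\<^sub>R fst p + \<alpha> *\<^sub>R snd p)"

lemma tri_phase_chart:
  assumes "\<gamma> \<ge> 0"
  shows "tri_phase \<zeta> z (chart \<alpha> \<gamma> p) =
    Re \<zeta> * shape1 \<alpha> \<gamma> (fst p) (snd p) z + 2 * sqrt \<gamma> * Im \<zeta> * shape2 \<alpha> (fst p) (snd p) z"
proof -
  have "z - ((1 - \<alpha>) *\<^sub>R fst p + \<alpha> *\<^sub>R snd p) = z - fst p - \<alpha> *\<^sub>R (snd p - fst p)" by (simp add: algebra_simps)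
  then have "tri_phase \<zeta> z (chart \<alpha> \<gamma> p) = Re \<zeta> * ((norm (z - fst p - \<alpha> *\<^sub>R (snd p - fst p)))\<^sup>2 - (norm (sqrt \<gamma> *\<^sub>R (snd p - fst p)))\<^sup>2) +
      2 * Im \<zeta> * ((sqrt \<gamma> *\<^sub>R (snd p - fst p)) \<bullet> (z - fst p - \<alpha> *\<^sub>R (snd p - fst p)))"
    by (simp only: tri_phase_def chart_def fst_conv snd_conv)
  then show ?thesis
    using assms by (simp add: shape1_def shape2_def power_mult_distrib)
qed

text \<open>For a bounded \<open>\<alpha>\<close> and \<open>\<gamma> >= g\<close> the chart has an
  inverse that is bounded uniformly in the shape: \<open>u\<close> recovers \<open>y - x\<close>
  from the first component of \<open>Y\<close>, and then \<open>x = snd Y - \<alpha> u\<close>,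
  \<open>y = snd Y + (1 - \<alpha>) u\<close>. \<open>B\<close> bounds the error in each of the two
  points.\<close>

lemma chart_lower:
  assumes \<alpha>: "\<bar>\<alpha>\<bar> \<le> a0" and \<gamma>: "0 < g" "g \<le> \<gamma>"
  defines "\<kappa> \<equiv> 1 / (2 * (1 + (1 + a0) / sqrt g)\<^sup>2)"
  shows "\<exists>x y. \<forall>p. \<kappa> * ((norm (fst p - x))\<^sup>2 + (norm (snd p - y))\<^sup>2) \<le> (norm (Y - chart \<alpha> \<gamma> p))\<^sup>2"
proof -
  define u where "u = (1 / sqrt \<gamma>) *\<^sub>R fst Y"
  define B where "B = 1 + (1 + a0) / sqrt g"
  have B: "B > 0" using \<alpha> \<gamma> by (simp add: B_def add_pos_nonneg)
  have "\<kappa> * ((norm (fst p - (snd Y - \<alpha> *\<^sub>R u)))\<^sup>2 + (norm (snd p - (snd Y + (1 - \<alpha>) *\<^sub>R u)))\<^sup>2) \<le> (norm (Y - chart \<alpha> \<gamma> p))\<^sup>2" for p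
  proof -
    define D where "D = norm (Y - chart \<alpha> \<gamma> p)"
    define e where "e = u - (snd p - fst p)"
    define f where "f = snd Y - ((1 - \<alpha>) *\<^sub>R fst p + \<alpha> *\<^sub>R snd p)"
    have D0: "D \<ge> 0" by (simp add: D_def)
    define V where "V = Y - chart \<alpha> \<gamma> p"
    have VD: "norm V = D" by (simp add: V_def D_def)
    have "norm (snd V) \<le> D" using norm_snd_le[of "snd V" "fst V"] unfolding prod.collapse VD .
    then have f: "norm f \<le> D" by (simp add: f_def V_def chart_def)
    have "sqrt \<gamma> * norm e = norm (fst (Y - chart \<alpha> \<gamma> p))"
    proof -
      have "sqrt \<gamma> *\<^sub>R e = fst (Y - chart \<alpha> \<gamma> p)" using \<gamma> by (simp add: e_def u_def chart_def scaleR_diff_right)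
      then show ?thesis using \<gamma> by (metis abs_of_nonneg norm_scaleR real_sqrt_ge_zero less_imp_le order_trans)
    qed
    also have "\<dots> \<le> D" using norm_fst_le[of "fst V" "snd V"] unfolding prod.collapse VD unfolding V_def .
    finally have "sqrt \<gamma> * norm e \<le> D" .
    moreover have "sqrt g * norm e \<le> sqrt \<gamma> * norm e" using \<gamma> by (intro mult_right_mono) auto
    ultimately have e: "norm e \<le> D / sqrt g" using \<gamma> by (simp add: field_simps)
    have bd: "norm (f + c *\<^sub>R e) \<le> B * D" if "\<bar>c\<bar> \<le> 1 + a0" for c
    proof -
      have "norm (f + c *\<^sub>R e) \<le> norm f + \<bar>c\<bar> * norm e" by (metis norm_triangle_ineq norm_scaleR)
      also have "\<dots> \<le> D + (1 + a0) * (D / sqrt g)" using f e that \<alpha> by (intro add_mono mult_mono) auto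
      finally show ?thesis by (simp add: B_def algebra_simps)
    qed
    have "norm (fst p - (snd Y - \<alpha> *\<^sub>R u)) = norm (f + (- \<alpha>) *\<^sub>R e)"
      by (subst norm_minus_commute) (simp add: e_def f_def algebra_simps)
    also have "\<dots> \<le> B * D" using \<alpha> by (intro bd) auto
    finally have 1: "(norm (fst p - (snd Y - \<alpha> *\<^sub>R u)))\<^sup>2 \<le> (B * D)\<^sup>2" by (intro power_mono) auto
    have "norm (snd p - (snd Y + (1 - \<alpha>) *\<^sub>R u)) = norm (f + (1 - \<alpha>) *\<^sub>R e)"
      by (subst norm_minus_commute) (simp add: e_def f_def algebra_simps)
    also have "\<dots> \<le> B * D" using \<alpha> by (intro bd) auto
    finally have 2: "(norm (snd p - (snd Y + (1 - \<alpha>) *\<^sub>R u)))\<^sup>2 \<le> (B * D)\<^sup>2" by (intro power_mono) auto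
    have "\<kappa> * ((norm (fst p - (snd Y - \<alpha> *\<^sub>R u)))\<^sup>2 + (norm (snd p - (snd Y + (1 - \<alpha>) *\<^sub>R u)))\<^sup>2) \<le> \<kappa> * (2 * (B * D)\<^sup>2)"
      using 1 2 unfolding \<kappa>_def by (intro mult_left_mono) auto
    also have "\<dots> = D\<^sup>2" using B unfolding \<kappa>_def B_def[symmetric] by (simp add: power_mult_distrib)
    finally show ?thesis by (simp add: D_def)
  qed
  then show ?thesis by blast
qed

text \<open>After \<open>chart_lower\<close> the Gaussian on pairs is dominated by a product of
  Gaussians in x and in y, so the exponents of the two Frostman bounds add up. The constant stays
  uniform over the box of shapes.\<close>

lemma chart_frostman:
  fixes P Q :: "'a::euclidean_space set"
  assumes fin: "finite P" "finite Q" and a: "\<And>p. a p \<ge> (0::real)" and b: "\<And>p. b p \<ge> (0::real)"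
    and froP: "\<And>y \<Lambda>. 0 < \<Lambda> \<Longrightarrow> \<Lambda> \<le> L \<Longrightarrow> (\<Sum>p\<in>P. a p * exp (- \<Lambda> * (norm (p - y))\<^sup>2)) \<le> C * \<Lambda> powr (- s / 2)"
    and froQ: "\<And>y \<Lambda>. 0 < \<Lambda> \<Longrightarrow> \<Lambda> \<le> L \<Longrightarrow> (\<Sum>p\<in>Q. b p * exp (- \<Lambda> * (norm (p - y))\<^sup>2)) \<le> C * \<Lambda> powr (- s / 2)"
    and C: "C \<ge> 0" and \<alpha>: "\<bar>\<alpha>\<bar> \<le> a0" and \<gamma>: "0 < g" "g \<le> \<gamma>" and \<Lambda>: "0 < \<Lambda>" "\<Lambda> \<le> L"
  defines "\<kappa> \<equiv> 1 / (2 * (1 + (1 + a0) / sqrt g)\<^sup>2)"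
  shows "(\<Sum>i\<in>P \<times> Q. a (fst i) * b (snd i) * exp (- \<Lambda> * (norm (Y - chart \<alpha> \<gamma> i))\<^sup>2)) \<le> C\<^sup>2 * \<kappa> powr - s * \<Lambda> powr - s"
proof -
  obtain x y where xy: "\<And>p. \<kappa> * ((norm (fst p - x))\<^sup>2 + (norm (snd p - y))\<^sup>2) \<le> (norm (Y - chart \<alpha> \<gamma> p))\<^sup>2"
    using chart_lower[OF \<alpha> \<gamma>, of Y] unfolding \<kappa>_def by blast
  have "1 + (1 + a0) / sqrt g \<ge> 1" using \<alpha> \<gamma> by simp
  then have "(1 + (1 + a0) / sqrt g)\<^sup>2 \<ge> 1" by (rule one_le_power)
  then have \<kappa>: "0 < \<kappa>" "\<kappa> \<le> 1" unfolding \<kappa>_def by (auto simp: divide_le_eq)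
  have \<kappa>\<Lambda>: "0 < \<kappa> * \<Lambda>" "\<kappa> * \<Lambda> \<le> L"
    using \<kappa> \<Lambda> mult_right_mono[of \<kappa> 1 \<Lambda>] by (simp, linarith)
  have "(\<Sum>i\<in>P \<times> Q. a (fst i) * b (snd i) * exp (- \<Lambda> * (norm (Y - chart \<alpha> \<gamma> i))\<^sup>2)) \<le>
    (\<Sum>i\<in>P \<times> Q. (a (fst i) * exp (- (\<kappa> * \<Lambda>) * (norm (fst i - x))\<^sup>2)) * (b (snd i) * exp (- (\<kappa> * \<Lambda>) * (norm (snd i - y))\<^sup>2)))"
  proof (intro sum_mono)
    fix i
    have "\<Lambda> * (\<kappa> * ((norm (fst i - x))\<^sup>2 + (norm (snd i - y))\<^sup>2)) \<le> \<Lambda> * (norm (Y - chart \<alpha> \<gamma> i))\<^sup>2"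
      using \<Lambda> by (intro mult_left_mono xy) auto
    then have "exp (- \<Lambda> * (norm (Y - chart \<alpha> \<gamma> i))\<^sup>2) \<le>
      exp (- (\<kappa> * \<Lambda>) * (norm (fst i - x))\<^sup>2) * exp (- (\<kappa> * \<Lambda>) * (norm (snd i - y))\<^sup>2)"
      unfolding exp_add[symmetric] by (simp add: algebra_simps)
    then have "a (fst i) * b (snd i) * exp (- \<Lambda> * (norm (Y - chart \<alpha> \<gamma> i))\<^sup>2) \<le>
      a (fst i) * b (snd i) * (exp (- (\<kappa> * \<Lambda>) * (norm (fst i - x))\<^sup>2) * exp (- (\<kappa> * \<Lambda>) * (norm (snd i - y))\<^sup>2))"
      using a b by (intro mult_left_mono) auto
    then show "a (fst i) * b (snd i) * exp (- \<Lambda> * (norm (Y - chart \<alpha> \<gamma> i))\<^sup>2) \<le>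
      (a (fst i) * exp (- (\<kappa> * \<Lambda>) * (norm (fst i - x))\<^sup>2)) * (b (snd i) * exp (- (\<kappa> * \<Lambda>) * (norm (snd i - y))\<^sup>2))"
      by (simp only: mult_ac)
  qed
  also have "\<dots> = (\<Sum>p\<in>P. a p * exp (- (\<kappa> * \<Lambda>) * (norm (p - x))\<^sup>2)) * (\<Sum>q\<in>Q. b q * exp (- (\<kappa> * \<Lambda>) * (norm (q - y))\<^sup>2))"
    by (simp add: sum_product sum.cartesian_product' del: mult_minus_left)
  also have "\<dots> \<le> (C * (\<kappa> * \<Lambda>) powr (- s / 2)) * (C * (\<kappa> * \<Lambda>) powr (- s / 2))"
    using C a b by (intro mult_mono froP froQ \<kappa>\<Lambda>) (auto intro!: sum_nonneg)
  also have "\<dots> = C\<^sup>2 * ((\<kappa> * \<Lambda>) powr (- s / 2) * (\<kappa> * \<Lambda>) powr (- s / 2))" by (simp add: power2_eq_square)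
  also have "(\<kappa> * \<Lambda>) powr (- s / 2) * (\<kappa> * \<Lambda>) powr (- s / 2) = \<kappa> powr - s * \<Lambda> powr - s"
    by (subst powr_add[symmetric]) (use \<kappa> \<Lambda> in \<open>simp add: powr_mult\<close>)
  finally show ?thesis by (simp only: mult.assoc)
qed

lemma grid_card_near:
  fixes S :: "(nat \<times> nat) set" and n \<delta> \<delta>' \<rho> :: real
  assumes S: "finite S" and \<delta>: "\<delta> > 0" "\<delta>' > 0" and \<rho>: "\<rho> \<ge> 1"
  defines "f \<equiv> \<lambda>q. Complex (\<delta> * (real (fst q) - n)) (\<delta>' * (real (snd q) - n))"
  shows "real (card {\<zeta> \<in> f ` S. norm (\<zeta> - \<eta>) \<le> \<rho>}) \<le> (2 / \<delta> + 1) * (2 / \<delta>' + 1) * \<rho>\<^sup>2"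
proof -
  let ?A = "{k \<in> fst ` S. \<bar>real k - (n + Re \<eta> / \<delta>)\<bar> \<le> \<rho> / \<delta>}"
  let ?B = "{k \<in> snd ` S. \<bar>real k - (n + Im \<eta> / \<delta>')\<bar> \<le> \<rho> / \<delta>'}"
  have sub: "{\<zeta> \<in> f ` S. norm (\<zeta> - \<eta>) \<le> \<rho>} \<subseteq> f ` (?A \<times> ?B)"
  proof
    fix \<zeta> assume "\<zeta> \<in> {\<zeta> \<in> f ` S. norm (\<zeta> - \<eta>) \<le> \<rho>}"
    then obtain q where q: "q \<in> S" "\<zeta> = f q" "norm (f q - \<eta>) \<le> \<rho>" by auto
    have "\<bar>\<delta> * (real (fst q) - n) - Re \<eta>\<bar> \<le> \<rho>" "\<bar>\<delta>' * (real (snd q) - n) - Im \<eta>\<bar> \<le> \<rho>"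
      using abs_Re_le_cmod[of "f q - \<eta>"] abs_Im_le_cmod[of "f q - \<eta>"] q(3) by (auto simp: f_def)
    moreover have "\<bar>\<delta> * (real (fst q) - n) - Re \<eta>\<bar> = \<delta> * \<bar>real (fst q) - (n + Re \<eta> / \<delta>)\<bar>"
    proof -
      have "\<delta> * (real (fst q) - n) - Re \<eta> = \<delta> * (real (fst q) - (n + Re \<eta> / \<delta>))" using \<delta> by (simp add: field_simps)
      then show ?thesis using \<delta> by (simp only: abs_mult abs_of_pos)
    qed
    moreover have "\<bar>\<delta>' * (real (snd q) - n) - Im \<eta>\<bar> = \<delta>' * \<bar>real (snd q) - (n + Im \<eta> / \<delta>')\<bar>"
    proof -
      have "\<delta>' * (real (snd q) - n) - Im \<eta> = \<delta>' * (real (snd q) - (n + Im \<eta> / \<delta>'))" using \<delta> by (simp add: field_simps)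
      then show ?thesis using \<delta> by (simp only: abs_mult abs_of_pos)
    qed
    ultimately have "q \<in> ?A \<times> ?B"
      using q(1) \<delta> by (cases q) (auto simp: pos_le_divide_eq mult.commute intro: rev_image_eqI)
    then show "\<zeta> \<in> f ` (?A \<times> ?B)" using q(2) by blast
  qed
  have "card {\<zeta> \<in> f ` S. norm (\<zeta> - \<eta>) \<le> \<rho>} \<le> card (f ` (?A \<times> ?B))"
    using S by (intro card_mono[OF _ sub]) auto
  also have "\<dots> \<le> card (?A \<times> ?B)" using S by (intro card_image_le) auto
  also have "\<dots> = card ?A * card ?B" by (rule card_cartesian_product)
  finally have "real (card {\<zeta> \<in> f ` S. norm (\<zeta> - \<eta>) \<le> \<rho>}) \<le> real (card ?A * card ?B)" by (simp only: of_nat_le_iff)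
  also have "\<dots> = real (card ?A) * real (card ?B)" by (rule of_nat_mult)
  also have "\<dots> \<le> (2 * (\<rho> / \<delta>) + 1) * (2 * (\<rho> / \<delta>') + 1)"
    using \<delta> \<rho> by (intro mult_mono card_near_le) auto
  also have "\<dots> \<le> ((2 / \<delta> + 1) * \<rho>) * ((2 / \<delta>' + 1) * \<rho>)"
    using \<delta> \<rho> by (intro mult_mono) (auto simp: algebra_simps)
  finally show ?thesis by (simp add: power2_eq_square mult_ac)
qed

text \<open>\<open>lev \<zeta>\<close> is the index of the dyadic annulus containing
  \<open>\<zeta>\<close>. The bounds of \<open>annulus_bound\<close> form, after square roots, a
  geometric series of ratio \<open>2 powr (- \<eta> / 4)\<close>, so the first annulus determines
  the size.\<close>

lemma high_frequency_bound:
  fixes Z :: "complex set" and X0 :: "'a::euclidean_space \<times> 'a" and X :: "'i \<Rightarrow> 'a \<times> 'a"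
  assumes Z: "finite Z" "\<And>\<zeta>. \<zeta> \<in> Z \<Longrightarrow> r0 \<le> norm \<zeta> \<and> (norm \<zeta>)\<^sup>2 \<le> L"
    and cnt: "\<And>\<eta> \<rho>. \<rho> \<ge> 1 \<Longrightarrow> real (card {\<zeta> \<in> Z. norm (\<zeta> - \<eta>) \<le> \<rho>}) \<le> CZ * \<rho>\<^sup>2"
    and \<kappa>: "\<And>\<zeta>. \<zeta> \<in> Z \<Longrightarrow> norm (\<kappa> \<zeta> :: complex) \<le> 1"
    and I: "finite I" "\<And>i. i \<in> I \<Longrightarrow> A i \<ge> 0" "sum A I \<le> 1"
    and froI: "\<And>Y \<Lambda>. 0 < \<Lambda> \<Longrightarrow> \<Lambda> \<le> L \<Longrightarrow> (\<Sum>i\<in>I. A i * exp (- \<Lambda> * (norm (Y - X i))\<^sup>2)) \<le> CI * \<Lambda> powr - s"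
    and near: "\<And>i. i \<in> I \<Longrightarrow> norm (X i - X0) \<le> \<rho>"
    and K: "finite K" "\<And>k. k \<in> K \<Longrightarrow> c k \<ge> (0::real)" "sum c K \<le> 1"
    and fro: "\<And>y \<Lambda>. 0 < \<Lambda> \<Longrightarrow> \<Lambda> \<le> L \<Longrightarrow> (\<Sum>k\<in>K. c k * exp (- \<Lambda> * (norm (z k - y))\<^sup>2)) \<le> CF * \<Lambda> powr (- s / 2)"
    and indep: "\<And>k a b. k \<in> K \<Longrightarrow> c0 * (a\<^sup>2 + b\<^sup>2) \<le> (norm (a *\<^sub>R fst X0 + b *\<^sub>R (z k - snd X0)))\<^sup>2"
    and H: "\<And>k. k \<in> K \<Longrightarrow> norm X0 + norm (z k) \<le> H"
    and s: "0 \<le> s" "s \<le> DIM('a)" and c0: "c0 > 0"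
    and B0: "B0 = 64 + 4 / c0" and \<eta>: "\<eta> = 3 * s - 2 * real DIM('a) - 2" "\<eta> > 0"
    and \<rho>: "16 * B0 * \<rho>\<^sup>2 \<le> \<eta>" and r0: "r0 \<ge> 8 * B0" and Cpos: "CI \<ge> 0" "CF \<ge> 0"
  shows "norm (\<Sum>i\<in>I. of_real (A i) * (\<Sum>\<zeta>\<in>Z. \<kappa> \<zeta> * (\<Sum>k\<in>K. of_real (c k) * cis (tri_phase \<zeta> (z k) (X i))))) \<le>
    sqrt (2 ^ DIM('a) * exp (64 * H\<^sup>2) * CI * 2 powr s * exp (\<eta> / 4) * CF * 32 * CZ\<^sup>2 * B0\<^sup>2 * (1 + 8 / \<eta>)\<^sup>2) *
      r0 powr (- \<eta> / 4) / (1 - 2 powr (- \<eta> / 4))"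
proof -
  define C where "C = 2 ^ DIM('a) * exp (64 * H\<^sup>2) * CI * 2 powr s * exp (\<eta> / 4) * CF * 32 * CZ\<^sup>2 * B0\<^sup>2 * (1 + 8 / \<eta>)\<^sup>2"
  have C0: "C \<ge> 0" unfolding C_def using Cpos by (intro mult_nonneg_nonneg) auto
  define q where "q = 2 powr (- \<eta> / 4)"
  have q: "0 < q" "q < 1" using \<eta> by (auto simp: q_def powr_less_one)
  have r0p: "r0 > 0" using r0 B0 c0 by (smt (verit) divide_pos_pos)
  let ?F = "\<lambda>i \<zeta>. \<kappa> \<zeta> * (\<Sum>k\<in>K. of_real (c k) * cis (tri_phase \<zeta> (z k) (X i)))"
  define lev where "lev = (\<lambda>\<zeta>::complex. nat \<lfloor>log 2 (norm \<zeta> / r0)\<rfloor>)"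
  let ?Z = "\<lambda>j. {\<zeta> \<in> Z. lev \<zeta> = j}"
  have levZ: "r0 * 2 ^ lev \<zeta> \<le> norm \<zeta> \<and> norm \<zeta> \<le> 2 * (r0 * 2 ^ lev \<zeta>)" if "\<zeta> \<in> Z" for \<zeta>
  proof -
    have n: "norm \<zeta> / r0 \<ge> 1" using Z(2)[OF that] r0p by (simp add: field_simps)
    then have "log 2 (norm \<zeta> / r0) \<ge> 0" by simp
    then have j: "real (lev \<zeta>) \<le> log 2 (norm \<zeta> / r0)" "log 2 (norm \<zeta> / r0) < real (lev \<zeta>) + 1"
      unfolding lev_def by (auto simp: of_nat_nat)
    have "2 ^ lev \<zeta> \<le> norm \<zeta> / r0" using j(1) n by (simp add: le_log_iff powr_realpow)
    moreover have "norm \<zeta> / r0 < 2 powr (real (lev \<zeta>) + 1)" using j(2) n by (simp add: log_less_iff)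
    then have "norm \<zeta> / r0 < 2 ^ lev \<zeta> * 2" by (simp add: powr_add powr_realpow)
    ultimately show ?thesis using r0p by (simp add: field_simps)
  qed
  have ann: "norm (\<Sum>i\<in>I. of_real (A i) * (\<Sum>\<zeta>\<in>?Z j. ?F i \<zeta>)) \<le> sqrt C * r0 powr (- \<eta> / 4) * q ^ j" for j
  proof (cases "?Z j = {}")
    case True
    then have "(\<Sum>i\<in>I. of_real (A i) * (\<Sum>\<zeta>\<in>?Z j. ?F i \<zeta>)) = 0" by (simp only: sum.empty mult_zero_right sum.neutral_const)
    then show ?thesis using C0 q by simp
  next
    case False
    \<comment> \<open>A frequency in the annulus certifies that its inner radius is an admissible
      scale, \<open>?r^2 <= L\<close>; an empty annulus need not satisfy this.\<close>
    then obtain \<zeta>0 where \<zeta>0: "\<zeta>0 \<in> Z" "lev \<zeta>0 = j" by blast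
    let ?r = "r0 * 2 ^ j"
    have r2: "?r\<^sup>2 \<le> L"
      using levZ[OF \<zeta>0(1)] Z(2)[OF \<zeta>0(1)] \<zeta>0(2) r0p by (meson order_trans power_mono mult_nonneg_nonneg less_imp_le zero_less_power zero_less_numeral)
    have "r0 * 1 \<le> r0 * 2 ^ j" using r0p by (intro mult_left_mono one_le_power) auto
    then have rB: "?r \<ge> 8 * B0" using r0 by linarith
    have cntj: "real (card {\<zeta> \<in> ?Z j. norm (\<zeta> - \<eta>) \<le> \<rho>}) \<le> CZ * \<rho>\<^sup>2" if "\<rho> \<ge> 1" for \<eta> \<rho>
    proof -
      have "card {\<zeta> \<in> ?Z j. norm (\<zeta> - \<eta>) \<le> \<rho>} \<le> card {\<zeta> \<in> Z. norm (\<zeta> - \<eta>) \<le> \<rho>}"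
        using Z(1) by (intro card_mono) auto
      then show ?thesis using cnt[OF that, of \<eta>] by linarith
    qed
    have "(norm (\<Sum>i\<in>I. of_real (A i) * (\<Sum>\<zeta>\<in>?Z j. ?F i \<zeta>)))\<^sup>2 \<le> C * ?r powr (- \<eta> / 2)"
      unfolding C_def
      by (rule annulus_bound[OF _ _ cntj _ I froI near K fro indep H s c0 B0 \<eta> \<rho> rB r2])
        (use Z(1) levZ \<kappa> in auto)
    also have "\<dots> = (sqrt C * r0 powr (- \<eta> / 4) * q ^ j)\<^sup>2"
    proof -
      have "(2 ^ j) powr (- \<eta> / 4) = q ^ j"
        unfolding q_def by (simp add: powr_realpow[symmetric] powr_powr mult.commute)
      then have "?r powr (- \<eta> / 4) = r0 powr (- \<eta> / 4) * q ^ j" using r0p by (simp add: powr_mult)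
      moreover have "?r powr (- \<eta> / 2) = (?r powr (- \<eta> / 4))\<^sup>2" by (simp add: power2_eq_square powr_add[symmetric])
      ultimately show ?thesis using C0 by (simp add: power_mult_distrib)
    qed
    finally show ?thesis by (rule power2_le_imp_le) (use C0 q in auto)
  qed
  define m where "m = Max (insert 0 (lev ` Z))"
  have "lev ` Z \<subseteq> {..m}" unfolding m_def using Z(1) by auto
  then have grp: "(\<Sum>\<zeta>\<in>Z. ?F i \<zeta>) = (\<Sum>j\<le>m. \<Sum>\<zeta>\<in>?Z j. ?F i \<zeta>)" for i
    using Z(1) by (intro sum.group[symmetric]) auto
  have "(\<Sum>i\<in>I. of_real (A i) * (\<Sum>\<zeta>\<in>Z. ?F i \<zeta>)) = (\<Sum>i\<in>I. \<Sum>j\<le>m. of_real (A i) * (\<Sum>\<zeta>\<in>?Z j. ?F i \<zeta>))"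
    unfolding grp by (simp only: sum_distrib_left)
  also have "\<dots> = (\<Sum>j\<le>m. \<Sum>i\<in>I. of_real (A i) * (\<Sum>\<zeta>\<in>?Z j. ?F i \<zeta>))" by (rule sum.swap)
  also have "norm \<dots> \<le> (\<Sum>j\<le>m. sqrt C * r0 powr (- \<eta> / 4) * q ^ j)"
    by (intro sum_norm_le ann)
  also have "\<dots> = sqrt C * r0 powr (- \<eta> / 4) * (\<Sum>j\<le>m. q ^ j)" by (simp only: sum_distrib_left)
  also have "\<dots> \<le> sqrt C * r0 powr (- \<eta> / 4) * (1 / (1 - q))"
  proof (intro mult_left_mono)
    have "(\<Sum>j\<le>m. q ^ j) \<le> (\<Sum>j. q ^ j)" using q by (intro sum_le_suminf summable_geometric) auto
    also have "\<dots> = 1 / (1 - q)" using q by (intro suminf_geometric) auto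
    finally show "(\<Sum>j\<le>m. q ^ j) \<le> 1 / (1 - q)" .
  qed (use C0 in auto)
  finally show ?thesis unfolding C_def q_def by simp
qed

section \<open>Uniform bounds near a nondegenerate triangle\<close>

lemma eventually_less_isCont:
  fixes f :: "'a::t2_space \<Rightarrow> real"
  assumes "isCont f p" "f p < B"
  shows "\<forall>\<^sub>F q in nhds p. f q < B"
  using assms order_tendstoD(2)[of f "f p" "nhds p" B]
  by (simp add: isCont_def tendsto_at_iff_tendsto_nhds)

text \<open>For the orthogonal vectors \<open>W0\<close>, \<open>P0\<close> of length
  \<open>l\<close> the norm is exactly \<open>l * N\<close>; the two perturbations of size
  \<open>l / 4\<close> take away at most half of it.\<close>

lemma nearly_orthogonal_lower:
  fixes W P W0 P0 :: "'a::real_inner"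
  assumes orth: "W0 \<bullet> P0 = 0" and nW: "norm W0 = l" and nP: "norm P0 = l" and l: "l > 0"
    and near: "norm (W - W0) \<le> l / 4" "norm (P - P0) \<le> l / 4"
  shows "l\<^sup>2 / 4 * (a\<^sup>2 + b\<^sup>2) \<le> (norm (a *\<^sub>R W + b *\<^sub>R P))\<^sup>2"
proof -
  define N where "N = sqrt (a\<^sup>2 + b\<^sup>2)"
  have N: "N \<ge> 0" "\<bar>a\<bar> \<le> N" "\<bar>b\<bar> \<le> N" "N\<^sup>2 = a\<^sup>2 + b\<^sup>2"
    unfolding N_def by (auto simp: real_le_rsqrt)
  have "(norm (a *\<^sub>R W0 + b *\<^sub>R P0))\<^sup>2 = a\<^sup>2 * (norm W0)\<^sup>2 + b\<^sup>2 * (norm P0)\<^sup>2"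
    unfolding power2_norm_eq_inner using orth
    by (simp add: inner_simps inner_commute power2_eq_square algebra_simps)
  also have "\<dots> = (l * N)\<^sup>2" unfolding nW nP power_mult_distrib N(4) by (simp add: algebra_simps)
  finally have n0: "norm (a *\<^sub>R W0 + b *\<^sub>R P0) = l * N" using l N by (simp add: power2_eq_imp_eq)
  have "a *\<^sub>R W0 + b *\<^sub>R P0 = (a *\<^sub>R W + b *\<^sub>R P) - (a *\<^sub>R (W - W0) + b *\<^sub>R (P - P0))" by (simp add: algebra_simps)
  then have "l * N \<le> norm (a *\<^sub>R W + b *\<^sub>R P) + norm (a *\<^sub>R (W - W0) + b *\<^sub>R (P - P0))"
    unfolding n0[symmetric] by (metis norm_triangle_ineq4)
  moreover have "norm (a *\<^sub>R (W - W0) + b *\<^sub>R (P - P0)) \<le> \<bar>a\<bar> * norm (W - W0) + \<bar>b\<bar> * norm (P - P0)"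
    by (metis norm_triangle_ineq norm_scaleR)
  moreover have "\<dots> \<le> N * (l / 4) + N * (l / 4)"
    using N near l by (intro add_mono mult_mono) auto
  ultimately have "l * N / 2 \<le> norm (a *\<^sub>R W + b *\<^sub>R P)" by (simp add: algebra_simps)
  then have "(l * N / 2)\<^sup>2 \<le> (norm (a *\<^sub>R W + b *\<^sub>R P))\<^sup>2" using l N by (intro power_mono) auto
  then show ?thesis by (simp add: power_mult_distrib power_divide N(4))
qed

lemma dist_tuple5_le:
  "dist (a, b, x, y, z) (a', b', x', y', z') \<le> dist a a' + dist b b' + dist x x' + dist y y' + dist z z'"
proof -
  have p: "dist (u, v) (u', v') \<le> dist u u' + dist v v'" for u u' :: "'p::metric_space" and v v' :: "'q::metric_space"
    unfolding dist_Pair_Pair by (rule real_le_lsqrt) (auto simp: power2_sum)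
  have "dist (a, b, x, y, z) (a', b', x', y', z') \<le> dist a a' + dist (b, x, y, z) (b', x', y', z')" by (rule p)
  also have "dist (b, x, y, z) (b', x', y', z') \<le> dist b b' + dist (x, y, z) (x', y', z')" by (rule p)
  also have "dist (x, y, z) (x', y', z') \<le> dist x x' + dist (y, z) (y', z')" by (rule p)
  also have "dist (y, z) (y', z') \<le> dist y y' + dist z z'" by (rule p)
  finally show ?thesis by simp
qed

text \<open>The conjuncts serve different ends. Closeness in the chart, the quadratic lower bound
  and the bounds by \<open>H\<close> enter the frequency estimate. The bounds by 1 on both shape
  functions keep them near the peak at 0 of \<open>cos_kernel\<close>, which is periodic. The
  remaining conditions make the average over the box of shapes large.\<close>

definition triangle_bounds :: "'a::euclidean_space \<Rightarrow> 'a \<Rightarrow> real \<Rightarrow> real \<Rightarrow> real \<Rightarrow> real \<Rightarrow> real \<Rightarrow> real \<Rightarrow> real \<Rightarrow>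
    real \<Rightarrow> real \<Rightarrow> 'a \<Rightarrow> 'a \<Rightarrow> 'a \<Rightarrow> bool" where
  "triangle_bounds x0 y0 c0 \<epsilon> \<alpha>0 \<gamma>0 \<tau>a \<tau>g H \<alpha> \<gamma> x y z \<longleftrightarrow>
      norm (chart \<alpha> \<gamma> (x, y) - chart \<alpha> \<gamma> (x0, y0)) \<le> \<epsilon> \<and>
      (\<forall>a b. c0 * (a\<^sup>2 + b\<^sup>2) \<le> (norm (a *\<^sub>R fst (chart \<alpha> \<gamma> (x0, y0)) + b *\<^sub>R (z - snd (chart \<alpha> \<gamma> (x0, y0)))))\<^sup>2) \<and>
      norm (chart \<alpha> \<gamma> (x0, y0)) + norm z \<le> H \<and> norm (y - x) \<le> H \<and> norm (z - x) \<le> H \<and> \<bar>\<alpha>\<bar> \<le> H \<and> \<gamma> \<le> H \<and>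
      \<bar>shape1 \<alpha> \<gamma> x y z\<bar> \<le> 1 \<and> \<bar>shape2 \<alpha> x y z\<bar> \<le> 1 \<and> x \<noteq> y \<and>
      (norm (y - x))\<^sup>2 * \<tau>a \<le> 1 \<and> (norm (y - x))\<^sup>2 * \<tau>g \<le> 1 \<and>
      \<bar>((y - x) \<bullet> (z - x)) / (norm (y - x))\<^sup>2 - \<alpha>0\<bar> \<le> \<tau>a / 2 \<and>
      \<bar>(norm (z - x - \<alpha> *\<^sub>R (y - x)))\<^sup>2 / (norm (y - x))\<^sup>2 - \<gamma>0\<bar> \<le> \<tau>g / 2"

text \<open>All conditions are open and hold at the base triangle with its own shape.
  \<open>c0\<close> is chosen before \<open>\<epsilon>\<close> because the admissible size of
  \<open>\<epsilon>\<close> later depends on \<open>c0\<close> through \<open>B0\<close>.\<close>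

lemma triangle_neighbourhood:
  fixes x0 y0 z0 :: "'a::euclidean_space"
  assumes xy: "x0 \<noteq> y0" and nz: "\<And>t. z0 \<noteq> x0 + t *\<^sub>R (y0 - x0)"
  shows "\<exists>c0>0. \<forall>\<epsilon>>0. \<exists>\<alpha>0 \<gamma>0 \<tau>a \<tau>g \<rho> H. 0 < \<tau>a \<and> 0 < \<tau>g \<and> 2 * \<tau>g \<le> \<gamma>0 \<and> 0 < \<rho> \<and> \<rho> \<le> 1 / 2 \<and> 1 \<le> H \<and>
    (\<forall>\<alpha>\<in>{\<alpha>0 - \<tau>a..\<alpha>0 + \<tau>a}. \<forall>\<gamma>\<in>{\<gamma>0 - \<tau>g..\<gamma>0 + \<tau>g}. \<forall>x\<in>cball x0 \<rho>. \<forall>y\<in>cball y0 \<rho>. \<forall>z\<in>cball z0 \<rho>.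
      triangle_bounds x0 y0 c0 \<epsilon> \<alpha>0 \<gamma>0 \<tau>a \<tau>g H \<alpha> \<gamma> x y z)"
proof -
  \<comment> \<open>The shape of the base triangle: \<open>p0\<close> is the part of
    \<open>z0 - x0\<close> orthogonal to \<open>w0\<close>, nonzero by \<open>nz\<close>, so both
    shape functions vanish at the base point.\<close>
  define w0 where "w0 = y0 - x0"
  define \<alpha>0 where "\<alpha>0 = (w0 \<bullet> (z0 - x0)) / (norm w0)\<^sup>2"
  define p0 where "p0 = z0 - x0 - \<alpha>0 *\<^sub>R w0"
  define \<gamma>0 where "\<gamma>0 = (norm p0)\<^sup>2 / (norm w0)\<^sup>2"
  define l where "l = norm p0"
  have w0: "norm w0 > 0" using xy by (simp add: w0_def)
  have "p0 \<noteq> 0" using nz[of \<alpha>0] by (auto simp: p0_def w0_def algebra_simps)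
  then have l: "l > 0" by (simp add: l_def)
  have \<gamma>0: "\<gamma>0 > 0" using l w0 by (simp add: \<gamma>0_def l_def)
  have orth: "w0 \<bullet> p0 = 0"
    using w0 by (simp add: p0_def inner_diff_right \<alpha>0_def power2_norm_eq_inner)
  have nW: "norm (sqrt \<gamma>0 *\<^sub>R w0) = l"
    using w0 by (simp add: \<gamma>0_def real_sqrt_divide l_def)
  let ?pt = "(\<alpha>0, \<gamma>0, x0, y0, z0)"
  let ?al = "\<lambda>q::real \<times> real \<times> 'a \<times> 'a \<times> 'a. fst q" and ?ga = "\<lambda>q::real \<times> real \<times> 'a \<times> 'a \<times> 'a. fst (snd q)"
  let ?x = "\<lambda>q::real \<times> real \<times> 'a \<times> 'a \<times> 'a. fst (snd (snd q))" and ?y = "\<lambda>q::real \<times> real \<times> 'a \<times> 'a \<times> 'a. fst (snd (snd (snd q)))"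
  let ?z = "\<lambda>q::real \<times> real \<times> 'a \<times> 'a \<times> 'a. snd (snd (snd (snd q)))"
  show ?thesis
  proof (rule exI[of _ "l\<^sup>2 / 4"], intro conjI allI impI)
    show "l\<^sup>2 / 4 > 0" using l by simp
    fix \<epsilon> :: real assume \<epsilon>: "\<epsilon> > 0"
    define H where "H = norm (chart \<alpha>0 \<gamma>0 (x0, y0)) + norm z0 + norm w0 + norm (z0 - x0) + \<bar>\<alpha>0\<bar> + \<gamma>0 + 1"
    let ?X0 = "\<lambda>q. chart (?al q) (?ga q) (x0, y0)"
    have "\<forall>\<^sub>F q in nhds ?pt. norm (chart (?al q) (?ga q) (?x q, ?y q) - ?X0 q) < \<epsilon>"
      by (rule eventually_less_isCont) (use \<epsilon> in \<open>auto simp: chart_def intro!: continuous_intros\<close>)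
    moreover have "\<forall>\<^sub>F q in nhds ?pt. norm (fst (?X0 q) - sqrt \<gamma>0 *\<^sub>R w0) < l / 4"
      by (rule eventually_less_isCont) (use l in \<open>auto simp: chart_def w0_def intro!: continuous_intros\<close>)
    moreover have "\<forall>\<^sub>F q in nhds ?pt. norm ((?z q - snd (?X0 q)) - p0) < l / 4"
    proof (rule eventually_less_isCont)
      have "z0 - ((1 - \<alpha>0) *\<^sub>R x0 + \<alpha>0 *\<^sub>R y0) = p0" by (simp add: p0_def w0_def algebra_simps)
      then show "norm ((?z ?pt - snd (?X0 ?pt)) - p0) < l / 4" using l by (simp add: chart_def)
    qed (auto simp: chart_def intro!: continuous_intros)
    moreover have "\<forall>\<^sub>F q in nhds ?pt. norm (?X0 q) + norm (?z q) < H"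
      by (rule eventually_less_isCont)
        (use w0 \<gamma>0 in \<open>auto simp: chart_def H_def intro!: continuous_intros add_nonneg_pos add_nonneg_nonneg\<close>)
    moreover have "\<forall>\<^sub>F q in nhds ?pt. norm (?y q - ?x q) < H"
      by (rule eventually_less_isCont) (use \<gamma>0 in \<open>auto simp: H_def w0_def intro!: continuous_intros add_nonneg_pos add_nonneg_nonneg\<close>)
    moreover have "\<forall>\<^sub>F q in nhds ?pt. norm (?z q - ?x q) < H"
      by (rule eventually_less_isCont) (use \<gamma>0 in \<open>auto simp: H_def w0_def intro!: continuous_intros add_nonneg_pos add_nonneg_nonneg\<close>)
    moreover have "\<forall>\<^sub>F q in nhds ?pt. \<bar>?al q\<bar> < H"
      by (rule eventually_less_isCont) (use \<gamma>0 in \<open>auto simp: H_def w0_def intro!: continuous_intros add_nonneg_pos add_nonneg_nonneg\<close>)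
    moreover have "\<forall>\<^sub>F q in nhds ?pt. ?ga q < H"
      by (rule eventually_less_isCont) (use \<gamma>0 in \<open>auto simp: H_def w0_def intro!: continuous_intros add_nonneg_pos add_nonneg_nonneg\<close>)
    moreover have "\<forall>\<^sub>F q in nhds ?pt. \<bar>shape1 (?al q) (?ga q) (?x q) (?y q) (?z q)\<bar> < 1"
    proof (rule eventually_less_isCont)
      show "\<bar>shape1 (?al ?pt) (?ga ?pt) (?x ?pt) (?y ?pt) (?z ?pt)\<bar> < 1"
        using w0 by (simp add: shape1_def \<gamma>0_def flip: w0_def p0_def)
    qed (auto simp: shape1_def intro!: continuous_intros)
    moreover have "\<forall>\<^sub>F q in nhds ?pt. \<bar>shape2 (?al q) (?x q) (?y q) (?z q)\<bar> < 1"
    proof (rule eventually_less_isCont)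
      show "\<bar>shape2 (?al ?pt) (?x ?pt) (?y ?pt) (?z ?pt)\<bar> < 1"
        using orth by (simp add: shape2_def flip: w0_def p0_def)
    qed (auto simp: shape2_def intro!: continuous_intros)
    moreover have "\<forall>\<^sub>F q in nhds ?pt. - norm (?y q - ?x q) < 0"
      by (rule eventually_less_isCont) (use xy in \<open>auto intro!: continuous_intros\<close>)
    moreover have "\<forall>\<^sub>F q in nhds ?pt. (norm (?y q - ?x q))\<^sup>2 < (norm w0)\<^sup>2 + 1"
      by (rule eventually_less_isCont) (auto simp: w0_def intro!: continuous_intros)
    ultimately have "\<forall>\<^sub>F q in nhds ?pt. norm (chart (?al q) (?ga q) (?x q, ?y q) - ?X0 q) < \<epsilon> \<and>
        norm (fst (?X0 q) - sqrt \<gamma>0 *\<^sub>R w0) < l / 4 \<and> norm ((?z q - snd (?X0 q)) - p0) < l / 4 \<and>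
        norm (?X0 q) + norm (?z q) < H \<and> norm (?y q - ?x q) < H \<and> norm (?z q - ?x q) < H \<and> \<bar>?al q\<bar> < H \<and> ?ga q < H \<and>
        \<bar>shape1 (?al q) (?ga q) (?x q) (?y q) (?z q)\<bar> < 1 \<and> \<bar>shape2 (?al q) (?x q) (?y q) (?z q)\<bar> < 1 \<and>
        ?x q \<noteq> ?y q \<and> (norm (?y q - ?x q))\<^sup>2 < (norm w0)\<^sup>2 + 1"
      by eventually_elim auto
    then obtain d1 where d1: "d1 > 0" and P1: "\<And>q. dist q ?pt < d1 \<Longrightarrow> norm (chart (?al q) (?ga q) (?x q, ?y q) - ?X0 q) < \<epsilon> \<and>
        norm (fst (?X0 q) - sqrt \<gamma>0 *\<^sub>R w0) < l / 4 \<and> norm ((?z q - snd (?X0 q)) - p0) < l / 4 \<and>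
        norm (?X0 q) + norm (?z q) < H \<and> norm (?y q - ?x q) < H \<and> norm (?z q - ?x q) < H \<and> \<bar>?al q\<bar> < H \<and> ?ga q < H \<and>
        \<bar>shape1 (?al q) (?ga q) (?x q) (?y q) (?z q)\<bar> < 1 \<and> \<bar>shape2 (?al q) (?x q) (?y q) (?z q)\<bar> < 1 \<and>
        ?x q \<noteq> ?y q \<and> (norm (?y q - ?x q))\<^sup>2 < (norm w0)\<^sup>2 + 1"
      unfolding eventually_nhds_metric by blast
    have B: "(norm w0)\<^sup>2 + 1 > 0" by (simp add: add_nonneg_pos)
    \<comment> \<open>The order \<open>\<tau>g\<close>, \<open>\<tau>a\<close>,
      \<open>\<rho>\<close> avoids circularity: the quotient compared with \<open>\<gamma>0\<close>
      depends on \<open>\<alpha>\<close> but not on \<open>\<gamma>\<close>, so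
      \<open>\<tau>a\<close> may be shrunk after \<open>\<tau>g\<close>; the quotient compared with
      \<open>\<alpha>0\<close> depends on the points only, so \<open>\<rho>\<close> may be shrunk
      last.\<close>
    define \<tau>g where "\<tau>g = min (d1 / 8) (min (\<gamma>0 / 2) (1 / ((norm w0)\<^sup>2 + 1)))"
    have \<tau>g: "\<tau>g > 0" "\<tau>g \<le> d1 / 8" "2 * \<tau>g \<le> \<gamma>0" "((norm w0)\<^sup>2 + 1) * \<tau>g \<le> 1"
    proof -
      show "\<tau>g > 0" "\<tau>g \<le> d1 / 8" using d1 \<gamma>0 B by (simp_all add: \<tau>g_def)
      have "\<tau>g \<le> \<gamma>0 / 2" "\<tau>g \<le> 1 / ((norm w0)\<^sup>2 + 1)" unfolding \<tau>g_def by linarith+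
      then show "2 * \<tau>g \<le> \<gamma>0" "((norm w0)\<^sup>2 + 1) * \<tau>g \<le> 1" using B by (simp_all add: pos_le_divide_eq mult.commute)
    qed
    have "\<forall>\<^sub>F q in nhds ?pt. \<bar>(norm (?z q - ?x q - ?al q *\<^sub>R (?y q - ?x q)))\<^sup>2 / (norm (?y q - ?x q))\<^sup>2 - \<gamma>0\<bar> < \<tau>g / 2"
    proof (rule eventually_less_isCont)
      show "\<bar>(norm (?z ?pt - ?x ?pt - ?al ?pt *\<^sub>R (?y ?pt - ?x ?pt)))\<^sup>2 / (norm (?y ?pt - ?x ?pt))\<^sup>2 - \<gamma>0\<bar> < \<tau>g / 2"
        using \<tau>g by (simp add: \<gamma>0_def flip: w0_def p0_def)
    qed (use xy in \<open>auto intro!: continuous_intros\<close>)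
    then obtain d2 where d2: "d2 > 0" and P2: "\<And>q. dist q ?pt < d2 \<Longrightarrow>
        \<bar>(norm (?z q - ?x q - ?al q *\<^sub>R (?y q - ?x q)))\<^sup>2 / (norm (?y q - ?x q))\<^sup>2 - \<gamma>0\<bar> < \<tau>g / 2"
      unfolding eventually_nhds_metric by blast
    define \<tau>a where "\<tau>a = min \<tau>g (d2 / 8)"
    have \<tau>a: "\<tau>a > 0" "\<tau>a \<le> \<tau>g" "\<tau>a \<le> d2 / 8" using \<tau>g d2 by (auto simp: \<tau>a_def)
    have "\<forall>\<^sub>F q in nhds ?pt. \<bar>((?y q - ?x q) \<bullet> (?z q - ?x q)) / (norm (?y q - ?x q))\<^sup>2 - \<alpha>0\<bar> < \<tau>a / 2"
    proof (rule eventually_less_isCont)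
      show "\<bar>((?y ?pt - ?x ?pt) \<bullet> (?z ?pt - ?x ?pt)) / (norm (?y ?pt - ?x ?pt))\<^sup>2 - \<alpha>0\<bar> < \<tau>a / 2"
        using \<tau>a by (simp add: \<alpha>0_def flip: w0_def)
    qed (use xy in \<open>auto intro!: continuous_intros\<close>)
    then obtain d3 where d3: "d3 > 0" and P3: "\<And>q. dist q ?pt < d3 \<Longrightarrow>
        \<bar>((?y q - ?x q) \<bullet> (?z q - ?x q)) / (norm (?y q - ?x q))\<^sup>2 - \<alpha>0\<bar> < \<tau>a / 2"
      unfolding eventually_nhds_metric by blast
    define \<rho> where "\<rho> = min (1 / 2) (min (d1 / 8) (min (d2 / 8) (d3 / 8)))"
    have \<rho>: "\<rho> > 0" "\<rho> \<le> 1 / 2" "\<rho> \<le> d1 / 8" "\<rho> \<le> d2 / 8" "\<rho> \<le> d3 / 8" using d1 d2 d3 by (auto simp: \<rho>_def)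
    have H1: "1 \<le> H" using \<gamma>0 by (simp add: H_def)
    show "\<exists>\<alpha>0 \<gamma>0 \<tau>a \<tau>g \<rho> H. 0 < \<tau>a \<and> 0 < \<tau>g \<and> 2 * \<tau>g \<le> \<gamma>0 \<and> 0 < \<rho> \<and> \<rho> \<le> 1 / 2 \<and> 1 \<le> H \<and>
    (\<forall>\<alpha>\<in>{\<alpha>0 - \<tau>a..\<alpha>0 + \<tau>a}. \<forall>\<gamma>\<in>{\<gamma>0 - \<tau>g..\<gamma>0 + \<tau>g}. \<forall>x\<in>cball x0 \<rho>. \<forall>y\<in>cball y0 \<rho>. \<forall>z\<in>cball z0 \<rho>.
      triangle_bounds x0 y0 (l\<^sup>2 / 4) \<epsilon> \<alpha>0 \<gamma>0 \<tau>a \<tau>g H \<alpha> \<gamma> x y z)"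
    proof (rule exI[of _ \<alpha>0], rule exI[of _ \<gamma>0], rule exI[of _ \<tau>a], rule exI[of _ \<tau>g], rule exI[of _ \<rho>], rule exI[of _ H],
        intro conjI[OF \<tau>a(1)] conjI[OF \<tau>g(1)] conjI[OF \<tau>g(3)] conjI[OF \<rho>(1)] conjI[OF \<rho>(2)] conjI[OF H1] ballI)
      fix \<alpha> \<gamma> x y z
      assume \<alpha>: "\<alpha> \<in> {\<alpha>0 - \<tau>a..\<alpha>0 + \<tau>a}" and \<gamma>: "\<gamma> \<in> {\<gamma>0 - \<tau>g..\<gamma>0 + \<tau>g}"
        and x: "x \<in> cball x0 \<rho>" and y: "y \<in> cball y0 \<rho>" and z: "z \<in> cball z0 \<rho>"
      have da: "dist \<alpha> \<alpha>0 \<le> \<tau>a" "dist \<gamma> \<gamma>0 \<le> \<tau>g" using \<alpha> \<gamma> by (auto simp: dist_real_def)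
      have dx: "dist x x0 \<le> \<rho>" "dist y y0 \<le> \<rho>" "dist z z0 \<le> \<rho>" using x y z by (auto simp: dist_commute)
      have D1: "dist (\<alpha>, \<gamma>, x, y, z) ?pt < d1"
        using dist_tuple5_le[of \<alpha> \<gamma> x y z \<alpha>0 \<gamma>0 x0 y0 z0] da dx \<tau>a \<tau>g \<rho> d1 by linarith
      have D2: "dist (\<alpha>, \<gamma>0, x, y, z) ?pt < d2"
        using dist_tuple5_le[of \<alpha> \<gamma>0 x y z \<alpha>0 \<gamma>0 x0 y0 z0] da dx \<tau>a \<rho> d2 by simp
      have D3: "dist (\<alpha>0, \<gamma>0, x, y, z) ?pt < d3"
        using dist_tuple5_le[of \<alpha>0 \<gamma>0 x y z \<alpha>0 \<gamma>0 x0 y0 z0] da dx \<rho> d3 by simp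
      note Q1 = P1[OF D1, unfolded fst_conv snd_conv] and Q2 = P2[OF D2, unfolded fst_conv snd_conv] and Q3 = P3[OF D3, unfolded fst_conv snd_conv]
      have orth': "(sqrt \<gamma>0 *\<^sub>R w0) \<bullet> p0 = 0" using orth by simp
      have indep: "\<forall>a b. l\<^sup>2 / 4 * (a\<^sup>2 + b\<^sup>2) \<le> (norm (a *\<^sub>R fst (chart \<alpha> \<gamma> (x0, y0)) + b *\<^sub>R (z - snd (chart \<alpha> \<gamma> (x0, y0)))))\<^sup>2"
        using Q1 by (intro allI nearly_orthogonal_lower[OF orth' nW l_def[symmetric] l]) auto
      have "(norm (y - x))\<^sup>2 * \<tau>g \<le> ((norm w0)\<^sup>2 + 1) * \<tau>g" using Q1 \<tau>g by (intro mult_right_mono) auto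
      then have g1: "(norm (y - x))\<^sup>2 * \<tau>g \<le> 1" using \<tau>g by linarith
      have "(norm (y - x))\<^sup>2 * \<tau>a \<le> (norm (y - x))\<^sup>2 * \<tau>g" using \<tau>a by (intro mult_left_mono) auto
      then have a1: "(norm (y - x))\<^sup>2 * \<tau>a \<le> 1" using g1 by linarith
      show "triangle_bounds x0 y0 (l\<^sup>2 / 4) \<epsilon> \<alpha>0 \<gamma>0 \<tau>a \<tau>g H \<alpha> \<gamma> x y z"
        unfolding triangle_bounds_def using Q1 Q2 Q3 indep a1 g1 by (intro conjI) (simp_all add: less_imp_le)
    qed
  qed
qed

subsection \<open>The weighted count of triangles\<close>

definition tri_weight :: "('a \<Rightarrow> real) \<Rightarrow> ('a \<Rightarrow> real) \<Rightarrow> ('a \<Rightarrow> real) \<Rightarrow> ('a \<times> 'a) \<times> 'a \<Rightarrow> real" where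
  "tri_weight a b c j = a (fst (fst j)) * b (snd (fst j)) * c (snd j)"

definition tri_count :: "nat \<Rightarrow> 'a::euclidean_space set \<Rightarrow> 'a set \<Rightarrow> 'a set \<Rightarrow> ('a \<Rightarrow> real) \<Rightarrow> ('a \<Rightarrow> real) \<Rightarrow> ('a \<Rightarrow> real) \<Rightarrow> real \<Rightarrow> real \<Rightarrow> real" where
  "tri_count n P Q R a b c \<alpha> \<gamma> = (\<Sum>j\<in>(P \<times> Q) \<times> R. tri_weight a b c j *
     (cos_kernel n (shape1 \<alpha> \<gamma> (fst (fst j)) (snd (fst j)) (snd j)) * cos_kernel n (shape2 \<alpha> (fst (fst j)) (snd (fst j)) (snd j))))"

definition tri_mode :: "nat \<Rightarrow> 'a::euclidean_space set \<Rightarrow> 'a set \<Rightarrow> 'a set \<Rightarrow> ('a \<Rightarrow> real) \<Rightarrow> ('a \<Rightarrow> real) \<Rightarrow> ('a \<Rightarrow> real) \<Rightarrow> real \<Rightarrow> real \<Rightarrow> nat \<times> nat \<Rightarrow> complex" where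
  "tri_mode n P Q R a b c \<alpha> \<gamma> q = of_real (kernel_coeff n (fst q) * kernel_coeff n (snd q)) *
     (\<Sum>j\<in>(P \<times> Q) \<times> R. of_real (tri_weight a b c j) *
        cis ((real (fst q) - real n) * shape1 \<alpha> \<gamma> (fst (fst j)) (snd (fst j)) (snd j) +
             (real (snd q) - real n) * shape2 \<alpha> (fst (fst j)) (snd (fst j)) (snd j)))"

lemma sum_tri_weight:
  assumes "sum a P = 1" "sum b Q = 1" "sum c R = 1"
  shows "(\<Sum>j\<in>(P \<times> Q) \<times> R. tri_weight a b c j) = 1"
proof -
  have "(\<Sum>j\<in>(P \<times> Q) \<times> R. tri_weight a b c j) = (\<Sum>x\<in>P. \<Sum>y\<in>Q. \<Sum>z\<in>R. a x * b y * c z)"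
    by (simp only: sum.cartesian_product' tri_weight_def fst_conv snd_conv)
  also have "\<dots> = sum a P * sum b Q * sum c R"
    by (simp only: sum_distrib_left[symmetric] sum_distrib_right[symmetric])
  finally have "(\<Sum>j\<in>(P \<times> Q) \<times> R. tri_weight a b c j) = sum a P * sum b Q * sum c R" .
  then show ?thesis using assms by simp
qed

lemma tri_count_fourier:
  "complex_of_real (tri_count n P Q R a b c \<alpha> \<gamma>) = (\<Sum>q\<in>{..2 * n} \<times> {..2 * n}. tri_mode n P Q R a b c \<alpha> \<gamma> q)"
proof -
  let ?s = "\<lambda>j. shape1 \<alpha> \<gamma> (fst (fst j)) (snd (fst j)) (snd j)" and ?t = "\<lambda>j. shape2 \<alpha> (fst (fst j)) (snd (fst j)) (snd j)"
  have "complex_of_real (cos_kernel n u * cos_kernel n v) = (\<Sum>q\<in>{..2 * n} \<times> {..2 * n}.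
      of_real (kernel_coeff n (fst q) * kernel_coeff n (snd q)) * cis ((real (fst q) - real n) * u + (real (snd q) - real n) * v))" for u v
    unfolding of_real_mult cos_kernel_fourier sum_product sum.cartesian_product'
    by (intro sum.cong refl) (simp only: fst_conv snd_conv cis_mult[symmetric] of_real_mult mult_ac)
  then have "complex_of_real (tri_count n P Q R a b c \<alpha> \<gamma>) = (\<Sum>j\<in>(P \<times> Q) \<times> R. \<Sum>q\<in>{..2 * n} \<times> {..2 * n}.
      of_real (tri_weight a b c j) * (of_real (kernel_coeff n (fst q) * kernel_coeff n (snd q)) *
        cis ((real (fst q) - real n) * ?s j + (real (snd q) - real n) * ?t j)))"
    unfolding tri_count_def of_real_sum of_real_mult[of "tri_weight a b c _"] by (simp only: sum_distrib_left)
  also have "\<dots> = (\<Sum>q\<in>{..2 * n} \<times> {..2 * n}. tri_mode n P Q R a b c \<alpha> \<gamma> q)"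
    unfolding tri_mode_def sum_distrib_left by (subst sum.swap) (intro sum.cong refl mult.left_commute)
  finally show ?thesis .
qed

lemma norm_cis_diff_le: "norm (cis s - cis t) \<le> \<bar>s - t\<bar>"
proof (rule power2_le_imp_le)
  have "(norm (cis s - cis t))\<^sup>2 = 2 - 2 * cos (s - t)"
    using sin_cos_squared_add[of s] sin_cos_squared_add[of t]
    by (simp add: cmod_power2 power2_diff cos_diff algebra_simps)
  also have "\<dots> = (2 * sin ((s - t) / 2))\<^sup>2"
  proof -
    have "cos (s - t) = cos (2 * ((s - t) / 2))" by (rule arg_cong) simp
    then show ?thesis unfolding cos_double_sin power_mult_distrib by simp
  qed
  also have "\<dots> \<le> (\<bar>s - t\<bar>)\<^sup>2"
    using abs_sin_x_le_abs_x[of "(s - t) / 2"] by (intro power2_le_iff_abs_le[THEN iffD2]) auto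
  finally show "(norm (cis s - cis t))\<^sup>2 \<le> (\<bar>s - t\<bar>)\<^sup>2" .
qed simp

text \<open>The coefficients are at most 1 and the weights have total mass 1, so a mode moves no
  more than its phase does.\<close>

lemma tri_mode_lipschitz:
  assumes nn: "\<And>p. a p \<ge> 0" "\<And>p. b p \<ge> 0" "\<And>p. c p \<ge> 0"
    and sums: "sum a P = 1" "sum b Q = 1" "sum c R = 1"
    and q: "\<bar>real (fst q) - real n\<bar> \<le> r" "\<bar>real (snd q) - real n\<bar> \<le> r" and e: "e \<ge> 0"
    and s1: "\<And>x y z. x \<in> P \<Longrightarrow> y \<in> Q \<Longrightarrow> z \<in> R \<Longrightarrow> \<bar>shape1 \<alpha> \<gamma> x y z - shape1 \<alpha>' \<gamma>' x y z\<bar> \<le> e"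
    and s2: "\<And>x y z. x \<in> P \<Longrightarrow> y \<in> Q \<Longrightarrow> z \<in> R \<Longrightarrow> \<bar>shape2 \<alpha> x y z - shape2 \<alpha>' x y z\<bar> \<le> e"
  shows "norm (tri_mode n P Q R a b c \<alpha> \<gamma> q - tri_mode n P Q R a b c \<alpha>' \<gamma>' q) \<le> 2 * r * e"
proof -
  let ?k = "real (fst q) - real n" and ?l = "real (snd q) - real n"
  let ?f = "\<lambda>\<alpha> \<gamma> j. ?k * shape1 \<alpha> \<gamma> (fst (fst j)) (snd (fst j)) (snd j) + ?l * shape2 \<alpha> (fst (fst j)) (snd (fst j)) (snd j)"
  have r: "r \<ge> 0" using q by linarith
  have w: "tri_weight a b c j \<ge> 0" for j using nn by (simp add: tri_weight_def)
  have d: "\<bar>?f \<alpha> \<gamma> j - ?f \<alpha>' \<gamma>' j\<bar> \<le> 2 * r * e" if "j \<in> (P \<times> Q) \<times> R" for j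
  proof -
    define x y z where "x = fst (fst j)" and "y = snd (fst j)" and "z = snd j"
    then have j: "j = ((x, y), z)" "x \<in> P" "y \<in> Q" "z \<in> R" using that by auto
    have "?f \<alpha> \<gamma> j - ?f \<alpha>' \<gamma>' j = ?k * (shape1 \<alpha> \<gamma> x y z - shape1 \<alpha>' \<gamma>' x y z) + ?l * (shape2 \<alpha> x y z - shape2 \<alpha>' x y z)"
      by (simp add: j(1) algebra_simps)
    also have "\<bar>\<dots>\<bar> \<le> \<bar>?k\<bar> * \<bar>shape1 \<alpha> \<gamma> x y z - shape1 \<alpha>' \<gamma>' x y z\<bar> + \<bar>?l\<bar> * \<bar>shape2 \<alpha> x y z - shape2 \<alpha>' x y z\<bar>"
      unfolding abs_mult[symmetric] by (rule abs_triangle_ineq)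
    also have "\<dots> \<le> r * e + r * e" using q r s1 s2 j by (intro add_mono mult_mono) auto
    also have "\<dots> = 2 * r * e" by simp
    finally show ?thesis .
  qed
  have eq: "tri_mode n P Q R a b c \<alpha> \<gamma> q - tri_mode n P Q R a b c \<alpha>' \<gamma>' q = of_real (kernel_coeff n (fst q) * kernel_coeff n (snd q)) *
     (\<Sum>j\<in>(P \<times> Q) \<times> R. of_real (tri_weight a b c j) * (cis (?f \<alpha> \<gamma> j) - cis (?f \<alpha>' \<gamma>' j)))"
    unfolding tri_mode_def by (simp only: right_diff_distrib sum_subtractf)
  have "norm (tri_mode n P Q R a b c \<alpha> \<gamma> q - tri_mode n P Q R a b c \<alpha>' \<gamma>' q) \<le> 1 * (\<Sum>j\<in>(P \<times> Q) \<times> R. tri_weight a b c j * (2 * r * e))"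
    unfolding eq norm_mult
  proof (intro mult_mono)
    show "norm (complex_of_real (kernel_coeff n (fst q) * kernel_coeff n (snd q))) \<le> 1"
      unfolding norm_of_real abs_mult using kernel_coeff_bounds by (intro mult_le_one) auto
    show "norm (\<Sum>j\<in>(P \<times> Q) \<times> R. of_real (tri_weight a b c j) * (cis (?f \<alpha> \<gamma> j) - cis (?f \<alpha>' \<gamma>' j))) \<le>
      (\<Sum>j\<in>(P \<times> Q) \<times> R. tri_weight a b c j * (2 * r * e))"
    proof (intro sum_norm_le)
      fix j assume j: "j \<in> (P \<times> Q) \<times> R"
      show "norm (of_real (tri_weight a b c j) * (cis (?f \<alpha> \<gamma> j) - cis (?f \<alpha>' \<gamma>' j))) \<le> tri_weight a b c j * (2 * r * e)"
        unfolding norm_mult using w[of j] norm_cis_diff_le[of "?f \<alpha> \<gamma> j" "?f \<alpha>' \<gamma>' j"] d[OF j]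
        by (intro mult_mono) auto
    qed
  qed auto
  also have "\<dots> = (\<Sum>j\<in>(P \<times> Q) \<times> R. tri_weight a b c j) * (2 * r * e)"
    by (simp only: sum_distrib_right mult_1_left)
  also have "\<dots> = 2 * r * e" unfolding sum_tri_weight[OF sums] by simp
  finally show ?thesis .
qed

text \<open>By \<open>tri_phase_chart\<close> the mode \<open>(k, l)\<close> is the phase with
  frequency \<open>(k - n) + i (l - n) / (2 * sqrt \<gamma>)\<close>. The modes thus form a
  rectangular grid whose mesh is controlled by \<open>g\<close> and \<open>H\<close> alone, which
  makes the bound uniform over the box. \<open>L\<close> bounds all squared frequencies of the
  kernel of order \<open>n\<close>, so the decay of the weights is used only up to that
  rate.\<close>

lemma tri_mode_high_bound:
  fixes P Q R :: "'a::euclidean_space set"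
  assumes fin: "finite P" "finite Q" "finite R"
    and nn: "\<And>p. a p \<ge> 0" "\<And>p. b p \<ge> 0" "\<And>p. c p \<ge> 0"
    and sums: "sum a P = 1" "sum b Q = 1" "sum c R = 1"
    and froP: "\<And>y \<Lambda>. 0 < \<Lambda> \<Longrightarrow> \<Lambda> \<le> L \<Longrightarrow> (\<Sum>p\<in>P. a p * exp (- \<Lambda> * (norm (p - y))\<^sup>2)) \<le> C * \<Lambda> powr (- s / 2)"
    and froQ: "\<And>y \<Lambda>. 0 < \<Lambda> \<Longrightarrow> \<Lambda> \<le> L \<Longrightarrow> (\<Sum>p\<in>Q. b p * exp (- \<Lambda> * (norm (p - y))\<^sup>2)) \<le> C * \<Lambda> powr (- s / 2)"
    and froR: "\<And>y \<Lambda>. 0 < \<Lambda> \<Longrightarrow> \<Lambda> \<le> L \<Longrightarrow> (\<Sum>p\<in>R. c p * exp (- \<Lambda> * (norm (p - y))\<^sup>2)) \<le> C * \<Lambda> powr (- s / 2)"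
    and C: "C \<ge> 0" and \<alpha>: "\<bar>\<alpha>\<bar> \<le> H" and \<gamma>: "0 < g" "g \<le> \<gamma>" "\<gamma> \<le> H"
    and near: "\<And>x y. x \<in> P \<Longrightarrow> y \<in> Q \<Longrightarrow> norm (chart \<alpha> \<gamma> (x, y) - X0) \<le> \<epsilon>"
    and indep: "\<And>z a b. z \<in> R \<Longrightarrow> c0 * (a\<^sup>2 + b\<^sup>2) \<le> (norm (a *\<^sub>R fst X0 + b *\<^sub>R (z - snd X0)))\<^sup>2"
    and H: "\<And>z. z \<in> R \<Longrightarrow> norm X0 + norm z \<le> H"
    and s: "0 \<le> s" "s \<le> DIM('a)" and c0: "c0 > 0"
    and B0: "B0 = 64 + 4 / c0" and \<eta>: "\<eta> = 3 * s - 2 * real DIM('a) - 2" "\<eta> > 0"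
    and \<epsilon>: "16 * B0 * \<epsilon>\<^sup>2 \<le> \<eta>" and r0: "r0 \<ge> 8 * B0" "r0 = r * min 1 (1 / (2 * sqrt H))"
    and L: "(real n * (1 + 1 / sqrt g))\<^sup>2 \<le> L"
  defines "S \<equiv> {q \<in> {..2 * n} \<times> {..2 * n}. \<not> (\<bar>real (fst q) - real n\<bar> \<le> r \<and> \<bar>real (snd q) - real n\<bar> \<le> r)}"
    and "\<kappa> \<equiv> 1 / (2 * (1 + (1 + H) / sqrt g)\<^sup>2)"
  shows "norm (\<Sum>q\<in>S. tri_mode n P Q R a b c \<alpha> \<gamma> q) \<le>
    sqrt (2 ^ DIM('a) * exp (64 * H\<^sup>2) * (C\<^sup>2 * \<kappa> powr - s) * 2 powr s * exp (\<eta> / 4) * C * 32 * (3 * (4 * sqrt H + 1))\<^sup>2 * B0\<^sup>2 * (1 + 8 / \<eta>)\<^sup>2) *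
      r0 powr (- \<eta> / 4) / (1 - 2 powr (- \<eta> / 4))"
proof -
  let ?\<delta> = "1 / (2 * sqrt \<gamma>)"
  have \<gamma>0: "\<gamma> > 0" and H0: "H > 0" using \<gamma> by linarith+
  have \<delta>: "?\<delta> > 0" using \<gamma>0 by simp
  have r0p: "r0 > 0" using r0(1) B0 c0 by (smt (verit) divide_pos_pos)
  have mpos: "min 1 (1 / (2 * sqrt H)) > 0" using H0 by simp
  have rp: "r > 0" using r0p mpos unfolding r0(2) by (simp add: zero_less_mult_iff)
  define f where "f = (\<lambda>q::nat \<times> nat. Complex (1 * (real (fst q) - real n)) (?\<delta> * (real (snd q) - real n)))"
  have finS: "finite S" unfolding S_def by simp
  have inj: "inj_on f S" using \<delta> by (auto simp: inj_on_def f_def prod_eq_iff)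
  \<comment> \<open>\<open>high_frequency_bound\<close> sums over a set of complex frequencies, so
    the coefficients are transported along the injection \<open>f\<close>.\<close>
  define coef where "coef = (\<lambda>\<zeta>. complex_of_real (kernel_coeff n (fst (the_inv_into S f \<zeta>)) * kernel_coeff n (snd (the_inv_into S f \<zeta>))))"
  have coef: "coef (f q) = of_real (kernel_coeff n (fst q) * kernel_coeff n (snd q))" if "q \<in> S" for q
    unfolding coef_def by (simp add: the_inv_into_f_f[OF inj that])
  have reindex: "(\<Sum>q\<in>S. tri_mode n P Q R a b c \<alpha> \<gamma> q) =
    (\<Sum>i\<in>P \<times> Q. of_real (a (fst i) * b (snd i)) * (\<Sum>\<zeta>\<in>f ` S. coef \<zeta> * (\<Sum>z\<in>R. of_real (c z) * cis (tri_phase \<zeta> z (chart \<alpha> \<gamma> i)))))"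
  proof -
    have ph: "tri_phase (f q) z (chart \<alpha> \<gamma> i) = (real (fst q) - real n) * shape1 \<alpha> \<gamma> (fst i) (snd i) z +
        (real (snd q) - real n) * shape2 \<alpha> (fst i) (snd i) z" for q z i
      using \<gamma>0 by (simp add: tri_phase_chart f_def)
    have "(\<Sum>i\<in>P \<times> Q. of_real (a (fst i) * b (snd i)) * (\<Sum>\<zeta>\<in>f ` S. coef \<zeta> * (\<Sum>z\<in>R. of_real (c z) * cis (tri_phase \<zeta> z (chart \<alpha> \<gamma> i))))) =
       (\<Sum>i\<in>P \<times> Q. \<Sum>q\<in>S. of_real (a (fst i) * b (snd i)) * (of_real (kernel_coeff n (fst q) * kernel_coeff n (snd q)) *
          (\<Sum>z\<in>R. of_real (c z) * cis ((real (fst q) - real n) * shape1 \<alpha> \<gamma> (fst i) (snd i) z + (real (snd q) - real n) * shape2 \<alpha> (fst i) (snd i) z))))"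
      unfolding sum.reindex[OF inj] sum_distrib_left[of _ _ S] by (intro sum.cong refl) (simp only: o_def ph coef)
    also have "\<dots> = (\<Sum>q\<in>S. tri_mode n P Q R a b c \<alpha> \<gamma> q)"
      unfolding tri_mode_def sum.cartesian_product' [of _ "P \<times> Q" R]
      by (subst sum.swap) (simp add: sum_distrib_left tri_weight_def mult_ac)
    finally show ?thesis by simp
  qed
  \<comment> \<open>Outside the low modes one coordinate exceeds \<open>r\<close>. The second
    coordinate is scaled by \<open>1 / (2 * sqrt \<gamma>)\<close>, which is at least
    \<open>1 / (2 * sqrt H)\<close>; this is the factor in \<open>r0\<close>.\<close>
  have Zr: "r0 \<le> norm (f q) \<and> (norm (f q))\<^sup>2 \<le> L" if q: "q \<in> S" for q
  proof
    have "r < \<bar>real (fst q) - real n\<bar> \<or> r < \<bar>real (snd q) - real n\<bar>" using q unfolding S_def by auto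
    then show "r0 \<le> norm (f q)"
    proof
      assume "r < \<bar>real (fst q) - real n\<bar>"
      moreover have "r0 \<le> r * 1" unfolding r0(2) using rp by (intro mult_left_mono) auto
      ultimately show ?thesis using abs_Re_le_cmod[of "f q"] by (simp add: f_def)
    next
      assume "r < \<bar>real (snd q) - real n\<bar>"
      then have "r * ?\<delta> \<le> \<bar>real (snd q) - real n\<bar> * ?\<delta>" using \<delta> by (intro mult_right_mono) auto
      also have "\<dots> = \<bar>Im (f q)\<bar>" using \<delta> by (simp add: f_def abs_mult)
      also have "\<dots> \<le> norm (f q)" by (rule abs_Im_le_cmod)
      finally have "r * ?\<delta> \<le> norm (f q)" .
      moreover have "r0 \<le> r * ?\<delta>"
      proof -
        have "1 / (2 * sqrt H) \<le> ?\<delta>" using \<gamma> \<gamma>0 by (intro divide_left_mono) auto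
        then show ?thesis unfolding r0(2) using rp by (intro mult_left_mono) (auto simp: min_le_iff_disj)
      qed
      ultimately show ?thesis by linarith
    qed
    have k: "\<bar>real (fst q) - real n\<bar> \<le> real n" "\<bar>real (snd q) - real n\<bar> \<le> real n" using q unfolding S_def by auto
    have "?\<delta> \<le> 1 / sqrt g" using \<gamma> by (intro frac_le) (auto intro: order_trans[of _ "sqrt \<gamma>"])
    then have "?\<delta> * \<bar>real (snd q) - real n\<bar> \<le> 1 / sqrt g * real n" using k \<gamma> by (intro mult_mono) auto
    then have "norm (f q) \<le> real n * (1 + 1 / sqrt g)"
      using cmod_le[of "f q"] k(1) \<delta> by (simp add: f_def abs_mult algebra_simps)
    then have "(norm (f q))\<^sup>2 \<le> (real n * (1 + 1 / sqrt g))\<^sup>2" by (intro power_mono) auto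
    then show "(norm (f q))\<^sup>2 \<le> L" using L by linarith
  qed
  have sumA: "(\<Sum>i\<in>P \<times> Q. a (fst i) * b (snd i)) = 1"
    using sums by (simp add: sum.cartesian_product' sum_distrib_left[symmetric])
  have cnt: "real (card {\<zeta> \<in> f ` S. norm (\<zeta> - e) \<le> \<rho>}) \<le> (3 * (4 * sqrt H + 1)) * \<rho>\<^sup>2" if \<rho>: "\<rho> \<ge> 1" for e \<rho>
  proof -
    have "real (card {\<zeta> \<in> f ` S. norm (\<zeta> - e) \<le> \<rho>}) \<le> (2 / 1 + 1) * (2 / ?\<delta> + 1) * \<rho>\<^sup>2"
      unfolding f_def using finS \<delta> \<rho> by (intro grid_card_near) auto
    also have "\<dots> \<le> (3 * (4 * sqrt H + 1)) * \<rho>\<^sup>2" using \<gamma> by (intro mult_right_mono mult_mono) auto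
    finally show ?thesis .
  qed
  have "norm (\<Sum>i\<in>P \<times> Q. of_real (a (fst i) * b (snd i)) * (\<Sum>\<zeta>\<in>f ` S. coef \<zeta> * (\<Sum>z\<in>R. of_real (c z) * cis (tri_phase \<zeta> z (chart \<alpha> \<gamma> i))))) \<le>
    sqrt (2 ^ DIM('a) * exp (64 * H\<^sup>2) * (C\<^sup>2 * \<kappa> powr - s) * 2 powr s * exp (\<eta> / 4) * C * 32 * (3 * (4 * sqrt H + 1))\<^sup>2 * B0\<^sup>2 * (1 + 8 / \<eta>)\<^sup>2) *
      r0 powr (- \<eta> / 4) / (1 - 2 powr (- \<eta> / 4))"
  proof -
    have Z: "finite (f ` S)" "\<And>\<zeta>. \<zeta> \<in> f ` S \<Longrightarrow> r0 \<le> norm \<zeta> \<and> (norm \<zeta>)\<^sup>2 \<le> L" using finS Zr by auto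
    have k1: "norm (coef \<zeta>) \<le> 1" if z: "\<zeta> \<in> f ` S" for \<zeta>
    proof -
      obtain q where q: "q \<in> S" "\<zeta> = f q" using z by blast
      show ?thesis unfolding q(2) coef[OF q(1)] norm_of_real abs_mult using kernel_coeff_bounds by (intro mult_le_one) auto
    qed
    have I: "finite (P \<times> Q)" "\<And>i. i \<in> P \<times> Q \<Longrightarrow> a (fst i) * b (snd i) \<ge> 0" "(\<Sum>i\<in>P \<times> Q. a (fst i) * b (snd i)) \<le> 1"
      using fin nn sumA by auto
    have froI: "(\<Sum>i\<in>P \<times> Q. a (fst i) * b (snd i) * exp (- \<Lambda> * (norm (Y - chart \<alpha> \<gamma> i))\<^sup>2)) \<le> C\<^sup>2 * \<kappa> powr - s * \<Lambda> powr - s"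
      if "0 < \<Lambda>" "\<Lambda> \<le> L" for Y \<Lambda>
      unfolding \<kappa>_def by (rule chart_frostman[OF fin(1,2) nn(1,2) froP froQ C \<alpha> \<gamma>(1,2) that])
    have nr: "norm (chart \<alpha> \<gamma> i - X0) \<le> \<epsilon>" if "i \<in> P \<times> Q" for i using near[of "fst i" "snd i"] that by auto
    have sc: "sum c R \<le> 1" using sums by simp
    have CI: "C\<^sup>2 * \<kappa> powr - s \<ge> 0" by simp
    show ?thesis
      by (rule high_frequency_bound[OF Z cnt k1 I froI nr fin(3) nn(3) sc froR indep H s c0 B0 \<eta> \<epsilon> r0(1) CI C])
  qed
  then show ?thesis unfolding reindex .
qed

section \<open>From a lower bound on average to approximate triangles\<close>

text \<open>\<open>shape2\<close> does not involve \<open>\<gamma>\<close> and is affine in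
  \<open>\<alpha>\<close>, so first an \<open>\<alpha>\<close> is found for which the sum with the
  second kernel alone is at least 1/2. With \<open>\<alpha>\<close> fixed, \<open>shape1\<close> is
  affine in \<open>\<gamma>\<close>, and averaging over \<open>\<gamma>\<close> costs another factor
  1/2.\<close>

lemma tri_count_average:
  fixes P Q R :: "'a::euclidean_space set"
  assumes fin: "finite P" "finite Q" "finite R"
    and nn: "\<And>p. a p \<ge> 0" "\<And>p. b p \<ge> 0" "\<And>p. c p \<ge> 0"
    and sums: "sum a P = 1" "sum b Q = 1" "sum c R = 1"
    and \<tau>: "\<tau>a > 0" "\<tau>g > 0"
    and ne: "\<And>x y. x \<in> P \<Longrightarrow> y \<in> Q \<Longrightarrow> x \<noteq> y \<and> (norm (y - x))\<^sup>2 * \<tau>a \<le> 1 \<and> (norm (y - x))\<^sup>2 * \<tau>g \<le> 1"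
    and al: "\<And>x y z. x \<in> P \<Longrightarrow> y \<in> Q \<Longrightarrow> z \<in> R \<Longrightarrow> \<bar>((y - x) \<bullet> (z - x)) / (norm (y - x))\<^sup>2 - \<alpha>0\<bar> \<le> \<tau>a / 2"
    and ga: "\<And>x y z \<alpha>. x \<in> P \<Longrightarrow> y \<in> Q \<Longrightarrow> z \<in> R \<Longrightarrow> \<alpha> \<in> {\<alpha>0 - \<tau>a..\<alpha>0 + \<tau>a} \<Longrightarrow>
      \<bar>(norm (z - x - \<alpha> *\<^sub>R (y - x)))\<^sup>2 / (norm (y - x))\<^sup>2 - \<gamma>0\<bar> \<le> \<tau>g / 2"
  shows "\<exists>\<alpha>\<in>{\<alpha>0 - \<tau>a..\<alpha>0 + \<tau>a}. \<exists>\<gamma>\<in>{\<gamma>0 - \<tau>g..\<gamma>0 + \<tau>g}. 1 / 4 \<le> tri_count n P Q R a b c \<alpha> \<gamma>"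
proof -
  let ?T = "(P \<times> Q) \<times> R"
  let ?x = "\<lambda>j::('a \<times> 'a) \<times> 'a. fst (fst j)" and ?y = "\<lambda>j::('a \<times> 'a) \<times> 'a. snd (fst j)" and ?z = "\<lambda>j::('a \<times> 'a) \<times> 'a. snd j"
  let ?w = "tri_weight a b c"
  let ?K1 = "\<lambda>j \<alpha> \<gamma>. cos_kernel n (shape1 \<alpha> \<gamma> (?x j) (?y j) (?z j))"
  let ?K2 = "\<lambda>j \<alpha>. cos_kernel n (shape2 \<alpha> (?x j) (?y j) (?z j))"
  have finT: "finite ?T" using fin by simp
  have w: "?w j \<ge> 0" for j using nn by (simp add: tri_weight_def)
  have jT: "?x j \<in> P" "?y j \<in> Q" "?z j \<in> R" if "j \<in> ?T" for j using that by auto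
  have c2: "continuous_on A (\<lambda>\<alpha>. ?K2 j \<alpha>)" for j A unfolding shape2_def by (intro continuous_intros)
  have c1: "continuous_on A (\<lambda>\<gamma>. ?K1 j \<alpha> \<gamma>)" for j \<alpha> A unfolding shape1_def by (intro continuous_intros)
  define h where "h = (\<lambda>\<alpha>. \<Sum>j\<in>?T. ?w j * ?K2 j \<alpha>)"
  have i2: "\<tau>a \<le> integral {\<alpha>0 - \<tau>a..\<alpha>0 + \<tau>a} (\<lambda>\<alpha>. ?K2 j \<alpha>)" if j: "j \<in> ?T" for j
  proof -
    let ?d = "?y j - ?x j"
    let ?s = "(?d \<bullet> (?z j - ?x j)) / (norm ?d)\<^sup>2"
    have d: "norm ?d > 0" "(norm ?d)\<^sup>2 * \<tau>a \<le> 1" using ne[OF jT(1,2)[OF j]] by auto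
    have eq: "shape2 \<alpha> (?x j) (?y j) (?z j) = (norm ?d)\<^sup>2 * (?s - \<alpha>)" for \<alpha>
    proof -
      have "(norm ?d)\<^sup>2 * ?s = ?d \<bullet> (?z j - ?x j)" using d(1) by simp
      moreover have "w \<bullet> (v - \<alpha> *\<^sub>R w) = w \<bullet> v - \<alpha> * (norm w)\<^sup>2" for w v :: 'a
        by (simp add: inner_diff_right power2_norm_eq_inner)
      ultimately show ?thesis unfolding shape2_def right_diff_distrib by (simp only: mult.commute)
    qed
    \<comment> \<open>The window of half-width \<open>\<tau>a / 2\<close> about the zero
      \<open>?s\<close> of \<open>shape2\<close> lies in the interval of averaging, and after
      scaling by \<open>|d|^2\<close> it stays inside one period of the kernel.\<close>
    have "(norm ?d)\<^sup>2 * (\<tau>a / 2) \<le> pi" using d(2) pi_ge_two by simp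
    moreover have "\<bar>?s - \<alpha>0\<bar> \<le> \<tau>a / 2" using al[OF jT[OF j]] .
    then have "\<alpha>0 - \<tau>a \<le> ?s - \<tau>a / 2" "?s + \<tau>a / 2 \<le> \<alpha>0 + \<tau>a" unfolding abs_le_iff by linarith+
    ultimately have "2 * (\<tau>a / 2) \<le> integral {\<alpha>0 - \<tau>a..\<alpha>0 + \<tau>a} (\<lambda>\<alpha>. cos_kernel n ((norm ?d)\<^sup>2 * (?s - \<alpha>)))"
      using d \<tau> by (intro integral_cos_kernel_affine_ge) auto
    then show ?thesis unfolding eq by simp
  qed
  have "1 / 2 * ((\<alpha>0 + \<tau>a) - (\<alpha>0 - \<tau>a)) = (\<Sum>j\<in>?T. ?w j) * \<tau>a" unfolding sum_tri_weight[OF sums] by simp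
  also have "\<dots> = (\<Sum>j\<in>?T. ?w j * \<tau>a)" by (rule sum_distrib_right)
  also have "\<dots> \<le> (\<Sum>j\<in>?T. ?w j * integral {\<alpha>0 - \<tau>a..\<alpha>0 + \<tau>a} (\<lambda>\<alpha>. ?K2 j \<alpha>))"
    by (intro sum_mono mult_left_mono i2 w)
  also have "\<dots> = integral {\<alpha>0 - \<tau>a..\<alpha>0 + \<tau>a} h"
    unfolding h_def using finT
    by (subst integral_sum) (auto intro!: integrable_continuous_interval continuous_intros c2)
  finally have "\<exists>\<alpha>\<in>{\<alpha>0 - \<tau>a..\<alpha>0 + \<tau>a}. 1 / 2 \<le> h \<alpha>"
    by (intro exists_ge_average) (use \<tau> in \<open>auto simp: h_def intro!: continuous_intros c2\<close>)
  then obtain \<alpha> where \<alpha>: "\<alpha> \<in> {\<alpha>0 - \<tau>a..\<alpha>0 + \<tau>a}" "1 / 2 \<le> h \<alpha>" by blast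
  have i1: "\<tau>g \<le> integral {\<gamma>0 - \<tau>g..\<gamma>0 + \<tau>g} (\<lambda>\<gamma>. ?K1 j \<alpha> \<gamma>)" if j: "j \<in> ?T" for j
  proof -
    let ?d = "?y j - ?x j"
    let ?s = "(norm (?z j - ?x j - \<alpha> *\<^sub>R ?d))\<^sup>2 / (norm ?d)\<^sup>2"
    have d: "norm ?d > 0" "(norm ?d)\<^sup>2 * \<tau>g \<le> 1" using ne[OF jT(1,2)[OF j]] by auto
    have eq: "shape1 \<alpha> \<gamma> (?x j) (?y j) (?z j) = (norm ?d)\<^sup>2 * (?s - \<gamma>)" for \<gamma>
      using d(1) by (simp add: shape1_def right_diff_distrib)
    have "(norm ?d)\<^sup>2 * (\<tau>g / 2) \<le> pi" using d(2) pi_ge_two by simp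
    moreover have "\<bar>?s - \<gamma>0\<bar> \<le> \<tau>g / 2" using ga[OF jT[OF j] \<alpha>(1)] .
    then have "\<gamma>0 - \<tau>g \<le> ?s - \<tau>g / 2" "?s + \<tau>g / 2 \<le> \<gamma>0 + \<tau>g" unfolding abs_le_iff by linarith+
    ultimately have "2 * (\<tau>g / 2) \<le> integral {\<gamma>0 - \<tau>g..\<gamma>0 + \<tau>g} (\<lambda>\<gamma>. cos_kernel n ((norm ?d)\<^sup>2 * (?s - \<gamma>)))"
      using d \<tau> by (intro integral_cos_kernel_affine_ge) auto
    then show ?thesis unfolding eq by simp
  qed
  have wK: "?w j * ?K2 j \<alpha> \<ge> 0" for j using w cos_kernel_nonneg by (intro mult_nonneg_nonneg) auto
  have "1 / 4 * ((\<gamma>0 + \<tau>g) - (\<gamma>0 - \<tau>g)) \<le> h \<alpha> * \<tau>g" using \<alpha>(2) \<tau> by simp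
  also have "\<dots> = (\<Sum>j\<in>?T. (?w j * ?K2 j \<alpha>) * \<tau>g)" unfolding h_def by (rule sum_distrib_right)
  also have "\<dots> \<le> (\<Sum>j\<in>?T. (?w j * ?K2 j \<alpha>) * integral {\<gamma>0 - \<tau>g..\<gamma>0 + \<tau>g} (\<lambda>\<gamma>. ?K1 j \<alpha> \<gamma>))"
    by (intro sum_mono mult_left_mono i1 wK)
  also have "\<dots> = integral {\<gamma>0 - \<tau>g..\<gamma>0 + \<tau>g} (\<lambda>\<gamma>. \<Sum>j\<in>?T. (?w j * ?K2 j \<alpha>) * ?K1 j \<alpha> \<gamma>)"
    using finT by (subst integral_sum) (auto intro!: integrable_continuous_interval continuous_intros c1)
  also have "(\<lambda>\<gamma>. \<Sum>j\<in>?T. (?w j * ?K2 j \<alpha>) * ?K1 j \<alpha> \<gamma>) = (\<lambda>\<gamma>. tri_count n P Q R a b c \<alpha> \<gamma>)"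
    unfolding tri_count_def by (simp only: mult_ac)
  finally have "\<exists>\<gamma>\<in>{\<gamma>0 - \<tau>g..\<gamma>0 + \<tau>g}. 1 / 4 \<le> tri_count n P Q R a b c \<alpha> \<gamma>"
    by (intro exists_ge_average) (use \<tau> in \<open>auto simp: tri_count_def intro!: continuous_intros c1\<close>)
  then show ?thesis using \<alpha>(1) by blast
qed

lemma tri_count_witness:
  assumes fin: "finite P" "finite Q" "finite R"
    and nn: "\<And>p. a p \<ge> 0" "\<And>p. b p \<ge> 0" "\<And>p. c p \<ge> 0"
    and sums: "sum a P = 1" "sum b Q = 1" "sum c R = 1"
    and t: "t < tri_count n P Q R a b c \<alpha> \<gamma>"
  shows "\<exists>x\<in>P. \<exists>y\<in>Q. \<exists>z\<in>R. t \<le> cos_kernel n (shape1 \<alpha> \<gamma> x y z) * cos_kernel n (shape2 \<alpha> x y z)"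
proof (rule ccontr)
  assume neg: "\<not> ?thesis"
  have w: "tri_weight a b c j \<ge> 0" for j using nn by (simp add: tri_weight_def)
  have "tri_count n P Q R a b c \<alpha> \<gamma> \<le> (\<Sum>j\<in>(P \<times> Q) \<times> R. tri_weight a b c j * t)"
    unfolding tri_count_def
  proof (intro sum_mono mult_left_mono w)
    fix j assume "j \<in> (P \<times> Q) \<times> R"
    then have "fst (fst j) \<in> P" "snd (fst j) \<in> Q" "snd j \<in> R" by auto
    then show "cos_kernel n (shape1 \<alpha> \<gamma> (fst (fst j)) (snd (fst j)) (snd j)) * cos_kernel n (shape2 \<alpha> (fst (fst j)) (snd (fst j)) (snd j)) \<le> t"
      using neg by (meson linear)
  qed
  also have "\<dots> = t" unfolding sum_distrib_right[symmetric] sum_tri_weight[OF sums] by simp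
  finally show False using t by simp
qed

lemma shape_lipschitz:
  assumes "norm (y - x) \<le> H" "norm (z - x) \<le> H" "\<bar>\<alpha>\<bar> \<le> H" "\<bar>\<alpha>'\<bar> \<le> H" "1 \<le> H"
    and d: "\<bar>\<alpha> - \<alpha>'\<bar> \<le> \<delta>" "\<bar>\<gamma> - \<gamma>'\<bar> \<le> \<delta>"
  shows "\<bar>shape1 \<alpha> \<gamma> x y z - shape1 \<alpha>' \<gamma>' x y z\<bar> \<le> 5 * H ^ 3 * \<delta>"
    and "\<bar>shape2 \<alpha> x y z - shape2 \<alpha>' x y z\<bar> \<le> 5 * H ^ 3 * \<delta>"
proof -
  define w v where "w = y - x" and "v = z - x"
  have \<delta>: "\<delta> \<ge> 0" using d by linarith
  have nw: "norm w \<le> H" "norm v \<le> H" using assms by (auto simp: w_def v_def)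
  have wv: "\<bar>w \<bullet> v\<bar> \<le> H\<^sup>2" using Cauchy_Schwarz_ineq2[of w v] nw mult_mono[of "norm w" H "norm v" H] by (simp add: power2_eq_square)
  have ww: "(norm w)\<^sup>2 \<le> H\<^sup>2" using nw by (intro power_mono) auto
  have H23: "H\<^sup>2 \<le> H ^ 3" using assms(5) by (intro power_increasing) auto
  have e1: "shape1 \<alpha> \<gamma> x y z - shape1 \<alpha>' \<gamma>' x y z = (\<alpha> - \<alpha>') * (- 2 * (w \<bullet> v)) + (\<alpha> - \<alpha>') * ((\<alpha> + \<alpha>') * (norm w)\<^sup>2) - (\<gamma> - \<gamma>') * (norm w)\<^sup>2"
    unfolding shape1_def w_def[symmetric] v_def[symmetric] power2_norm_eq_inner
    by (simp add: inner_simps inner_commute algebra_simps power2_eq_square)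
  have t1: "\<bar>(\<alpha> - \<alpha>') * (- 2 * (w \<bullet> v))\<bar> \<le> \<delta> * (2 * H\<^sup>2)"
    unfolding abs_mult using d wv \<delta> by (intro mult_mono) auto
  have t2: "\<bar>(\<alpha> - \<alpha>') * ((\<alpha> + \<alpha>') * (norm w)\<^sup>2)\<bar> \<le> \<delta> * (2 * H * H\<^sup>2)"
    unfolding abs_mult using d ww \<delta> assms by (intro mult_mono) auto
  have t3: "\<bar>(\<gamma> - \<gamma>') * (norm w)\<^sup>2\<bar> \<le> \<delta> * H\<^sup>2"
    unfolding abs_mult using d ww \<delta> by (intro mult_mono) auto
  have h: "\<delta> * H\<^sup>2 \<le> \<delta> * H ^ 3" using H23 \<delta> by (intro mult_left_mono) auto
  have "\<bar>shape1 \<alpha> \<gamma> x y z - shape1 \<alpha>' \<gamma>' x y z\<bar> \<le> \<delta> * (2 * H\<^sup>2) + \<delta> * (2 * H * H\<^sup>2) + \<delta> * H\<^sup>2"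
    unfolding e1 using t1 t2 t3 by linarith
  also have "\<dots> = 3 * (\<delta> * H\<^sup>2) + 2 * (\<delta> * H ^ 3)" by (simp add: power3_eq_cube power2_eq_square)
  also have "\<dots> \<le> 5 * (\<delta> * H ^ 3)" using h by linarith
  finally show "\<bar>shape1 \<alpha> \<gamma> x y z - shape1 \<alpha>' \<gamma>' x y z\<bar> \<le> 5 * H ^ 3 * \<delta>" by (simp only: mult_ac)
  have "shape2 \<alpha> x y z - shape2 \<alpha>' x y z = - ((\<alpha> - \<alpha>') * (norm w)\<^sup>2)"
    unfolding shape2_def w_def[symmetric] power2_norm_eq_inner by (simp add: inner_simps algebra_simps)
  moreover have "\<bar>(\<alpha> - \<alpha>') * (norm w)\<^sup>2\<bar> \<le> \<delta> * H\<^sup>2"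
    unfolding abs_mult using d ww \<delta> by (intro mult_mono) auto
  moreover have "0 \<le> \<delta> * H ^ 3" using \<delta> assms(5) by simp
  ultimately have "\<bar>shape2 \<alpha> x y z - shape2 \<alpha>' x y z\<bar> \<le> 5 * (\<delta> * H ^ 3)" using h by linarith
  then show "\<bar>shape2 \<alpha> x y z - shape2 \<alpha>' x y z\<bar> \<le> 5 * H ^ 3 * \<delta>" by (simp only: mult_ac)
qed

text \<open>One of \<open>|u|\<close>, \<open>|v|\<close> is at least \<open>m / 2\<close>. That
  factor decays geometrically in \<open>n\<close>, while the other is at most
  \<open>2 * n + 1\<close>.\<close>

lemma cos_kernel_product_small:
  assumes u: "\<bar>u\<bar> \<le> 1" "\<bar>v\<bar> \<le> 1" and m: "0 \<le> m" "m \<le> \<bar>u\<bar> + \<bar>v\<bar>"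
  shows "cos_kernel n u * cos_kernel n v \<le> (2 * real n + 1)\<^sup>2 * ((cos (m / 4))\<^sup>2) ^ n"
proof -
  have main: "cos_kernel n u * cos_kernel n v \<le> (2 * real n + 1)\<^sup>2 * ((cos (m / 4))\<^sup>2) ^ n"
    if uv: "\<bar>u\<bar> \<le> 1" "m / 2 \<le> \<bar>u\<bar>" for u v
  proof -
    have "cos (\<bar>u\<bar> / 2) \<le> cos (m / 4)" using uv m pi_ge_two by (intro cos_monotone_0_pi_le) auto
    moreover have "- (pi / 2) \<le> \<bar>u\<bar> / 2" "\<bar>u\<bar> / 2 \<le> pi / 2" using uv(1) pi_ge_two by linarith+
    then have "0 \<le> cos (\<bar>u\<bar> / 2)" by (rule cos_ge_zero)
    moreover have "cos (\<bar>u\<bar> / 2) = cos (u / 2)" by (cases "u \<ge> 0") auto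
    ultimately have "((cos (u / 2))\<^sup>2) ^ n \<le> ((cos (m / 4))\<^sup>2) ^ n" by (intro power_mono) auto
    then have 1: "cos_kernel n u \<le> (2 * real n + 1) * ((cos (m / 4))\<^sup>2) ^ n"
      using cos_kernel_le[of n u] by (smt (verit) mult_left_mono of_nat_0_le_iff)
    have "((cos (v / 2))\<^sup>2) ^ n \<le> 1" using abs_square_le_1[of "cos (v / 2)"] by (simp add: power_le_one)
    then have "(2 * real n + 1) * ((cos (v / 2))\<^sup>2) ^ n \<le> (2 * real n + 1) * 1" by (intro mult_left_mono) auto
    then have 2: "cos_kernel n v \<le> 2 * real n + 1" unfolding mult_1_right by (rule order_trans[OF cos_kernel_le])
    have "cos_kernel n u * cos_kernel n v \<le> ((2 * real n + 1) * ((cos (m / 4))\<^sup>2) ^ n) * (2 * real n + 1)"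
      using 1 2 cos_kernel_nonneg by (intro mult_mono) auto
    then show ?thesis by (simp add: power2_eq_square mult_ac)
  qed
  show ?thesis
  proof (cases "m / 2 \<le> \<bar>u\<bar>")
    case True then show ?thesis using main u by blast
  next
    case False
    then have "m / 2 \<le> \<bar>v\<bar>" using m by linarith
    then show ?thesis using main[of v u] u by (simp add: mult.commute)
  qed
qed

subsection \<open>Attained shapes\<close>

text \<open>The condition \<open>16 * B0 * \<epsilon>\<^sup>2 \<le> \<eta>\<close> makes the set of pairs \<open>(x, y)\<close> so small that the Gaussian factor
  of variance about \<open>1 / ln r\<close> in the main estimate costs less than the gain \<open>r powr (- \<eta>)\<close>.\<close>
locale triangle_box =
  fixes A1 A2 A3 :: "'a::euclidean_space set" and x0 y0 :: 'a
    and s \<eta> c0 B0 \<epsilon> \<alpha>0 \<gamma>0 \<tau>a \<tau>g H :: real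
  assumes compact: "compact A1" "compact A2" "compact A3"
    and diam: "\<And>x y. x \<in> A1 \<Longrightarrow> y \<in> A1 \<Longrightarrow> norm (x - y) \<le> 1" "\<And>x y. x \<in> A2 \<Longrightarrow> y \<in> A2 \<Longrightarrow> norm (x - y) \<le> 1"
      "\<And>x y. x \<in> A3 \<Longrightarrow> y \<in> A3 \<Longrightarrow> norm (x - y) \<le> 1"
    and content: "hausdorff_content s A1 \<noteq> 0" "hausdorff_content s A2 \<noteq> 0" "hausdorff_content s A3 \<noteq> 0"
    and s: "0 < s" "s \<le> DIM('a)" and \<eta>: "\<eta> = 3 * s - 2 * real DIM('a) - 2" "0 < \<eta>"
    and c0: "0 < c0" and B0: "B0 = 64 + 4 / c0" and \<epsilon>: "16 * B0 * \<epsilon>\<^sup>2 \<le> \<eta>"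
    and \<tau>: "0 < \<tau>a" "0 < \<tau>g" "2 * \<tau>g \<le> \<gamma>0" and H1: "1 \<le> H"
    and bounds: "\<And>\<alpha> \<gamma> x y z. \<alpha> \<in> {\<alpha>0 - \<tau>a..\<alpha>0 + \<tau>a} \<Longrightarrow> \<gamma> \<in> {\<gamma>0 - \<tau>g..\<gamma>0 + \<tau>g} \<Longrightarrow> x \<in> A1 \<Longrightarrow> y \<in> A2 \<Longrightarrow> z \<in> A3 \<Longrightarrow>
      triangle_bounds x0 y0 c0 \<epsilon> \<alpha>0 \<gamma>0 \<tau>a \<tau>g H \<alpha> \<gamma> x y z"
begin

lemmas box = bounds[unfolded triangle_bounds_def]

lemma nonempty: "A1 \<noteq> {}" "A2 \<noteq> {}" "A3 \<noteq> {}"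
  using content by (auto simp: hausdorff_content_empty)

text \<open>The count is at least 1/4 at some shape of the box. Passing to a shape within
  \<open>\<delta>\<close> loses at most 3/16: 1/16 from the low modes, and 1/16 from the high modes
  at each of the two shapes. What remains exceeds 1/32. The centre may depend on \<open>n\<close>,
  but \<open>\<delta>\<close> does not.\<close>

lemma kernel_witness:
  "\<exists>\<delta>>0. \<forall>n. \<exists>\<alpha>1\<in>{\<alpha>0 - \<tau>a..\<alpha>0 + \<tau>a}. \<exists>\<gamma>1\<in>{\<gamma>0 - \<tau>g..\<gamma>0 + \<tau>g}.
     \<forall>\<alpha>\<in>{\<alpha>0 - \<tau>a..\<alpha>0 + \<tau>a}. \<forall>\<gamma>\<in>{\<gamma>0 - \<tau>g..\<gamma>0 + \<tau>g}. \<bar>\<alpha> - \<alpha>1\<bar> \<le> \<delta> \<longrightarrow> \<bar>\<gamma> - \<gamma>1\<bar> \<le> \<delta> \<longrightarrow>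
       (\<exists>x\<in>A1. \<exists>y\<in>A2. \<exists>z\<in>A3. 1 / 32 \<le> cos_kernel n (shape1 \<alpha> \<gamma> x y z) * cos_kernel n (shape2 \<alpha> x y z))"
proof -
  let ?BA = "{\<alpha>0 - \<tau>a..\<alpha>0 + \<tau>a}" and ?BG = "{\<gamma>0 - \<tau>g..\<gamma>0 + \<tau>g}"
  obtain C1 where C1: "\<And>L. \<exists>P a. finite P \<and> P \<subseteq> A1 \<and> (\<forall>p. a p \<ge> 0) \<and> sum a P = 1 \<and>
     (\<forall>y \<Lambda>. 0 < \<Lambda> \<longrightarrow> \<Lambda> \<le> L \<longrightarrow> (\<Sum>p\<in>P. a p * exp (- \<Lambda> * (norm (p - y))\<^sup>2)) \<le> C1 * \<Lambda> powr (- s / 2))"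
    using frostman_finite[OF compact(1) diam(1) s(1) content(1)] by blast
  obtain C2 where C2: "\<And>L. \<exists>P a. finite P \<and> P \<subseteq> A2 \<and> (\<forall>p. a p \<ge> 0) \<and> sum a P = 1 \<and>
     (\<forall>y \<Lambda>. 0 < \<Lambda> \<longrightarrow> \<Lambda> \<le> L \<longrightarrow> (\<Sum>p\<in>P. a p * exp (- \<Lambda> * (norm (p - y))\<^sup>2)) \<le> C2 * \<Lambda> powr (- s / 2))"
    using frostman_finite[OF compact(2) diam(2) s(1) content(2)] by blast
  obtain C3 where C3: "\<And>L. \<exists>P a. finite P \<and> P \<subseteq> A3 \<and> (\<forall>p. a p \<ge> 0) \<and> sum a P = 1 \<and>
     (\<forall>y \<Lambda>. 0 < \<Lambda> \<longrightarrow> \<Lambda> \<le> L \<longrightarrow> (\<Sum>p\<in>P. a p * exp (- \<Lambda> * (norm (p - y))\<^sup>2)) \<le> C3 * \<Lambda> powr (- s / 2))"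
    using frostman_finite[OF compact(3) diam(3) s(1) content(3)] by blast
  define C where "C = max 0 (max C1 (max C2 C3))"
  have C: "C \<ge> 0" "C1 \<le> C" "C2 \<le> C" "C3 \<le> C" by (auto simp: C_def)
  define g where "g = \<gamma>0 - \<tau>g"
  have g: "g > 0" using \<tau> by (simp add: g_def)
  define \<kappa> where "\<kappa> = 1 / (2 * (1 + (1 + H) / sqrt g)\<^sup>2)"
  define M where "M = sqrt (2 ^ DIM('a) * exp (64 * H\<^sup>2) * (C\<^sup>2 * \<kappa> powr - s) * 2 powr s * exp (\<eta> / 4) * C * 32 * (3 * (4 * sqrt H + 1))\<^sup>2 * B0\<^sup>2 * (1 + 8 / \<eta>)\<^sup>2)"
  \<comment> \<open>\<open>M\<close> contains neither \<open>n\<close> nor \<open>r\<close>, so the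
    cut-off \<open>r0\<close> can be fixed once for all kernels.\<close>
  have "((\<lambda>r. r powr (- \<eta> / 4)) \<longlongrightarrow> 0) at_top"
    using \<eta>(2) by (intro tendsto_neg_powr filterlim_ident) auto
  then have "((\<lambda>r. M * r powr (- \<eta> / 4) / (1 - 2 powr (- \<eta> / 4))) \<longlongrightarrow> M * 0 / (1 - 2 powr (- \<eta> / 4))) at_top"
    using \<eta>(2) by (intro tendsto_intros) auto
  then have "eventually (\<lambda>r. M * r powr (- \<eta> / 4) / (1 - 2 powr (- \<eta> / 4)) < 1 / 16) at_top"
    by (rule order_tendstoD) simp
  then have "eventually (\<lambda>r. M * r powr (- \<eta> / 4) / (1 - 2 powr (- \<eta> / 4)) < 1 / 16 \<and> 8 * B0 \<le> r) at_top"
    using eventually_ge_at_top[of "8 * B0"] by (rule eventually_conj)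
  then obtain r0 where r0: "M * r0 powr (- \<eta> / 4) / (1 - 2 powr (- \<eta> / 4)) < 1 / 16" "8 * B0 \<le> r0"
    using eventually_happens[of _ at_top] trivial_limit_at_top_linorder by blast
  have B0p: "B0 > 0" using c0 by (simp add: B0 add_pos_pos)
  define m where "m = min 1 (1 / (2 * sqrt H))"
  have m: "m > 0" using H1 by (simp add: m_def)
  define r where "r = r0 / m"
  have rm: "r0 = r * m" using m by (simp add: r_def)
  have r: "r > 0" using r0(2) B0p m by (simp add: r_def)
  \<comment> \<open>There are at most \<open>(2 * r + 1)^2\<close> low modes, each moving by at most
    \<open>2 * r * e\<close>; this \<open>e\<close> makes the total exactly 1/16. Dividing by the
    Lipschitz constant \<open>5 * H ^ 3\<close> of the shape functions then gives
    \<open>\<delta>\<close>.\<close>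
  define e where "e = 1 / (16 * (2 * r + 1)\<^sup>2 * (2 * r))"
  have e: "e > 0" using r by (simp add: e_def)
  have re: "(2 * r + 1) * (2 * r + 1) * (2 * r * e) = 1 / 16"
  proof -
    have "A * A * (B * (1 / (16 * A\<^sup>2 * B))) = 1 / 16" if "A \<noteq> 0" "B \<noteq> 0" for A B :: real
      using that by (simp add: power2_eq_square)
    from this[of "2 * r + 1" "2 * r"] show ?thesis using r unfolding e_def by linarith
  qed
  define \<delta> where "\<delta> = e / (5 * H ^ 3)"
  have \<delta>: "\<delta> > 0" "5 * H ^ 3 * \<delta> = e" using e H1 by (auto simp: \<delta>_def)
  have "\<exists>\<alpha>1\<in>?BA. \<exists>\<gamma>1\<in>?BG.
     \<forall>\<alpha>\<in>?BA. \<forall>\<gamma>\<in>?BG. \<bar>\<alpha> - \<alpha>1\<bar> \<le> \<delta> \<longrightarrow> \<bar>\<gamma> - \<gamma>1\<bar> \<le> \<delta> \<longrightarrow>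
       (\<exists>x\<in>A1. \<exists>y\<in>A2. \<exists>z\<in>A3. 1 / 32 \<le> cos_kernel n (shape1 \<alpha> \<gamma> x y z) * cos_kernel n (shape2 \<alpha> x y z))" for n
  proof -
    define L where "L = (real n * (1 + 1 / sqrt g))\<^sup>2"
    obtain P a where P: "finite P" "P \<subseteq> A1" "\<And>p. a p \<ge> 0" "sum a P = 1"
      and fP: "\<And>y \<Lambda>. 0 < \<Lambda> \<Longrightarrow> \<Lambda> \<le> L \<Longrightarrow> (\<Sum>p\<in>P. a p * exp (- \<Lambda> * (norm (p - y))\<^sup>2)) \<le> C1 * \<Lambda> powr (- s / 2)"
      using C1[of L] by blast
    obtain Q b where Q: "finite Q" "Q \<subseteq> A2" "\<And>p. b p \<ge> 0" "sum b Q = 1"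
      and fQ: "\<And>y \<Lambda>. 0 < \<Lambda> \<Longrightarrow> \<Lambda> \<le> L \<Longrightarrow> (\<Sum>p\<in>Q. b p * exp (- \<Lambda> * (norm (p - y))\<^sup>2)) \<le> C2 * \<Lambda> powr (- s / 2)"
      using C2[of L] by blast
    obtain R c where R: "finite R" "R \<subseteq> A3" "\<And>p. c p \<ge> 0" "sum c R = 1"
      and fR: "\<And>y \<Lambda>. 0 < \<Lambda> \<Longrightarrow> \<Lambda> \<le> L \<Longrightarrow> (\<Sum>p\<in>R. c p * exp (- \<Lambda> * (norm (p - y))\<^sup>2)) \<le> C3 * \<Lambda> powr (- s / 2)"
      using C3[of L] by blast
    have fro: "(\<Sum>p\<in>P. a p * exp (- \<Lambda> * (norm (p - y))\<^sup>2)) \<le> C * \<Lambda> powr (- s / 2)"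
      "(\<Sum>p\<in>Q. b p * exp (- \<Lambda> * (norm (p - y))\<^sup>2)) \<le> C * \<Lambda> powr (- s / 2)"
      "(\<Sum>p\<in>R. c p * exp (- \<Lambda> * (norm (p - y))\<^sup>2)) \<le> C * \<Lambda> powr (- s / 2)" if "0 < \<Lambda>" "\<Lambda> \<le> L" for y \<Lambda>
      using fP[OF that, of y] fQ[OF that, of y] fR[OF that, of y]
        mult_right_mono[OF C(2), of "\<Lambda> powr (- s / 2)"] mult_right_mono[OF C(3), of "\<Lambda> powr (- s / 2)"]
        mult_right_mono[OF C(4), of "\<Lambda> powr (- s / 2)"] powr_ge_zero[of \<Lambda> "- s / 2"] by linarith+
    have mem: "x \<in> A1" if "x \<in> P" for x using P that by blast
    have mem2: "x \<in> A2" if "x \<in> Q" for x using Q that by blast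
    have mem3: "x \<in> A3" if "x \<in> R" for x using R that by blast
    note bx = box[OF _ _ mem mem2 mem3]
    obtain x1 y1 z1 where xyz1: "x1 \<in> A1" "y1 \<in> A2" "z1 \<in> A3" using nonempty by blast
    have g0: "\<gamma>0 \<in> ?BG" "\<alpha>0 \<in> ?BA" using \<tau> by auto
    have "\<exists>\<alpha>\<in>?BA. \<exists>\<gamma>\<in>?BG. 1 / 4 \<le> tri_count n P Q R a b c \<alpha> \<gamma>"
    proof (rule tri_count_average[OF P(1) Q(1) R(1) P(3) Q(3) R(3) P(4) Q(4) R(4) \<tau>(1,2)])
      fix x y assume "x \<in> P" "y \<in> Q"
      then show "x \<noteq> y \<and> (norm (y - x))\<^sup>2 * \<tau>a \<le> 1 \<and> (norm (y - x))\<^sup>2 * \<tau>g \<le> 1"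
        using box[OF g0(2,1) mem mem2 xyz1(3)] by blast
    next
      fix x y z assume "x \<in> P" "y \<in> Q" "z \<in> R"
      then show "\<bar>((y - x) \<bullet> (z - x)) / (norm (y - x))\<^sup>2 - \<alpha>0\<bar> \<le> \<tau>a / 2"
        using bx[OF g0(2,1)] by blast
    next
      fix x y z \<alpha> assume "x \<in> P" "y \<in> Q" "z \<in> R" "\<alpha> \<in> ?BA"
      then show "\<bar>(norm (z - x - \<alpha> *\<^sub>R (y - x)))\<^sup>2 / (norm (y - x))\<^sup>2 - \<gamma>0\<bar> \<le> \<tau>g / 2"
        using bx[OF _ g0(1)] by blast
    qed
    then obtain \<alpha>1 \<gamma>1 where ag1: "\<alpha>1 \<in> ?BA" "\<gamma>1 \<in> ?BG" and quarter: "1 / 4 \<le> tri_count n P Q R a b c \<alpha>1 \<gamma>1" by blast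
    let ?I = "{..2 * n} \<times> {..2 * n}"
    let ?low = "\<lambda>q. \<bar>real (fst q) - real n\<bar> \<le> r \<and> \<bar>real (snd q) - real n\<bar> \<le> r"
    let ?S = "{q \<in> ?I. \<not> ?low q}"
    have high: "norm (\<Sum>q\<in>?S. tri_mode n P Q R a b c \<alpha> \<gamma> q) \<le> 1 / 16" if ag: "\<alpha> \<in> ?BA" "\<gamma> \<in> ?BG" for \<alpha> \<gamma>
    proof -
      have h: "\<bar>\<alpha>\<bar> \<le> H" "\<gamma> \<le> H" "g \<le> \<gamma>" using box[OF ag xyz1] ag by (auto simp: g_def)
      have "norm (\<Sum>q\<in>?S. tri_mode n P Q R a b c \<alpha> \<gamma> q) \<le> M * r0 powr (- \<eta> / 4) / (1 - 2 powr (- \<eta> / 4))"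
        unfolding M_def \<kappa>_def
      proof (rule tri_mode_high_bound[OF P(1) Q(1) R(1) P(3) Q(3) R(3) P(4) Q(4) R(4) _ _ _ C(1) h(1) g h(3,2) _ _ _ _ s(2) c0 B0 \<eta> \<epsilon> r0(2) rm[unfolded m_def], where L = L and ?X0.0 = "chart \<alpha> \<gamma> (x0, y0)"])
        show "norm (chart \<alpha> \<gamma> (x, y) - chart \<alpha> \<gamma> (x0, y0)) \<le> \<epsilon>" if "x \<in> P" "y \<in> Q" for x y
          using box[OF ag mem[OF that(1)] mem2[OF that(2)] xyz1(3)] by blast
        show "c0 * (a\<^sup>2 + b\<^sup>2) \<le> (norm (a *\<^sub>R fst (chart \<alpha> \<gamma> (x0, y0)) + b *\<^sub>R (z - snd (chart \<alpha> \<gamma> (x0, y0)))))\<^sup>2" if "z \<in> R" for z a b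
          using box[OF ag xyz1(1,2) mem3[OF that]] by blast
        show "norm (chart \<alpha> \<gamma> (x0, y0)) + norm z \<le> H" if "z \<in> R" for z
          using box[OF ag xyz1(1,2) mem3[OF that]] by blast
      qed (use fro s in \<open>auto simp: L_def\<close>)
      then show ?thesis using r0(1) by linarith
    qed
    show ?thesis
    proof (rule bexI[OF _ ag1(1)], rule bexI[OF _ ag1(2)], intro ballI impI)
      fix \<alpha> \<gamma> assume ag: "\<alpha> \<in> ?BA" "\<gamma> \<in> ?BG" and d: "\<bar>\<alpha> - \<alpha>1\<bar> \<le> \<delta>" "\<bar>\<gamma> - \<gamma>1\<bar> \<le> \<delta>"
      let ?t = "\<lambda>q. tri_mode n P Q R a b c \<alpha> \<gamma> q" and ?t1 = "\<lambda>q. tri_mode n P Q R a b c \<alpha>1 \<gamma>1 q"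
      let ?T = "{k \<in> {..2 * n}. \<bar>real k - real n\<bar> \<le> r}"
      have h: "\<bar>\<alpha>\<bar> \<le> H" "\<bar>\<alpha>1\<bar> \<le> H" using box[OF ag xyz1] box[OF ag1 xyz1] by auto
      have lip: "\<bar>shape1 \<alpha> \<gamma> x y z - shape1 \<alpha>1 \<gamma>1 x y z\<bar> \<le> e" "\<bar>shape2 \<alpha> x y z - shape2 \<alpha>1 x y z\<bar> \<le> e"
        if "x \<in> P" "y \<in> Q" "z \<in> R" for x y z
        using shape_lipschitz[of y x H z \<alpha> \<alpha>1 \<delta> \<gamma> \<gamma>1, unfolded \<delta>(2)] bx[OF ag that] h H1 d by auto
      have IT: "?I = ?T \<times> ?T \<union> ?S" "?T \<times> ?T \<inter> ?S = {}" by auto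
      have split: "(\<Sum>q\<in>?I. f q) = (\<Sum>q\<in>?T \<times> ?T. f q) + (\<Sum>q\<in>?S. f q)" for f :: "nat \<times> nat \<Rightarrow> complex"
        using IT by (subst IT(1), subst sum.union_disjoint) auto
      have "norm ((\<Sum>q\<in>?T \<times> ?T. ?t q) - (\<Sum>q\<in>?T \<times> ?T. ?t1 q)) \<le> (\<Sum>q\<in>?T \<times> ?T. norm (?t q - ?t1 q))"
        unfolding sum_subtractf[symmetric] by (rule norm_sum)
      also have "\<dots> \<le> (\<Sum>q\<in>?T \<times> ?T. 2 * r * e)"
        by (intro sum_mono tri_mode_lipschitz P Q R lip less_imp_le[OF e]) auto
      also have "\<dots> = real (card ?T) * real (card ?T) * (2 * r * e)" by (simp add: card_cartesian_product)
      also have "\<dots> \<le> (2 * r + 1) * (2 * r + 1) * (2 * r * e)"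
        using r e card_near_le[of r "{..2 * n}" "real n"] by (intro mult_right_mono mult_mono) auto
      finally have low: "norm ((\<Sum>q\<in>?T \<times> ?T. ?t q) - (\<Sum>q\<in>?T \<times> ?T. ?t1 q)) \<le> 1 / 16" unfolding re .
      have "complex_of_real (tri_count n P Q R a b c \<alpha> \<gamma> - tri_count n P Q R a b c \<alpha>1 \<gamma>1) =
          ((\<Sum>q\<in>?T \<times> ?T. ?t q) - (\<Sum>q\<in>?T \<times> ?T. ?t1 q)) + (\<Sum>q\<in>?S. ?t q) - (\<Sum>q\<in>?S. ?t1 q)"
        unfolding of_real_diff tri_count_fourier split by simp
      then have "\<bar>tri_count n P Q R a b c \<alpha> \<gamma> - tri_count n P Q R a b c \<alpha>1 \<gamma>1\<bar> =
          norm (((\<Sum>q\<in>?T \<times> ?T. ?t q) - (\<Sum>q\<in>?T \<times> ?T. ?t1 q)) + (\<Sum>q\<in>?S. ?t q) - (\<Sum>q\<in>?S. ?t1 q))"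
        by (metis norm_of_real)
      also have "\<dots> \<le> 1 / 16 + 1 / 16 + 1 / 16"
        by (intro norm_triangle_le_diff order_trans[OF norm_triangle_ineq] add_mono low high[OF ag] high[OF ag1] order_trans[OF norm_triangle_ineq4])
      finally have "1 / 32 < tri_count n P Q R a b c \<alpha> \<gamma>" using quarter by linarith
      from tri_count_witness[OF P(1) Q(1) R(1) P(3) Q(3) R(3) P(4) Q(4) R(4) this] mem mem2 mem3
      show "\<exists>x\<in>A1. \<exists>y\<in>A2. \<exists>z\<in>A3. 1 / 32 \<le> cos_kernel n (shape1 \<alpha> \<gamma> x y z) * cos_kernel n (shape2 \<alpha> x y z)" by blast
    qed
  qed
  then show ?thesis using \<delta>(1) by blast
qed

text \<open>The centres of \<open>kernel_witness\<close> vary with \<open>n\<close>; along a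
  subsequence they converge to some \<open>l\<close>, and a shape within \<open>\<delta> / 2\<close>
  of \<open>l\<close> has witnesses for infinitely many \<open>n\<close>. If the least value
  \<open>m\<close> of \<open>|shape1| + |shape2|\<close> over the compact product were positive, the
  kernel products would tend to 0 uniformly, against the bound 1/32.\<close>

lemma shapes_attained:
  "\<exists>a1 a2 g1 g2. a1 < a2 \<and> g1 < g2 \<and> 0 < g1 \<and> (\<forall>\<alpha>\<in>{a1<..<a2}. \<forall>\<gamma>\<in>{g1<..<g2}.
     \<exists>x\<in>A1. \<exists>y\<in>A2. \<exists>z\<in>A3. x \<noteq> y \<and> shape1 \<alpha> \<gamma> x y z = 0 \<and> shape2 \<alpha> x y z = 0)"
proof -
  let ?BA = "{\<alpha>0 - \<tau>a..\<alpha>0 + \<tau>a}" and ?BG = "{\<gamma>0 - \<tau>g..\<gamma>0 + \<tau>g}"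
  obtain \<delta> where \<delta>: "\<delta> > 0" and "\<forall>n. \<exists>p\<in>?BA \<times> ?BG.
     \<forall>\<alpha>\<in>?BA. \<forall>\<gamma>\<in>?BG. \<bar>\<alpha> - fst p\<bar> \<le> \<delta> \<longrightarrow> \<bar>\<gamma> - snd p\<bar> \<le> \<delta> \<longrightarrow>
       (\<exists>x\<in>A1. \<exists>y\<in>A2. \<exists>z\<in>A3. 1 / 32 \<le> cos_kernel n (shape1 \<alpha> \<gamma> x y z) * cos_kernel n (shape2 \<alpha> x y z))"
    using kernel_witness by (fastforce simp: Bex_def)
  then obtain p where p: "\<And>n. p n \<in> ?BA \<times> ?BG"
    and wit: "\<And>n \<alpha> \<gamma>. \<alpha> \<in> ?BA \<Longrightarrow> \<gamma> \<in> ?BG \<Longrightarrow> \<bar>\<alpha> - fst (p n)\<bar> \<le> \<delta> \<Longrightarrow> \<bar>\<gamma> - snd (p n)\<bar> \<le> \<delta> \<Longrightarrow>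
       (\<exists>x\<in>A1. \<exists>y\<in>A2. \<exists>z\<in>A3. 1 / 32 \<le> cos_kernel n (shape1 \<alpha> \<gamma> x y z) * cos_kernel n (shape2 \<alpha> x y z))"
    by metis
  have "seq_compact (?BA \<times> ?BG)" by (intro compact_imp_seq_compact compact_Times) auto
  then obtain l f where l: "l \<in> ?BA \<times> ?BG" and f: "strict_mono (f :: nat \<Rightarrow> nat)" and lim: "(p \<circ> f) \<longlonglongrightarrow> l"
    using p unfolding seq_compact_def by metis
  have hit: "\<exists>x\<in>A1. \<exists>y\<in>A2. \<exists>z\<in>A3. x \<noteq> y \<and> shape1 \<alpha> \<gamma> x y z = 0 \<and> shape2 \<alpha> x y z = 0"
    if ag: "\<alpha> \<in> ?BA" "\<gamma> \<in> ?BG" and near: "\<bar>\<alpha> - fst l\<bar> < \<delta> / 2" "\<bar>\<gamma> - snd l\<bar> < \<delta> / 2" for \<alpha> \<gamma>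
  proof -
    define F where "F = (\<lambda>t::'a \<times> 'a \<times> 'a. \<bar>shape1 \<alpha> \<gamma> (fst t) (fst (snd t)) (snd (snd t))\<bar> + \<bar>shape2 \<alpha> (fst t) (fst (snd t)) (snd (snd t))\<bar>)"
    have "continuous_on (A1 \<times> A2 \<times> A3) F" unfolding F_def shape1_def shape2_def by (intro continuous_intros)
    moreover have "compact (A1 \<times> A2 \<times> A3)" "A1 \<times> A2 \<times> A3 \<noteq> {}" using compact nonempty by (auto intro!: compact_Times)
    ultimately obtain t where t: "t \<in> A1 \<times> A2 \<times> A3" and tmin: "\<And>u. u \<in> A1 \<times> A2 \<times> A3 \<Longrightarrow> F t \<le> F u"
      using continuous_attains_inf[of "A1 \<times> A2 \<times> A3" F] by blast
    obtain x y z where xyz: "t = (x, y, z)" "x \<in> A1" "y \<in> A2" "z \<in> A3" using t by (cases t) auto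
    define m where "m = F t"
    have m0: "m \<ge> 0" by (simp add: m_def F_def)
    have m2: "m \<le> 2" using box[OF ag xyz(2-4)] unfolding m_def F_def xyz by simp
    have "m = 0"
    proof (rule ccontr)
      assume "m \<noteq> 0"
      then have m: "m > 0" using m0 by simp
      define q where "q = (cos (m / 4))\<^sup>2"
      have "cos (m / 4) < cos 0" using m m2 pi_ge_two by (intro cos_monotone_0_pi) auto
      moreover have "0 \<le> cos (m / 4)" using m m2 pi_ge_two by (intro cos_ge_zero) auto
      ultimately have q: "0 \<le> q" "q < 1" by (auto simp: q_def abs_square_less_1)
      have "(\<lambda>n. (2 * real n + 1)\<^sup>2 * q ^ n) \<longlonglongrightarrow> 0"
      proof (cases "q = 0")
        case True
        have "eventually (\<lambda>n. (2 * real n + 1)\<^sup>2 * q ^ n = 0) sequentially"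
          using eventually_gt_at_top[of 0] by eventually_elim (simp add: True)
        then show ?thesis by (rule tendsto_eventually)
      next
        case False
        then have "q > 0" using q by simp
        then show ?thesis using q(2) by real_asymp
      qed
      then have "(\<lambda>n. (2 * real (f n) + 1)\<^sup>2 * q ^ f n) \<longlonglongrightarrow> 0"
        using LIMSEQ_subseq_LIMSEQ[OF _ f] unfolding o_def by blast
      then have "eventually (\<lambda>n. (2 * real (f n) + 1)\<^sup>2 * q ^ f n < 1 / 32) sequentially"
        by (rule order_tendstoD) simp
      moreover have "eventually (\<lambda>n. dist ((p \<circ> f) n) l < \<delta> / 2) sequentially"
        using tendstoD[OF lim, of "\<delta> / 2"] \<delta> by simp
      ultimately have "eventually (\<lambda>n. (2 * real (f n) + 1)\<^sup>2 * q ^ f n < 1 / 32 \<and> dist ((p \<circ> f) n) l < \<delta> / 2) sequentially"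
        by (rule eventually_conj)
      then obtain n where n: "(2 * real (f n) + 1)\<^sup>2 * q ^ f n < 1 / 32" "dist (p (f n)) l < \<delta> / 2"
        unfolding o_def by (auto simp: eventually_sequentially)
      have "\<bar>fst (p (f n)) - fst l\<bar> < \<delta> / 2" "\<bar>snd (p (f n)) - snd l\<bar> < \<delta> / 2"
        using dist_fst_le[of "p (f n)" l] dist_snd_le[of "p (f n)" l] n(2) by (auto simp: dist_real_def)
      then have "\<bar>\<alpha> - fst (p (f n))\<bar> \<le> \<delta>" "\<bar>\<gamma> - snd (p (f n))\<bar> \<le> \<delta>" using near by linarith+
      from wit[OF ag this] obtain x y z where u: "x \<in> A1" "y \<in> A2" "z \<in> A3"
        and k: "1 / 32 \<le> cos_kernel (f n) (shape1 \<alpha> \<gamma> x y z) * cos_kernel (f n) (shape2 \<alpha> x y z)" by blast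
      have "m \<le> \<bar>shape1 \<alpha> \<gamma> x y z\<bar> + \<bar>shape2 \<alpha> x y z\<bar>" using tmin[of "(x, y, z)"] u unfolding m_def F_def by simp
      then have "cos_kernel (f n) (shape1 \<alpha> \<gamma> x y z) * cos_kernel (f n) (shape2 \<alpha> x y z) \<le> (2 * real (f n) + 1)\<^sup>2 * q ^ f n"
        unfolding q_def using box[OF ag u] m0 by (intro cos_kernel_product_small) auto
      then show False using k n(1) by linarith
    qed
    then have "shape1 \<alpha> \<gamma> x y z = 0 \<and> shape2 \<alpha> x y z = 0" unfolding m_def F_def xyz fst_conv snd_conv by linarith
    then show ?thesis using box[OF ag xyz(2-4)] xyz(2-4) by blast
  qed
  have ll: "fst l \<in> ?BA" "snd l \<in> ?BG" using l by auto
  \<comment> \<open>\<open>l\<close> may lie on the boundary of the closed box; intersecting the box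
    with the neighbourhood of \<open>l\<close> still leaves nonempty open intervals.\<close>
  define a1 a2 g1 g2 where "a1 = max (\<alpha>0 - \<tau>a) (fst l - \<delta> / 2)" and "a2 = min (\<alpha>0 + \<tau>a) (fst l + \<delta> / 2)"
    and "g1 = max (\<gamma>0 - \<tau>g) (snd l - \<delta> / 2)" and "g2 = min (\<gamma>0 + \<tau>g) (snd l + \<delta> / 2)"
  have "a1 < a2" "g1 < g2" "0 < g1" using ll \<delta> \<tau> by (auto simp: a1_def a2_def g1_def g2_def)
  moreover have "\<forall>\<alpha>\<in>{a1<..<a2}. \<forall>\<gamma>\<in>{g1<..<g2}.
     \<exists>x\<in>A1. \<exists>y\<in>A2. \<exists>z\<in>A3. x \<noteq> y \<and> shape1 \<alpha> \<gamma> x y z = 0 \<and> shape2 \<alpha> x y z = 0"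
      proof (intro ballI)
    fix \<alpha> \<gamma> assume "\<alpha> \<in> {a1<..<a2}" "\<gamma> \<in> {g1<..<g2}"
    then have "\<alpha> \<in> ?BA" "\<gamma> \<in> ?BG" "\<bar>\<alpha> - fst l\<bar> < \<delta> / 2" "\<bar>\<gamma> - snd l\<bar> < \<delta> / 2"
      unfolding abs_less_iff by (simp_all add: a1_def a2_def g1_def g2_def)
    then show "\<exists>x\<in>A1. \<exists>y\<in>A2. \<exists>z\<in>A3. x \<noteq> y \<and> shape1 \<alpha> \<gamma> x y z = 0 \<and> shape2 \<alpha> x y z = 0" by (rule hit)
  qed
  ultimately show ?thesis by blast
qed

end

lemma hausdorff_content_of_dim:
  assumes "0 < s" "ereal s < hausdorff_dim E"
  shows "hausdorff_content s E \<noteq> 0"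
proof
  assume "hausdorff_content s E = 0"
  then have "hausdorff_measure s E = 0" using hausdorff_measure_eq_0 assms(1) by blast
  then have "hausdorff_dim E \<le> ereal s"
    unfolding hausdorff_dim_def using assms(1) by (intro Inf_lower) auto
  then show False using assms(2) by simp
qed

text \<open>Points and lines have zero content for \<open>s > 1\<close>, so
  \<open>point_of_local_content\<close> may avoid \<open>x\<close> when choosing \<open>y\<close>,
  and the line through \<open>x\<close> and \<open>y\<close> when choosing \<open>z\<close>.\<close>

lemma noncollinear_content_points:
  fixes E :: "'a::euclidean_space set"
  assumes "hausdorff_content s E \<noteq> 0" "s > 1"
  obtains x y z where "x \<noteq> y" "\<And>t. z \<noteq> x + t *\<^sub>R (y - x)" "\<And>\<rho>. \<rho> > 0 \<Longrightarrow> hausdorff_content s (E \<inter> cball x \<rho>) \<noteq> 0"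
    "\<And>\<rho>. \<rho> > 0 \<Longrightarrow> hausdorff_content s (E \<inter> cball y \<rho>) \<noteq> 0" "\<And>\<rho>. \<rho> > 0 \<Longrightarrow> hausdorff_content s (E \<inter> cball z \<rho>) \<noteq> 0"
proof -
  note pt = point_of_local_content[OF assms(1)]
  obtain x where x: "\<And>\<rho>. \<rho> > 0 \<Longrightarrow> hausdorff_content s (E \<inter> cball x \<rho>) \<noteq> 0"
    using pt[OF hausdorff_content_empty] by blast
  obtain y where y: "y \<noteq> x" "\<And>\<rho>. \<rho> > 0 \<Longrightarrow> hausdorff_content s (E \<inter> cball y \<rho>) \<noteq> 0"
    using pt[OF hausdorff_content_singleton[of s x]] assms(2) by auto
  obtain z where z: "z \<notin> range (\<lambda>t. x + t *\<^sub>R (y - x))" "\<And>\<rho>. \<rho> > 0 \<Longrightarrow> hausdorff_content s (E \<inter> cball z \<rho>) \<noteq> 0"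
    using pt[OF hausdorff_content_line[OF assms(2), of x "y - x"]] by blast
  show ?thesis using that[OF y(1)[symmetric] _ x y(2) z(2)] z(1) by blast
qed

lemma shapes_attained_of_dim:
  fixes E :: "'a::euclidean_space set"
  assumes "DIM('a) \<ge> 3" and E: "compact E" and dim: "hausdorff_dim E > ereal ((2 * real DIM('a) + 2) / 3)"
  shows "\<exists>a1 a2 g1 g2. a1 < a2 \<and> g1 < g2 \<and> 0 < g1 \<and> (\<forall>\<alpha>\<in>{a1<..<a2}. \<forall>\<gamma>\<in>{g1<..<g2}.
     \<exists>x\<in>E. \<exists>y\<in>E. \<exists>z\<in>E. x \<noteq> y \<and> shape1 \<alpha> \<gamma> x y z = 0 \<and> shape2 \<alpha> x y z = 0)"
proof -
  obtain s' where s': "ereal ((2 * real DIM('a) + 2) / 3) < ereal s'" "ereal s' < hausdorff_dim E"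
    using ereal_dense2[OF dim] by blast
  \<comment> \<open>The cap at the dimension is for the estimate that needs \<open>s <= d\<close>.
    It stays above the threshold because \<open>(2 * d + 2) / 3 < d\<close> for
    \<open>d >= 3\<close>.\<close>
  define s where "s = min s' (real DIM('a))"
  have s: "(2 * real DIM('a) + 2) / 3 < s" "s \<le> DIM('a)" "s > 1" "s > 0"
    using s'(1) assms(1) by (auto simp: s_def)
  have "ereal s < hausdorff_dim E" using s'(2) by (rule le_less_trans[rotated]) (simp add: s_def)
  then have content: "hausdorff_content s E \<noteq> 0" by (rule hausdorff_content_of_dim[OF s(4)])
  obtain x0 y0 z0 where xyz: "x0 \<noteq> y0" "\<And>t. z0 \<noteq> x0 + t *\<^sub>R (y0 - x0)"
    and loc: "\<And>\<rho>. \<rho> > 0 \<Longrightarrow> hausdorff_content s (E \<inter> cball x0 \<rho>) \<noteq> 0"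
      "\<And>\<rho>. \<rho> > 0 \<Longrightarrow> hausdorff_content s (E \<inter> cball y0 \<rho>) \<noteq> 0" "\<And>\<rho>. \<rho> > 0 \<Longrightarrow> hausdorff_content s (E \<inter> cball z0 \<rho>) \<noteq> 0"
    by (rule noncollinear_content_points[OF content s(3)]) blast
  define \<eta> where "\<eta> = 3 * s - 2 * real DIM('a) - 2"
  have \<eta>: "\<eta> > 0" using s(1) by (simp add: \<eta>_def)
  obtain c0 where c0: "c0 > 0" and nb: "\<And>\<epsilon>. \<epsilon> > 0 \<Longrightarrow> \<exists>\<alpha>0 \<gamma>0 \<tau>a \<tau>g \<rho> H. 0 < \<tau>a \<and> 0 < \<tau>g \<and> 2 * \<tau>g \<le> \<gamma>0 \<and> 0 < \<rho> \<and> \<rho> \<le> 1 / 2 \<and> 1 \<le> H \<and>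
    (\<forall>\<alpha>\<in>{\<alpha>0 - \<tau>a..\<alpha>0 + \<tau>a}. \<forall>\<gamma>\<in>{\<gamma>0 - \<tau>g..\<gamma>0 + \<tau>g}. \<forall>x\<in>cball x0 \<rho>. \<forall>y\<in>cball y0 \<rho>. \<forall>z\<in>cball z0 \<rho>.
      triangle_bounds x0 y0 c0 \<epsilon> \<alpha>0 \<gamma>0 \<tau>a \<tau>g H \<alpha> \<gamma> x y z)"
    using triangle_neighbourhood[OF xyz] by blast
  define B0 where "B0 = 64 + 4 / c0"
  have B0: "B0 > 0" using c0 by (simp add: B0_def add_pos_pos)
  define \<epsilon> where "\<epsilon> = sqrt (\<eta> / (16 * B0))"
  have \<epsilon>: "\<epsilon> > 0" "16 * B0 * \<epsilon>\<^sup>2 \<le> \<eta>" using \<eta> B0 by (simp_all add: \<epsilon>_def)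
  obtain \<alpha>0 \<gamma>0 \<tau>a \<tau>g \<rho> H where \<tau>: "0 < \<tau>a" "0 < \<tau>g" "2 * \<tau>g \<le> \<gamma>0" and \<rho>: "0 < \<rho>" "\<rho> \<le> 1 / 2" and H: "1 \<le> H" and box:
    "\<forall>\<alpha>\<in>{\<alpha>0 - \<tau>a..\<alpha>0 + \<tau>a}. \<forall>\<gamma>\<in>{\<gamma>0 - \<tau>g..\<gamma>0 + \<tau>g}. \<forall>x\<in>cball x0 \<rho>. \<forall>y\<in>cball y0 \<rho>. \<forall>z\<in>cball z0 \<rho>.
      triangle_bounds x0 y0 c0 \<epsilon> \<alpha>0 \<gamma>0 \<tau>a \<tau>g H \<alpha> \<gamma> x y z"
    using nb[OF \<epsilon>(1)] by blast
  have diam: "norm (u - v) \<le> 1" if "u \<in> E \<inter> cball w \<rho>" "v \<in> E \<inter> cball w \<rho>" for u v w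
    using dist_triangle3[of u v w] that \<rho>(2) by (auto simp: dist_norm[symmetric])
  have comp: "compact (E \<inter> cball w \<rho>)" for w using E by (intro compact_Int compact_cball)
  interpret triangle_box "E \<inter> cball x0 \<rho>" "E \<inter> cball y0 \<rho>" "E \<inter> cball z0 \<rho>" x0 y0 s \<eta> c0 B0 \<epsilon> \<alpha>0 \<gamma>0 \<tau>a \<tau>g H
  proof unfold_locales
    show "triangle_bounds x0 y0 c0 \<epsilon> \<alpha>0 \<gamma>0 \<tau>a \<tau>g H \<alpha> \<gamma> x y z"
      if "\<alpha> \<in> {\<alpha>0 - \<tau>a..\<alpha>0 + \<tau>a}" "\<gamma> \<in> {\<gamma>0 - \<tau>g..\<gamma>0 + \<tau>g}"
        "x \<in> E \<inter> cball x0 \<rho>" "y \<in> E \<inter> cball y0 \<rho>" "z \<in> E \<inter> cball z0 \<rho>" for \<alpha> \<gamma> x y z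
      using box[rule_format, OF that(1,2)] that(3-5) by blast
  qed (rule comp diam loc(1)[OF \<rho>(1)] loc(2)[OF \<rho>(1)] loc(3)[OF \<rho>(1)] s \<eta> \<eta>_def c0 B0_def \<epsilon>(2) \<tau> H; assumption?)+
  obtain a1 a2 g1 g2 where ag: "a1 < a2" "g1 < g2" "0 < g1" and att: "\<forall>\<alpha>\<in>{a1<..<a2}. \<forall>\<gamma>\<in>{g1<..<g2}.
     \<exists>x\<in>E \<inter> cball x0 \<rho>. \<exists>y\<in>E \<inter> cball y0 \<rho>. \<exists>z\<in>E \<inter> cball z0 \<rho>. x \<noteq> y \<and> shape1 \<alpha> \<gamma> x y z = 0 \<and> shape2 \<alpha> x y z = 0"
    by (rule exE[OF shapes_attained]) (elim exE conjE, rule that)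
  have "\<exists>x\<in>E. \<exists>y\<in>E. \<exists>z\<in>E. x \<noteq> y \<and> shape1 \<alpha> \<gamma> x y z = 0 \<and> shape2 \<alpha> x y z = 0"
    if "\<alpha> \<in> {a1<..<a2}" "\<gamma> \<in> {g1<..<g2}" for \<alpha> \<gamma>
    using att[rule_format, OF that] by (elim bexE IntE) (intro bexI)
  with ag show ?thesis by (intro exI conjI ballI)
qed

subsection \<open>The projective plane\<close>

text \<open>Pythagoras: up to sign the sides at \<open>z\<close> are \<open>\<alpha> w + p\<close>
  and \<open>(\<alpha> - 1) w + p\<close> with \<open>p\<close> orthogonal to \<open>w\<close> and
  \<open>|p|^2 = \<gamma> |w|^2\<close>.\<close>

lemma side_lengths_of_shape:
  fixes x y z :: "'a::euclidean_space"
  assumes s1: "shape1 \<alpha> \<gamma> x y z = 0" and s2: "shape2 \<alpha> x y z = 0"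
  shows "(norm (x - z))\<^sup>2 = (\<alpha>\<^sup>2 + \<gamma>) * (norm (x - y))\<^sup>2" "(norm (y - z))\<^sup>2 = ((1 - \<alpha>)\<^sup>2 + \<gamma>) * (norm (x - y))\<^sup>2"
proof -
  define w p where "w = y - x" and "p = z - x - \<alpha> *\<^sub>R w"
  have wp: "w \<bullet> p = 0" using s2 by (simp add: shape2_def w_def p_def)
  have pp: "p \<bullet> p = \<gamma> * (w \<bullet> w)" using s1 by (simp add: shape1_def w_def p_def power2_norm_eq_inner)
  have n: "(norm (t *\<^sub>R w + p))\<^sup>2 = (t\<^sup>2 + \<gamma>) * (norm w)\<^sup>2" for t
    unfolding power2_norm_eq_inner
    by (simp add: inner_add_left inner_add_right inner_commute[of p w] wp pp power2_eq_square distrib_right)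
  have "norm (x - z) = norm (\<alpha> *\<^sub>R w + p)" "norm (x - y) = norm w"
    unfolding norm_minus_commute[of x] by (simp_all add: p_def w_def)
  moreover have "norm (y - z) = norm ((\<alpha> - 1) *\<^sub>R w + p)"
    unfolding norm_minus_commute[of y] by (simp add: p_def w_def algebra_simps)
  ultimately show "(norm (x - z))\<^sup>2 = (\<alpha>\<^sup>2 + \<gamma>) * (norm (x - y))\<^sup>2" "(norm (y - z))\<^sup>2 = ((1 - \<alpha>)\<^sup>2 + \<gamma>) * (norm (x - y))\<^sup>2"
    by (simp_all only: n power2_commute[of 1])
qed

theorem theorem1p4:
  fixes E :: "(real ^ 'd) set"
  assumes "CARD('d) \<ge> 3"
    and "compact E"
    and "hausdorff_dim E > ereal ((2 * real CARD('d) + 2) / 3)"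
  shows "RP2 interior_of
           {hom_coords (norm (x - y)) (norm (x - z)) (norm (y - z)) | x y z.
              x \<in> E \<and> y \<in> E \<and> z \<in> E \<and> x \<noteq> y \<and> x \<noteq> z \<and> y \<noteq> z} \<noteq> {}"
    (is "RP2 interior_of ?S \<noteq> {}")
proof -
  obtain a1 a2 g1 g2 where ag: "a1 < a2" "g1 < g2" "0 < g1" and hit: "\<And>\<alpha> \<gamma>. \<alpha> \<in> {a1<..<a2} \<Longrightarrow> \<gamma> \<in> {g1<..<g2} \<Longrightarrow>
     \<exists>x\<in>E. \<exists>y\<in>E. \<exists>z\<in>E. x \<noteq> y \<and> shape1 \<alpha> \<gamma> x y z = 0 \<and> shape2 \<alpha> x y z = 0"
    using shapes_attained_of_dim[of E] assms by auto
  \<comment> \<open>With \<open>A = |x - z| / |x - y|\<close> and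
    \<open>B = |y - z| / |x - y|\<close>, the equations \<open>A^2 = \<alpha>^2 + \<gamma>\<close>
    and \<open>B^2 = (1 - \<alpha>)^2 + \<gamma>\<close> are solved by
    \<open>\<alpha> = \<phi> (A, B)\<close> and \<open>\<gamma> = \<psi> (A, B)\<close>. Below,
    \<open>h\<close> reads off \<open>(A, B)\<close> in the affine chart with nonzero first
    coordinate.\<close>
  define \<phi> :: "real \<times> real \<Rightarrow> real" where "\<phi> = (\<lambda>p. (1 + (fst p)\<^sup>2 - (snd p)\<^sup>2) / 2)"
  define \<psi> :: "real \<times> real \<Rightarrow> real" where "\<psi> = (\<lambda>p. (fst p)\<^sup>2 - (\<phi> p)\<^sup>2)"
  define O1 where "O1 = {p. 0 < fst p \<and> 0 < snd p \<and> a1 < \<phi> p \<and> \<phi> p < a2 \<and> g1 < \<psi> p \<and> \<psi> p < g2}"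
  define h :: "real^3 \<Rightarrow> real \<times> real" where "h = (\<lambda>v. (v $ 2 / v $ 1, v $ 3 / v $ 1))"
  define V where "V = {v. v $ 1 \<noteq> 0} \<inter> h -` O1"
  have "open O1" unfolding O1_def \<psi>_def \<phi>_def
    by (intro open_Collect_conj open_Collect_less continuous_intros) auto
  moreover have "open {v :: real^3. v $ 1 \<noteq> 0}" by (intro open_Collect_neq continuous_intros)
  moreover have "continuous_on {v. v $ 1 \<noteq> 0} h" unfolding h_def by (intro continuous_intros) auto
  ultimately have V: "open V" unfolding V_def by (intro continuous_open_preimage)
  have V0: "v \<noteq> 0" if "v \<in> V" for v using that by (auto simp: V_def)
  have scale: "c *\<^sub>R v \<in> V" if "v \<in> V" "c \<noteq> 0" for v c using that by (simp add: V_def h_def)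
  \<comment> \<open>\<open>V\<close> is a union of punctured lines through 0, hence the full
    preimage of its image, and openness in \<open>RP2\<close> reduces to openness of
    \<open>V\<close>.\<close>
  have pre: "{v. v \<noteq> 0 \<and> proj_class v \<in> proj_class ` V} = V"
  proof -
    have "v \<in> V" if "c *\<^sub>R v \<in> V" "c \<noteq> 0" for v c using scale[OF that(1), of "inverse c"] that(2) by simp
    then show ?thesis using V0 by (auto simp: proj_class_eq_iff)
  qed
  have op: "openin RP2 (proj_class ` V)" unfolding openin_RP2 pre using V V0 by auto
  have sub: "proj_class ` V \<subseteq> ?S"
  proof
    fix W assume "W \<in> proj_class ` V"
    then obtain v where v: "v \<in> V" "W = proj_class v" by blast
    define A B where "A = v $ 2 / v $ 1" and "B = v $ 3 / v $ 1"
    define \<alpha> \<gamma> where "\<alpha> = (1 + A\<^sup>2 - B\<^sup>2) / 2" and "\<gamma> = A\<^sup>2 - \<alpha>\<^sup>2"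
    have AB: "A > 0" "B > 0" "\<alpha> \<in> {a1<..<a2}" "\<gamma> \<in> {g1<..<g2}" and v1: "v $ 1 \<noteq> 0"
      using v(1) by (auto simp: V_def O1_def h_def \<phi>_def \<psi>_def A_def B_def \<alpha>_def \<gamma>_def)
    obtain x y z where xyz: "x \<in> E" "y \<in> E" "z \<in> E" "x \<noteq> y" "shape1 \<alpha> \<gamma> x y z = 0" "shape2 \<alpha> x y z = 0"
      using hit[OF AB(3,4)] by blast
    have "\<alpha>\<^sup>2 + \<gamma> = A\<^sup>2" "(1 - \<alpha>)\<^sup>2 + \<gamma> = B\<^sup>2"
      by (simp add: \<gamma>_def) (simp add: \<gamma>_def power2_diff, simp add: \<alpha>_def field_simps)
    note len = side_lengths_of_shape[OF xyz(5,6), unfolded this, folded power_mult_distrib]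
    have nz: "norm (x - z) = A * norm (x - y)" "norm (y - z) = B * norm (x - y)"
      using AB len by (auto simp: power2_eq_iff_nonneg)
    have d: "norm (x - y) > 0" using xyz(4) by simp
    have "vector [norm (x - y), norm (x - z), norm (y - z)] = (norm (x - y) / v $ 1) *\<^sub>R v"
      using v1 by (simp add: vec_eq_iff forall_3 nz A_def B_def)
    then have "W = hom_coords (norm (x - y)) (norm (x - z)) (norm (y - z))"
      unfolding hom_coords_def v(2) proj_class_eq_iff using d v1 by (intro exI[of _ "norm (x - y) / v $ 1"]) simp
    moreover have "x \<noteq> z" "y \<noteq> z" using nz AB d by auto
    ultimately show "W \<in> ?S" using xyz(1-4) by blast
  qed
  \<comment> \<open>The midpoint of the box of shapes, turned into side lengths with first side 1,
    shows that \<open>V\<close> is not empty.\<close>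
  define \<alpha> \<gamma> where "\<alpha> = (a1 + a2) / 2" and "\<gamma> = (g1 + g2) / 2"
  define v :: "real^3" where "v = vector [1, sqrt (\<alpha>\<^sup>2 + \<gamma>), sqrt ((1 - \<alpha>)\<^sup>2 + \<gamma>)]"
  have \<gamma>: "\<gamma> > 0" using ag by (simp add: \<gamma>_def)
  then have pos: "\<alpha>\<^sup>2 + \<gamma> > 0" "(1 - \<alpha>)\<^sup>2 + \<gamma> > 0" by (simp_all add: add_nonneg_pos)
  then have "\<phi> (h v) = \<alpha>" by (simp add: \<phi>_def h_def v_def power2_diff field_simps)
  moreover from this have "\<psi> (h v) = \<gamma>" using pos by (simp add: \<psi>_def) (simp add: h_def v_def)
  ultimately have "v \<in> V" using pos ag by (simp add: V_def O1_def) (simp add: h_def v_def \<alpha>_def \<gamma>_def)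
  then show ?thesis using interior_of_maximal[OF sub op] by blast
qed

end
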